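(* Let $G$ be a connected bipartite graph with left vertex set $V_1=\{0,1,\dots,k\}$ and right vertex set $V_2=\{k+1,\dots,n\}$ (both non-empty), and let $A_G=\{e_i+e_j \mid ij\in E(G)\}\subset\mathbb{Z}^{n+1}$. Then the principal $A_G$-determinant is given by $$E_{A_G}(z)=\prod_{\substack{\varnothing\neq I\subset V_1,\ \varnothing\neq J\subset V_2,\ |I|=|J|,\\ G_{I\cup J}\text{ is connected and satisfies }( * )}}\det(z_{I,J})^{u(S(A_G)/Q_{I,J})},$$ where $z_{I,J}$ is the submatrix of $z_G$ with rows in $I$ and columns in $J$.
   Context: Graph notation. $G$ is bipartite with parts $V_1=\{0,\dots,k\}$, $V_2=\{k+1,\dots,n\}$; $e_0,\dots,e_n$ is the standard basis of $\mathbb{R}^{n+1}$. For each edge $ij$ ($i\in V_1$, $j\in V_2$) there is an independent variable $z_{ij}$; $z_G$ is the $(k+1)\times(n-k)$ matrix with rows indexed by $V_1$, columns by $V_2$, and $(i,j)$-entry $z_{ij}$ if $ij\in E(G)$ and $0$ otherwise. For $T\subset V(G)$, $G_T$ is the subgraph induced by $T$; $N(G;T)$ is the set of vertices of $G$ joined by an edge of $G$ to an element of $T$. $P_G=\mathrm{Conv}(A_G)$ is the edge polytope, and $Q_{I,J}=\mathrm{Conv}\{e_i+e_j\mid ij\in E(G_{I\cup J})\}$, which is a face of $P_G$. Condition $( * )$, for a bipartite graph $H$ with parts $W_1,W_2$ (here $I,J$ for $H=G_{I\cup J}$), $|W_1|=|W_2|$: either $|W_1|=1$ and $H$ is connected,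 or $|W_1|>1$ and $|W|<|N(H;W)|$ for every non-empty proper subset $W\subsetneq W_1$. Principal $A$-determinant. Let $A\subset\mathbb{Z}^N$ be a finite set lying in an affine hyperplane $\{\psi=1\}$ for some linear functional $\psi$. For a finite such set $B$ put $f_B(\alpha;z)=\sum_{u\in B}z_u\alpha^u$, $\alpha\in(\mathbb{C}^* )^N$. The $B$-discriminant variety $\nabla_B\subset\mathbb{C}^B$ is the Zariski closure of the projection to $\mathbb{C}^B$ of $\{(\alpha,z)\in(\mathbb{C}^* )^N\times\mathbb{C}^B\mid \partial f_B/\partial\alpha_i(\alpha;z)=0,\ i=1,\dots,N\}$. If $\nabla_B$ is a hypersurface, $B$ is called non-defective and $\Delta_B$ denotes its reduced defining polynomial (unique up to a non-zero scalar); otherwise $\Delta_B=1$. A face $Q$ of $\mathrm{Conv}(A)$ is non-defective if $A\cap Q$ is. Then $$E_A:=\prod_{Q}\Delta_{A\cap Q}^{m_Q},\qquad m_Q=i(Q,A)\cdot u(S(A)/Q),$$ the product being over all non-empty non-defective faces $Q$ of $\mathrm{Conv}(A)$ (including $\mathrm{Conv}(A)$ itself). Here $i(Q,A)=[\mathbb{Z}^N\cap\mathrm{Lin}_{\mathbb{R}}(Q):\mathrm{Lin}_{\mathbb{Z}}(A\cap Q)]$, where $\mathrm{Lin}_{\mathbb R}$, $\mathrm{Lin}_{\mathbb Z}$ denote linear spans over $\mathbb{R}$ and $\mathbb{Z}$. $S(A)$ is the semigroup generated by $A$ and $0$, and $S(A)/Q$ is the subsemigroup of $\mathbb{Z}^N/(\mathbb{Z}^N\cap\mathrm{Lin}_{\mathbb{R}}(Q))$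 generated by $0$ and the images of the elements of $A$. For a semigroup $S$ with group completion $\Xi(S)$, let $K(S)$ and $K_+(S)$ be the convex hulls of $S$ and of $S\setminus\{0\}$ in $\Xi(S)\otimes\mathbb{R}$; the subdiagram volume $u(S)$ is the volume of the closure of $K(S)\setminus K_+(S)$, normalized so that a unimodular simplex with respect to the lattice $\Xi(S)$ has volume $1$; $u(\{0\}):=1$. Since discriminants are defined up to non-zero scalars, the identity is understood up to a non-zero constant factor. *)

theory Defs
  imports
    "HOL-Analysis.Analysis"
    "HOL-Library.Poly_Mapping"
    "HOL-Computational_Algebra.Group_Closure"
    "HOL-Computational_Algebra.Squarefree"
    "Jordan_Normal_Form.Determinant"
    "Jordan_Normal_Form.DL_Submatrix"
begin

no_notation vec_index (infixl \<open>$\<close> 100)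
no_notation scalar_prod (infix \<open>\<bullet>\<close> 70)
hide_const (open) Matrix.orthogonal
hide_fact (open) Matrix.orthogonal_def

section \<open>Complex polynomials in variables \<open>z\<^sub>u\<close>\<close>

type_synonym 'u cpoly = "('u \<Rightarrow>\<^sub>0 nat) \<Rightarrow>\<^sub>0 complex"

definition pvar :: "'u \<Rightarrow> 'u cpoly" where
  "pvar u = Poly_Mapping.single (Poly_Mapping.single u 1) 1"

definition pconst :: "complex \<Rightarrow> 'u cpoly" where
  "pconst c = Poly_Mapping.single 0 c"

definition pvars :: "'u cpoly \<Rightarrow> 'u set" where
  "pvars p = (\<Union>m \<in> Poly_Mapping.keys p. Poly_Mapping.keys m)"

definition peval :: "('u \<Rightarrow> complex) \<Rightarrow> 'u cpoly \<Rightarrow> complex" where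
  "peval z p = (\<Sum>m \<in> Poly_Mapping.keys p. Poly_Mapping.lookup p m *
     (\<Prod>u \<in> Poly_Mapping.keys m. z u ^ Poly_Mapping.lookup m u))"


section \<open>Discriminants\<close>

text \<open>The affine space \<open>\<complex>\<^sup>B\<close> consists of the functions on \<open>B\<close>, extended by
  \<^const>\<open>undefined\<close> outside of \<open>B\<close>.\<close>

definition coeff_space :: "'u set \<Rightarrow> ('u \<Rightarrow> complex) set" where
  "coeff_space B = B \<rightarrow>\<^sub>E UNIV"

definition laurent :: "(int ^ 'n::finite) set \<Rightarrow> (int ^ 'n \<Rightarrow> complex) \<Rightarrow> ('n \<Rightarrow> complex) \<Rightarrow> complex" where
  "laurent B z \<alpha> = (\<Sum>u\<in>B. z u * (\<Prod>i\<in>UNIV. \<alpha> i powi (u $ i)))"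

definition partial_deriv :: "'n \<Rightarrow> (('n \<Rightarrow> complex) \<Rightarrow> complex) \<Rightarrow> ('n \<Rightarrow> complex) \<Rightarrow> complex" where
  "partial_deriv i f \<alpha> = deriv (\<lambda>t. f (\<alpha>(i := t))) (\<alpha> i)"

definition singular_coeffs :: "(int ^ 'n::finite) set \<Rightarrow> (int ^ 'n \<Rightarrow> complex) set" where
  "singular_coeffs B = {z \<in> coeff_space B. \<exists>\<alpha>. (\<forall>i. \<alpha> i \<noteq> 0) \<and> (\<forall>i. partial_deriv i (laurent B z) \<alpha> = 0)}"

definition zero_locus :: "'u set \<Rightarrow> 'u cpoly \<Rightarrow> ('u \<Rightarrow> complex) set" where
  "zero_locus B p = {z \<in> coeff_space B. peval z p = 0}"

definition zariski_closure :: "'u set \<Rightarrow> ('u \<Rightarrow> complex) set \<Rightarrow> ('u \<Rightarrow> complex) set" where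
  "zariski_closure B X = coeff_space B \<inter> \<Inter> {zero_locus B p |p. pvars p \<subseteq> B \<and> X \<subseteq> zero_locus B p}"

definition discriminant_variety :: "(int ^ 'n::finite) set \<Rightarrow> (int ^ 'n \<Rightarrow> complex) set" where
  "discriminant_variety B = zariski_closure B (singular_coeffs B)"

definition hypersurface :: "'u set \<Rightarrow> ('u \<Rightarrow> complex) set \<Rightarrow> bool" where
  "hypersurface B X \<longleftrightarrow> (\<exists>p. pvars p \<subseteq> B \<and> pvars p \<noteq> {} \<and> X = zero_locus B p)"

definition reduced_defining_poly :: "'u set \<Rightarrow> ('u \<Rightarrow> complex) set \<Rightarrow> 'u cpoly \<Rightarrow> bool" where
  "reduced_defining_poly B X p \<longleftrightarrow> pvars p \<subseteq> B \<and> squarefree p \<and> X = zero_locus B p"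

definition nondefective :: "(int ^ 'n::finite) set \<Rightarrow> bool" where
  "nondefective B \<longleftrightarrow> hypersurface B (discriminant_variety B)"

text \<open>The reduced defining polynomial is determined only up to a non-zero scalar; one is chosen.\<close>

definition discriminant :: "(int ^ 'n::finite) set \<Rightarrow> (int ^ 'n) cpoly" where
  "discriminant B =
     (if nondefective B then SOME p. reduced_defining_poly B (discriminant_variety B) p else 1)"


section \<open>Subdiagram volumes\<close>

inductive_set semigroup_closure :: "'a::monoid_add set \<Rightarrow> 'a set" for X where
  zero: "0 \<in> semigroup_closure X"
| base: "x \<in> X \<Longrightarrow> x \<in> semigroup_closure X"
| add: "x \<in> semigroup_closure X \<Longrightarrow> y \<in> semigroup_closure X \<Longrightarrow> x + y \<in> semigroup_closure X"

definition lattice_basis :: "'a::real_vector set \<Rightarrow> 'a set \<Rightarrow> bool" where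
  "lattice_basis \<Lambda> b \<longleftrightarrow> independent b \<and> group_closure b = \<Lambda>"

text \<open>Volume of a subset of the real span of a lattice \<open>\<Lambda>\<close>: Lebesgue measure in the coordinates of a
  \<open>\<int>\<close>-basis of \<open>\<Lambda>\<close> (it does not depend on the basis), multiplied by \<open>d!\<close>, where \<open>d\<close> is the rank,
  so that unimodular simplices have volume 1.\<close>

definition lattice_volume :: "'a::euclidean_space set \<Rightarrow> 'a set \<Rightarrow> real" where
  "lattice_volume \<Lambda> X = (let b = SOME b. lattice_basis \<Lambda> b in
     fact (card b) * measure (\<Pi>\<^sub>M v\<in>b. lborel)
       {c \<in> b \<rightarrow>\<^sub>E (UNIV :: real set). (\<Sum>v\<in>b. c v *\<^sub>R v) \<in> X})"

text \<open>Here \<open>S\<close> is a semigroup contained in a discrete subgroup of a Euclidean space.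
  Its group completion is then the subgroup which it generates, and the tensor product of the latter
  with \<open>\<real>\<close> is its real span, so that convex hulls and closures can be formed in the ambient space.\<close>

definition subdiagram_volume :: "'a::euclidean_space set \<Rightarrow> real" where
  "subdiagram_volume S =
     (if S = {0} then 1
      else lattice_volume (group_closure S) (closure (convex hull S - convex hull (S - {0}))))"


section \<open>The principal determinant\<close>

definition rvec :: "int ^ 'n \<Rightarrow> real ^ 'n::finite" where
  "rvec u = (\<chi> i. real_of_int (u $ i))"

definition newton_polytope :: "(int ^ 'n::finite) set \<Rightarrow> (real ^ 'n) set" where
  "newton_polytope A = convex hull (rvec ` A)"

definition face_points :: "(int ^ 'n::finite) set \<Rightarrow> (real ^ 'n) set \<Rightarrow> (int ^ 'n) set" where
  "face_points A Q = {u \<in> A. rvec u \<in> Q}"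

definition subgroup_index :: "'a::ab_group_add set \<Rightarrow> 'a set \<Rightarrow> nat" where
  "subgroup_index G H = card (G // {(x, y). x \<in> G \<and> y \<in> G \<and> x - y \<in> H})"

definition face_index :: "(real ^ 'n::finite) set \<Rightarrow> (int ^ 'n) set \<Rightarrow> nat" where
  "face_index Q A = subgroup_index {v. rvec v \<in> span Q} (group_closure (face_points A Q))"

text \<open>The quotient of \<open>\<real>\<^sup>N\<close> by a linear subspace \<open>L\<close> is realised as the orthogonal
  complement of \<open>L\<close>; the quotient map is \<open>x\<close> minus the orthogonal projection of \<open>x\<close> to \<open>L\<close>.
  Its restriction to integer points identifies the quotient of \<open>\<int>\<^sup>N\<close> by \<open>\<int>\<^sup>N \<inter> L\<close> with
  its image.\<close>

definition quotient_map_by :: "'a::euclidean_space set \<Rightarrow> 'a \<Rightarrow> 'a" where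
  "quotient_map_by L x = x - closest_point L x"

lemma closest_point_subspace:
  fixes L :: "'a::euclidean_space set"
  assumes L: "subspace L" and y: "y \<in> L" and orth: "\<And>w. w \<in> L \<Longrightarrow> (x - y) \<bullet> w = 0"
  shows "closest_point L x = y"
proof (rule closest_point_unique[symmetric])
  show "convex L" "closed L"
    using L by (simp_all add: subspace_imp_convex closed_subspace)
  show "y \<in> L" by (fact y)
  show "\<forall>z\<in>L. dist x y \<le> dist x z"
  proof
    fix z assume "z \<in> L"
    then have "y - z \<in> L" using L y by (simp add: subspace_diff)
    then have "orthogonal (x - y) (y - z)" using orth by (simp add: orthogonal_def)
    then have "(norm (x - y + (y - z)))\<^sup>2 = (norm (x - y))\<^sup>2 + (norm (y - z))\<^sup>2"
      by (rule norm_add_Pythagorean)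
    then have "(norm (x - y))\<^sup>2 \<le> (norm (x - z))\<^sup>2" by simp
    then show "dist x y \<le> dist x z" by (simp add: dist_norm)
  qed
qed

lemma quotient_map_by_decomp:
  fixes L :: "'a::euclidean_space set"
  assumes L: "subspace L"
  shows "x - quotient_map_by L x \<in> L"
    and "w \<in> L \<Longrightarrow> quotient_map_by L x \<bullet> w = 0"
proof -
  obtain y v where yv: "y \<in> span L" "\<And>w. w \<in> span L \<Longrightarrow> orthogonal v w" "x = y + v"
    using orthogonal_subspace_decomp_exists[of L x] by metis
  have sp: "span L = L" using L by (simp add: span_eq_iff)
  have v: "v \<bullet> w = 0" if "w \<in> L" for w
    using yv(2) that by (simp add: sp orthogonal_def)
  have "closest_point L x = y"
    by (rule closest_point_subspace[OF L]) (use yv v in \<open>simp_all add: sp\<close>)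
  then have "quotient_map_by L x = v" using yv(3) by (simp add: quotient_map_by_def)
  then show "x - quotient_map_by L x \<in> L" and "w \<in> L \<Longrightarrow> quotient_map_by L x \<bullet> w = 0"
    using yv v by (simp_all add: sp)
qed

lemma quotient_map_by_eqI:
  fixes L :: "'a::euclidean_space set"
  assumes "subspace L" "x - v \<in> L" "\<And>w. w \<in> L \<Longrightarrow> v \<bullet> w = 0"
  shows "quotient_map_by L x = v"
  using closest_point_subspace[of L "x - v" x] assms by (simp add: quotient_map_by_def)

lemma linear_quotient_map_by:
  fixes L :: "'a::euclidean_space set"
  assumes L: "subspace L"
  shows "linear (quotient_map_by L)"
proof (rule linearI)
  note d = quotient_map_by_decomp[OF L]
  show "quotient_map_by L (x + y) = quotient_map_by L x + quotient_map_by L y" for x y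
    using subspace_add[OF L d(1)[of x] d(1)[of y]] d(2)
    by (intro quotient_map_by_eqI[OF L]) (simp_all add: algebra_simps inner_add_left)
  show "quotient_map_by L (r *\<^sub>R x) = r *\<^sub>R quotient_map_by L x" for r x
    using subspace_mul[OF L d(1)[of x], of r] d(2)
    by (intro quotient_map_by_eqI[OF L]) (simp_all add: algebra_simps)
qed

lemma quotient_map_by_eq_iff:
  fixes L :: "'a::euclidean_space set"
  assumes L: "subspace L"
  shows "quotient_map_by L x = quotient_map_by L y \<longleftrightarrow> x - y \<in> L"
proof
  note d = quotient_map_by_decomp[OF L]
  assume "quotient_map_by L x = quotient_map_by L y"
  then show "x - y \<in> L"
    using subspace_diff[OF L d(1)[of x] d(1)[of y]] by simp
next
  note d = quotient_map_by_decomp[OF L]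
  assume "x - y \<in> L"
  then show "quotient_map_by L x = quotient_map_by L y"
    using subspace_add[OF L _ d(1)[of y]] d(2)
    by (intro quotient_map_by_eqI[OF L]) fastforce+
qed

definition quotient_semigroup :: "(int ^ 'n::finite) set \<Rightarrow> (real ^ 'n) set \<Rightarrow> (real ^ 'n) set" where
  "quotient_semigroup A Q = semigroup_closure ((\<lambda>u. quotient_map_by (span Q) (rvec u)) ` A)"

text \<open>For a face \<open>Q\<close> of the polytope of \<open>A\<close>, the subdiagram volume is a positive integer: the closure
  in question is a union of lattice pyramids with apex \<open>0\<close>. Taking the floor is therefore a mere
  conversion to \<^typ>\<open>nat\<close>.\<close>

definition face_volume :: "(int ^ 'n::finite) set \<Rightarrow> (real ^ 'n) set \<Rightarrow> nat" where
  "face_volume A Q = nat \<lfloor>subdiagram_volume (quotient_semigroup A Q)\<rfloor>"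

text \<open>To be used for finite \<open>A\<close> in an affine hyperplane \<open>{\<psi> = 1}\<close>, \<open>\<psi>\<close> a linear functional.\<close>

definition principal_determinant :: "(int ^ 'n::finite) set \<Rightarrow> (int ^ 'n) cpoly" where
  "principal_determinant A =
     (\<Prod>Q | Q face_of newton_polytope A \<and> Q \<noteq> {} \<and> nondefective (face_points A Q).
        discriminant (face_points A Q) ^ (face_index Q A * face_volume A Q))"


section \<open>Bipartite graphs\<close>

text \<open>A graph with vertices in \<^typ>\<open>nat\<close> is given by a set \<open>T\<close> of vertices and a set \<open>E\<close> of pairs.
  The graph is undirected; in a bipartite graph every edge is listed once, its left end first.\<close>

definition graph_connected :: "nat set \<Rightarrow> (nat \<times> nat) set \<Rightarrow> bool" where
  "graph_connected T E \<longleftrightarrow> (\<forall>x\<in>T. \<forall>y\<in>T. (x, y) \<in> (E \<union> E\<inverse>)\<^sup>*)"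

definition induced_edges :: "(nat \<times> nat) set \<Rightarrow> nat set \<Rightarrow> (nat \<times> nat) set" where
  "induced_edges E T = E \<inter> T \<times> T"

definition neighbours :: "(nat \<times> nat) set \<Rightarrow> nat set \<Rightarrow> nat set" where
  "neighbours E W = (E \<union> E\<inverse>) `` W"

definition condition_star :: "nat set \<Rightarrow> nat set \<Rightarrow> (nat \<times> nat) set \<Rightarrow> bool" where
  "condition_star W1 W2 F \<longleftrightarrow> card W1 = card W2 \<and>
     (card W1 = 1 \<and> graph_connected (W1 \<union> W2) F \<or>
      card W1 > 1 \<and> (\<forall>W. W \<noteq> {} \<and> W \<subset> W1 \<longrightarrow> card W < card (neighbours F W)))"

text \<open>The standard basis \<open>e\<^sub>0, \<dots>, e\<^sub>n\<close>, where \<open>n + 1\<close> is the number of elements of \<open>'n\<close>: the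
  function \<^term>\<open>from_nat_into UNIV\<close> enumerates \<open>'n\<close> by \<open>{..<n + 1}\<close>.\<close>

definition std_basis :: "nat \<Rightarrow> int ^ 'n::finite" where
  "std_basis i = axis (from_nat_into UNIV i) 1"

definition edge_vectors :: "(nat \<times> nat) set \<Rightarrow> (int ^ 'n::finite) set" where
  "edge_vectors E = {std_basis i + std_basis j |i j. (i, j) \<in> E}"

definition edge_face :: "(nat \<times> nat) set \<Rightarrow> nat set \<Rightarrow> nat set \<Rightarrow> (real ^ 'n::finite) set" where
  "edge_face E I J = convex hull (rvec ` edge_vectors (induced_edges E (I \<union> J)))"

text \<open>Column \<open>c\<close> of the matrix belongs to the vertex \<open>k + 1 + c\<close>, and the variable of
  an edge \<open>ij\<close> is the one indexed by \<open>e\<^sub>i + e\<^sub>j\<close>.\<close>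

definition edge_matrix :: "nat \<Rightarrow> nat \<Rightarrow> (nat \<times> nat) set \<Rightarrow> (int ^ 'n::finite) cpoly mat" where
  "edge_matrix k n E = mat (k + 1) (n - k) (\<lambda>(i, c).
     if (i, k + 1 + c) \<in> E then pvar (std_basis i + std_basis (k + 1 + c)) else 0)"

definition edge_submatrix ::
    "nat \<Rightarrow> nat \<Rightarrow> (nat \<times> nat) set \<Rightarrow> nat set \<Rightarrow> nat set \<Rightarrow> (int ^ 'n::finite) cpoly mat" where
  "edge_submatrix k n E I J = submatrix (edge_matrix k n E) I {c. k + 1 + c \<in> J}"

end

(*
  The discriminant of a face spanned by an edge set F with rows I and columns J describes the
  matrices supported on F that have left and right kernel vectors without zero entries.

  If its closure V is a hypersurface, it is the zero set of a polynomial involving some variable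
  z_ij, and no non-zero polynomial independent of z_ij vanishes on V. By Hall's theorem, a failure
  of the condition on the graph yields a set of rows (or columns) with equally many neighbours,
  matched to them, whose block does not involve z_ij; its determinant vanishes on V.

  Conversely, under the condition every singular matrix is a limit of matrices with full kernel
  vectors: the support of a right kernel vector can be enlarged step by step, because by Hall's
  condition the rows not meeting the support are too few to determine a vector on its complement;
  then the left kernel vector, given by cofactors, is generically full. Hence V is the zero set of
  the determinant. That the determinant is, up to a constant, its only squarefree equation needs
  neither factoriality nor the Nullstellensatz: a polynomial p without zeros outside of {det = 0} is
  constant on the lines contained in the sets {det = s}, s non-zero. These lines, together with the
  homogeneity of p in each row and column, show that p is a constant times a power of the
  determinant.

  The faces of the polytope are exposed, and a face with a connected edge set F consists of all
  edges between the vertices of F; these are the faces Q_{I,J}. Connectedness also makes the lattice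
  index 1.
*)
theory Submission
  imports Defs "HOL-Computational_Algebra.Fundamental_Theorem_Algebra"
begin

section \<open>Polynomial functions\<close>

text \<open>The strictness of Hall's inequality drives both halves. It gives every non-empty proper
  set of rows a spare column, so that after deletion of any row i and any column j, edge or not, a
  perfect matching remains. Hence every cofactor of the generic matrix is a non-zero polynomial, and
  rows and columns of cofactors supply kernel vectors without zeros. A tight proper set of rows
  would instead put the matrix into block triangular form, and its determinant would factor.

  The obstacle is density: the matrices with full kernel vectors are given by an existential
  condition, and a polynomial vanishing on them has to vanish on all singular matrices. Limits are
  taken along complex lines only. A polynomial on a line has finitely many zeros or vanishes
  identically, and this serves in place of both continuity and the irreducibility of affine space.

  The subdiagram volumes are carried along as exponents; of the two factors of the multiplicity,
  only the lattice index is evaluated.\<close>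

definition meval :: "('u \<Rightarrow> complex) \<Rightarrow> ('u \<Rightarrow>\<^sub>0 nat) \<Rightarrow> complex" where
  "meval z m = (\<Prod>u \<in> Poly_Mapping.keys m. z u ^ Poly_Mapping.lookup m u)"

lemma meval_superset:
  assumes "finite K" "Poly_Mapping.keys m \<subseteq> K"
  shows "meval z m = (\<Prod>u\<in>K. z u ^ Poly_Mapping.lookup m u)"
  unfolding meval_def
  by (rule prod.mono_neutral_left) (use assms in \<open>auto simp: in_keys_iff\<close>)

lemma meval_0 [simp]: "meval z 0 = 1"
  by (simp add: meval_def)

lemma meval_add: "meval z (m + m') = meval z m * meval z m'"
proof -
  let ?K = "Poly_Mapping.keys m \<union> Poly_Mapping.keys m'"
  have "Poly_Mapping.keys (m + m') \<subseteq> ?K" by (rule keys_add)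
  then show ?thesis
    by (simp add: meval_superset[of ?K] lookup_add power_add prod.distrib)
qed

lemma peval_superset:
  assumes "finite K" "Poly_Mapping.keys p \<subseteq> K"
  shows "peval z p = (\<Sum>m\<in>K. Poly_Mapping.lookup p m * meval z m)"
  unfolding peval_def meval_def
  by (rule sum.mono_neutral_left) (use assms in \<open>auto simp: in_keys_iff\<close>)

lemma peval_meval: "peval z p = (\<Sum>m\<in>Poly_Mapping.keys p. Poly_Mapping.lookup p m * meval z m)"
  by (rule peval_superset) auto

lemma peval_0 [simp]: "peval z 0 = 0"
  by (simp add: peval_def)

lemma peval_single: "peval z (Poly_Mapping.single m c) = c * meval z m"
  by (subst peval_superset[of "{m}"]) auto

lemma peval_1 [simp]: "peval z 1 = 1"
  using peval_single[of z 0 1] by simp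

lemma peval_pconst [simp]: "peval z (pconst c) = c"
  by (simp add: pconst_def peval_single)

lemma peval_pvar [simp]: "peval z (pvar u) = z u"
  by (simp add: pvar_def peval_single meval_def)

lemma peval_add: "peval z (p + q) = peval z p + peval z q"
proof -
  let ?K = "Poly_Mapping.keys p \<union> Poly_Mapping.keys q"
  have "Poly_Mapping.keys (p + q) \<subseteq> ?K" by (rule keys_add)
  then show ?thesis
    by (simp add: peval_superset[of ?K] lookup_add ring_distribs sum.distrib)
qed

lemma peval_sum: "peval z (sum f A) = (\<Sum>x\<in>A. peval z (f x))"
  by (induction A rule: infinite_finite_induct) (simp_all add: peval_add)

lemma poly_mapping_sum_single:
  "p = (\<Sum>m\<in>Poly_Mapping.keys p. Poly_Mapping.single m (Poly_Mapping.lookup p m))"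
  by (rule poly_mapping_eqI)
    (simp add: lookup_sum lookup_single when_def sum.delta' in_keys_iff)

lemma peval_mult: "peval z (p * q) = peval z p * peval z q"
proof -
  have "p * q = (\<Sum>m\<in>Poly_Mapping.keys p. \<Sum>m'\<in>Poly_Mapping.keys q.
      Poly_Mapping.single (m + m') (Poly_Mapping.lookup p m * Poly_Mapping.lookup q m'))"
    by (subst (1) poly_mapping_sum_single[of p], subst (1) poly_mapping_sum_single[of q])
      (simp add: sum_product mult_single)
  then show ?thesis
    by (simp add: peval_sum peval_single meval_add peval_meval[of z p] peval_meval[of z q]
        sum_product mult_ac)
qed

lemma comm_ring_hom_peval: "comm_ring_hom (peval z)"
  by unfold_locales (simp_all add: peval_add peval_mult)

lemma peval_power: "peval z (p ^ n) = peval z p ^ n"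
  by (induction n) (simp_all add: peval_mult)

lemma peval_cong:
  assumes "\<And>u. u \<in> pvars p \<Longrightarrow> z u = z' u"
  shows "peval z p = peval z' p"
  unfolding peval_def using assms
  by (intro sum.cong arg_cong2[where f = "(*)"] prod.cong refl arg_cong2[where f = "(^)"])
    (auto simp: pvars_def)

lemma pvars_0 [simp]: "pvars 0 = {}" and pvars_1 [simp]: "pvars 1 = {}"
  by (simp_all add: pvars_def)

lemma pvars_pvar: "pvars (pvar u) = {u}"
  by (simp add: pvars_def pvar_def)

lemma pvars_add: "pvars (p + q) \<subseteq> pvars p \<union> pvars q"
  using keys_add[of p q] unfolding pvars_def by blast

lemma pvars_uminus: "pvars (- p) = pvars p"
  unfolding pvars_def by (simp add: Poly_Mapping.keys_def)

lemma pvars_mult: "pvars (p * q) \<subseteq> pvars p \<union> pvars q"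
proof
  fix u assume "u \<in> pvars (p * q)"
  then obtain m where m: "m \<in> Poly_Mapping.keys (p * q)" "u \<in> Poly_Mapping.keys m"
    by (auto simp: pvars_def)
  then obtain a b where "m = a + b" "a \<in> Poly_Mapping.keys p" "b \<in> Poly_Mapping.keys q"
    using keys_mult[of p q] by blast
  with m(2) keys_add[of a b] show "u \<in> pvars p \<union> pvars q"
    by (auto simp: pvars_def)
qed

lemma pvars_sum: "(\<And>x. x \<in> A \<Longrightarrow> pvars (f x) \<subseteq> V) \<Longrightarrow> pvars (sum f A) \<subseteq> V"
proof (induction A rule: infinite_finite_induct)
  case (insert x A)
  have "pvars (f x + sum f A) \<subseteq> pvars (f x) \<union> pvars (sum f A)" by (rule pvars_add)
  also have "\<dots> \<subseteq> V" using insert by blast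
  finally show ?case using insert by simp
qed simp_all

lemma pvars_prod: "(\<And>x. x \<in> A \<Longrightarrow> pvars (f x) \<subseteq> V) \<Longrightarrow> pvars (prod f A) \<subseteq> V"
proof (induction A rule: infinite_finite_induct)
  case (insert x A)
  have "pvars (f x * prod f A) \<subseteq> pvars (f x) \<union> pvars (prod f A)" by (rule pvars_mult)
  also have "\<dots> \<subseteq> V" using insert by blast
  finally show ?case using insert by simp
qed simp_all

lemma pvars_det:
  assumes A: "A \<in> carrier_mat m m" and V: "\<And>i j. i < m \<Longrightarrow> j < m \<Longrightarrow> pvars (A $$ (i, j)) \<subseteq> V"
  shows "pvars (Determinant.det A) \<subseteq> V"
  unfolding det_def'[OF A]
proof (rule pvars_sum)
  fix \<pi> assume "\<pi> \<in> {\<pi>. \<pi> permutes {0..<m}}"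
  then have \<pi>: "\<pi> i < m" if "i < m" for i
    using that by (metis atLeastLessThan_iff mem_Collect_eq permutes_in_image zero_le)
  have "pvars (signof \<pi> :: 'a cpoly) = {}"
    by (simp add: sign_def pvars_uminus)
  moreover have "pvars (\<Prod>i = 0..<m. A $$ (i, \<pi> i)) \<subseteq> V"
    by (rule pvars_prod) (use V \<pi> in auto)
  ultimately show "pvars (signof \<pi> * (\<Prod>i = 0..<m. A $$ (i, \<pi> i))) \<subseteq> V"
    using pvars_mult[of "signof \<pi>" "\<Prod>i = 0..<m. A $$ (i, \<pi> i)"] by blast
qed

text \<open>Induction on the number of variables: for fixed values of the others, the sum is a
  univariate polynomial in the value t at \<open>v\<close>, and its coefficient at
  \<open>f v\<close> collects the g in M with \<open>g v = f v\<close>. These are still told apart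
  by the remaining variables, as the third assumption requires.\<close>

lemma monomials_independent:
  fixes c :: "('u \<Rightarrow> nat) \<Rightarrow> complex"
  assumes "finite V" "finite M"
    and "\<And>f g. f \<in> M \<Longrightarrow> g \<in> M \<Longrightarrow> (\<And>u. u \<in> V \<Longrightarrow> f u = g u) \<Longrightarrow> f = g"
    and "\<And>z. (\<Sum>f\<in>M. c f * (\<Prod>u\<in>V. z u ^ f u)) = 0"
    and "f \<in> M"
  shows "c f = 0"
  using assms
proof (induction V arbitrary: M f rule: finite_induct)
  case empty
  then have "M = {f}" by blast
  with empty(3) show ?case by simp
next
  case (insert v V)
  define M' where "M' = {g \<in> M. g v = f v}"
  have "(\<Sum>g\<in>M'. c g * (\<Prod>u\<in>V. z u ^ g u)) = 0" for z
  proof -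
    define P where "P = (\<Sum>g\<in>M. monom (c g * (\<Prod>u\<in>V. z u ^ g u)) (g v))"
    have "poly P t = 0" for t
    proof -
      have "poly P t = (\<Sum>g\<in>M. c g * (\<Prod>u\<in>insert v V. (z(v := t)) u ^ g u))"
        unfolding P_def poly_sum poly_monom
      proof (rule sum.cong[OF refl])
        fix g
        have "(\<Prod>u\<in>V. (z(v := t)) u ^ g u) = (\<Prod>u\<in>V. z u ^ g u)"
          by (rule prod.cong) (use insert.hyps in auto)
        then show "c g * (\<Prod>u\<in>V. z u ^ g u) * t ^ g v = c g * (\<Prod>u\<in>insert v V. (z(v := t)) u ^ g u)"
          using insert.hyps by simp
      qed
      also have "\<dots> = 0" by (rule insert.prems(3))
      finally show ?thesis .
    qed
    then have "P = 0" using poly_all_0_iff_0 by blast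
    then have "0 = coeff P (f v)" by simp
    also have "\<dots> = (\<Sum>g\<in>M'. c g * (\<Prod>u\<in>V. z u ^ g u))"
      using insert.prems(1) by (simp add: P_def M'_def coeff_sum sum.If_cases Int_def)
    finally show ?thesis by simp
  qed
  moreover have "g = h" if "g \<in> M'" "h \<in> M'" "\<And>u. u \<in> V \<Longrightarrow> g u = h u" for g h
  proof (rule insert.prems(2))
    show "g \<in> M" "h \<in> M" "\<And>u. u \<in> insert v V \<Longrightarrow> g u = h u"
      using that by (auto simp: M'_def)
  qed
  ultimately show ?case
    using insert.IH[of M' f] insert.prems(1,4) by (auto simp: M'_def)
qed

lemma meval_sum_eq_0_imp:
  assumes "finite M" "\<And>z. (\<Sum>m\<in>M. c m * meval z m) = 0" "m \<in> M"
  shows "c m = 0"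
proof -
  define V where "V = (\<Union>m\<in>M. Poly_Mapping.keys m)"
  have V: "finite V" using assms(1) by (simp add: V_def)
  have inj: "inj_on Poly_Mapping.lookup M" by (simp add: inj_on_def lookup_inject)
  \<comment> \<open>The coefficients have to be indexed by functions instead of finitely supported
    maps; \<open>Abs_poly_mapping\<close> undoes \<open>lookup\<close>.\<close>
  define c' where "c' f = c (Abs_poly_mapping f)" for f
  have c': "c' (Poly_Mapping.lookup m) = c m" for m
    by (simp add: c'_def lookup_inverse)
  have "c' (Poly_Mapping.lookup m) = 0"
  proof (rule monomials_independent[OF V, of "Poly_Mapping.lookup ` M"])
    fix z
    have "(\<Sum>f\<in>Poly_Mapping.lookup ` M. c' f * (\<Prod>u\<in>V. z u ^ f u)) = (\<Sum>m\<in>M. c m * meval z m)"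
      unfolding sum.reindex[OF inj] o_def c'
      by (intro sum.cong refl arg_cong2[where f = "(*)"] meval_superset[symmetric] V)
        (auto simp: V_def)
    then show "(\<Sum>f\<in>Poly_Mapping.lookup ` M. c' f * (\<Prod>u\<in>V. z u ^ f u)) = 0"
      using assms(2) by simp
  next
    fix f g assume fg: "f \<in> Poly_Mapping.lookup ` M" "g \<in> Poly_Mapping.lookup ` M"
      and eq: "\<And>u. u \<in> V \<Longrightarrow> f u = g u"
    have "f u = g u" for u
    proof (cases "u \<in> V")
      case False
      then show ?thesis using fg by (auto simp: V_def in_keys_iff)
    qed (rule eq)
    then show "f = g" by auto
  qed (use assms in auto)
  then show ?thesis by (simp add: c')
qed

lemma peval_eq_0_imp:
  assumes "\<And>z. peval z p = 0"
  shows "p = 0"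
proof (rule ccontr)
  assume "p \<noteq> 0"
  then obtain m where m: "m \<in> Poly_Mapping.keys p" by (metis all_not_in_conv keys_eq_empty)
  have "Poly_Mapping.lookup p m = 0"
    by (rule meval_sum_eq_0_imp[OF finite_keys _ m]) (use assms in \<open>simp add: peval_meval\<close>)
  with m show False by (simp add: in_keys_iff)
qed

lemma peval_inject:
  assumes "\<And>z. peval z p = peval z q"
  shows "p = q"
proof -
  interpret comm_ring_hom "peval z" for z by (rule comm_ring_hom_peval)
  have "p - q = 0" by (rule peval_eq_0_imp) (simp add: hom_minus assms)
  then show ?thesis by simp
qed

text \<open>If setting x to 0 never changed the value, the monomials containing x, which this
  substitution kills, would add up to the zero function, contrary to their independence.\<close>

lemma pvars_depends:
  assumes "x \<in> pvars p"
  shows "\<exists>z. peval z p \<noteq> peval (z(x := 0)) p"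
proof (rule ccontr)
  assume "\<not> ?thesis"
  then have eq: "peval z p = peval (z(x := 0)) p" for z by blast
  obtain m where m: "m \<in> Poly_Mapping.keys p" "x \<in> Poly_Mapping.keys m"
    using assms by (auto simp: pvars_def)
  define M where "M = {m \<in> Poly_Mapping.keys p. x \<in> Poly_Mapping.keys m}"
  have "Poly_Mapping.lookup p m = 0"
  proof (rule meval_sum_eq_0_imp[of M])
    fix z
    have 0: "meval (z(x := 0)) m = 0" if "m \<in> M" for m
      using that unfolding meval_def by (auto simp: M_def in_keys_iff intro!: bexI[of _ x])
    have 1: "meval (z(x := 0)) m = meval z m" if "m \<in> Poly_Mapping.keys p - M" for m
      unfolding meval_def by (rule prod.cong) (use that in \<open>auto simp: M_def\<close>)
    have split: "peval z p = (\<Sum>m\<in>M. Poly_Mapping.lookup p m * meval z m) +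
      (\<Sum>m\<in>Poly_Mapping.keys p - M. Poly_Mapping.lookup p m * meval z m)" for z
      unfolding peval_meval
      by (subst sum.subset_diff[of M]) (auto simp: M_def add.commute)
    show "(\<Sum>m\<in>M. Poly_Mapping.lookup p m * meval z m) = 0"
      using eq[of z] split[of z] split[of "z(x := 0)"] 0 1 by simp
  qed (use m in \<open>auto simp: M_def\<close>)
  with m show False by (simp add: in_keys_iff)
qed

text \<open>Polynomial functions enter the argument only through their restrictions to lines.\<close>

definition line_poly :: "(('a \<Rightarrow> complex) \<Rightarrow> complex) \<Rightarrow> bool" where
  "line_poly f \<longleftrightarrow> (\<forall>z y. \<exists>p. \<forall>t. f (\<lambda>u. z u + t * y u) = poly p t)"

lemma line_polyE:
  assumes "line_poly f"
  obtains p where "\<And>t. f (\<lambda>u. z u + t * y u) = poly p t"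
  using assms unfolding line_poly_def by metis

lemma line_poly_const [intro]: "line_poly (\<lambda>z. c)"
  unfolding line_poly_def by (intro allI exI[of _ "[:c:]"]) simp

lemma line_poly_coord [intro]: "line_poly (\<lambda>z. z u)"
  unfolding line_poly_def
proof safe
  fix z y :: "'a \<Rightarrow> complex"
  have "\<forall>t. z u + t * y u = poly [:z u, y u:] t" by simp
  then show "\<exists>p. \<forall>t. z u + t * y u = poly p t" by blast
qed

lemma line_poly_add [intro]:
  assumes "line_poly f" "line_poly g"
  shows "line_poly (\<lambda>z. f z + g z)"
  using assms unfolding line_poly_def by (metis poly_add)

lemma line_poly_diff [intro]:
  assumes "line_poly f" "line_poly g"
  shows "line_poly (\<lambda>z. f z - g z)"
  using assms unfolding line_poly_def by (metis poly_diff)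

lemma line_poly_mult [intro]:
  assumes "line_poly f" "line_poly g"
  shows "line_poly (\<lambda>z. f z * g z)"
  using assms unfolding line_poly_def by (metis poly_mult)

lemma line_poly_power [intro]: "line_poly f \<Longrightarrow> line_poly (\<lambda>z. f z ^ n)"
  by (induction n) (auto simp: mult.commute)

lemma line_poly_sum [intro]: "(\<And>x. x \<in> A \<Longrightarrow> line_poly (f x)) \<Longrightarrow> line_poly (\<lambda>z. \<Sum>x\<in>A. f x z)"
  by (induction A rule: infinite_finite_induct) auto

lemma line_poly_prod [intro]: "(\<And>x. x \<in> A \<Longrightarrow> line_poly (f x)) \<Longrightarrow> line_poly (\<lambda>z. \<Prod>x\<in>A. f x z)"
  by (induction A rule: infinite_finite_induct) auto

lemma line_poly_peval [intro]: "line_poly (\<lambda>z. peval z p)"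
  unfolding peval_def
  by (intro line_poly_sum line_poly_mult line_poly_const line_poly_prod line_poly_power line_poly_coord)

lemma line_poly_if [intro]:
  "(b \<Longrightarrow> line_poly f) \<Longrightarrow> (\<not> b \<Longrightarrow> line_poly g) \<Longrightarrow> line_poly (\<lambda>z. if b then f z else g z)"
  by (cases b) auto

lemma line_poly_det:
  assumes A: "\<And>z. A z \<in> carrier_mat m m"
    and "\<And>i j. i < m \<Longrightarrow> j < m \<Longrightarrow> line_poly (\<lambda>z. A z $$ (i, j))"
  shows "line_poly (\<lambda>z. Determinant.det (A z))"
proof -
  have "line_poly (\<lambda>z. \<Sum>\<pi> | \<pi> permutes {0..<m}. signof \<pi> * (\<Prod>i = 0..<m. A z $$ (i, \<pi> i)))"
  proof (intro line_poly_sum line_poly_mult line_poly_prod line_poly_const)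
    fix \<pi> i assume "\<pi> \<in> {\<pi>. \<pi> permutes {0..<m}}" "i \<in> {0..<m}"
    then show "line_poly (\<lambda>z. A z $$ (i, \<pi> i))"
      using assms(2)[of i "\<pi> i"] permutes_in_image[of \<pi> "{0..<m}" i] by auto
  qed
  then show ?thesis by (simp add: det_def'[OF A])
qed

lemma line_poly_cofactor:
  assumes A: "\<And>z. A z \<in> carrier_mat m m"
    and "\<And>i j. i < m \<Longrightarrow> j < m \<Longrightarrow> line_poly (\<lambda>z. A z $$ (i, j))"
    and "k < m" "l < m"
  shows "line_poly (\<lambda>z. cofactor (A z) k l)"
  unfolding cofactor_def
proof (intro line_poly_mult line_poly_const line_poly_det)
  show c: "mat_delete (A z) k l \<in> carrier_mat (m - 1) (m - 1)" for z
    by (rule mat_delete_carrier[OF A])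
  fix i j assume ij: "i < m - 1" "j < m - 1"
  then have "insert_index k i < m" "insert_index l j < m"
    by (auto simp: insert_index_def)
  moreover have "mat_delete (A z) k l $$ (i, j) = A z $$ (insert_index k i, insert_index l j)" for z
    using mat_delete_index[of "A z" "m - 1" k l i j] A[of z] assms(3,4) ij
    by (cases m) auto
  ultimately show "line_poly (\<lambda>z. mat_delete (A z) k l $$ (i, j))"
    using assms(2) by simp
qed

section \<open>Zeros of polynomial functions along complex lines\<close>

lemma complex_avoids_finite: "finite X \<Longrightarrow> \<exists>t::complex. t \<notin> X"
  by (metis UNIV_I infinite_UNIV_char_0 rev_finite_subset subsetI)

lemma line_poly_finite_roots:
  assumes "line_poly f" "f (\<lambda>u. z u + t0 * y u) \<noteq> 0"
  shows "finite {t. f (\<lambda>u. z u + t * y u) = 0}"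
proof -
  obtain p where p: "\<And>t. f (\<lambda>u. z u + t * y u) = poly p t"
    using line_polyE[OF assms(1)] by blast
  with assms(2) have "p \<noteq> 0" by auto
  then show ?thesis unfolding p by (rule poly_roots_finite)
qed

text \<open>On the line through the two points, each function has only finitely many zeros, so some
  point avoids both sets. This is the form in which the irreducibility of affine space
  enters.\<close>

lemma line_poly_common_nonzero:
  assumes "line_poly f" "line_poly g" "f z \<noteq> 0" "g y \<noteq> 0"
  shows "\<exists>w. f w \<noteq> 0 \<and> g w \<noteq> 0"
proof -
  let ?w = "\<lambda>t u. z u + t * (y u - z u)"
  have "finite {t. f (?w t) = 0}"
    by (rule line_poly_finite_roots[OF assms(1), of _ 0]) (use assms in simp)
  moreover have "finite {t. g (?w t) = 0}"
    by (rule line_poly_finite_roots[OF assms(2), of _ 1]) (use assms in simp)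
  ultimately have "finite ({t. f (?w t) = 0} \<union> {t. g (?w t) = 0})" by simp
  from complex_avoids_finite[OF this] obtain t where "f (?w t) \<noteq> 0" "g (?w t) \<noteq> 0"
    by blast
  then show ?thesis by blast
qed

lemma line_poly_common_nonzero_family:
  assumes "finite A" "\<And>x. x \<in> A \<Longrightarrow> line_poly (f x)" "\<And>x. x \<in> A \<Longrightarrow> \<exists>z. f x z \<noteq> 0"
  shows "\<exists>w. \<forall>x\<in>A. f x w \<noteq> 0"
  using assms
proof (induction A rule: finite_induct)
  case (insert x A)
  then obtain w where "\<forall>x\<in>A. f x w \<noteq> 0" by auto
  then have "(\<Prod>x\<in>A. f x w) \<noteq> 0" using insert by simp
  moreover obtain z where "f x z \<noteq> 0" using insert by blast
  moreover have "line_poly (\<lambda>z. \<Prod>x\<in>A. f x z)" using insert.prems(1) by blast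
  ultimately obtain v where "f x v \<noteq> 0" "(\<Prod>x\<in>A. f x v) \<noteq> 0"
    using line_poly_common_nonzero[of "f x" "\<lambda>z. \<Prod>x\<in>A. f x z" z w] insert.prems(1) by auto
  then show ?case using insert by auto
qed simp

lemma line_poly_mult_eq_0:
  assumes "line_poly f" "line_poly g" "\<And>z. f z * g z = 0" "f z0 \<noteq> 0"
  shows "g z = 0"
  using line_poly_common_nonzero[OF assms(1,2,4), of z] assms(3) by auto

text \<open>Stands in for passing to the limit t = 0: a function that is polynomial on the line and
  has infinitely many zeros there vanishes on all of it, in particular at z.\<close>

lemma line_poly_limit:
  assumes "line_poly f" "finite X" "\<And>t. t \<notin> X \<Longrightarrow> f (\<lambda>u. z u + t * y u) = 0"
  shows "f z = 0"
proof (rule ccontr)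
  assume "f z \<noteq> 0"
  then have "finite {t. f (\<lambda>u. z u + t * y u) = 0}"
    by (intro line_poly_finite_roots[OF assms(1), of _ 0]) simp
  with assms(2) have "finite (X \<union> {t. f (\<lambda>u. z u + t * y u) = 0})" by simp
  from complex_avoids_finite[OF this] show False using assms(3) by blast
qed

text \<open>By the fundamental theorem of algebra, a polynomial in t without roots is constant; t =
  0 gives the value at z.\<close>

lemma line_poly_nonvanishing:
  assumes "line_poly f" "\<And>t. f (\<lambda>u. z u + t * y u) \<noteq> 0"
  shows "f (\<lambda>u. z u + t * y u) = f z"
proof -
  obtain p where p: "\<And>t. f (\<lambda>u. z u + t * y u) = poly p t"
    using line_polyE[OF assms(1)] by blast
  have "constant (poly p)"
    using fundamental_theorem_of_algebra[of p] assms(2) p by auto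
  then have "poly p t = poly p 0" unfolding constant_def by blast
  then show ?thesis using p[of t] p[of 0] by simp
qed

text \<open>Once the full power of t is split off, the quotient has no root at all: a root would
  have to be 0, but the order of p at 0 has been used up. So the quotient is constant.\<close>

lemma poly_nonvanishing_off_0:
  fixes p :: "complex poly"
  assumes "\<And>t. t \<noteq> 0 \<Longrightarrow> poly p t \<noteq> 0"
  shows "\<exists>c k. p = monom c k"
proof -
  have "p \<noteq> 0" using assms[of 1] by auto
  then obtain q where q: "p = [:- 0, 1:] ^ order 0 p * q" "\<not> [:- 0, 1:] dvd q"
    using order_decomp by blast
  have "constant (poly q)"
  proof (rule ccontr)
    assume "\<not> constant (poly q)"
    then obtain t where t: "poly q t = 0" using fundamental_theorem_of_algebra by blast
    then have "poly p t = 0" by (subst q(1)) simp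
    with assms have "t = 0" by blast
    with t q(2) show False by (simp add: poly_eq_0_iff_dvd)
  qed
  then have "degree q = 0" by (simp add: constant_degree)
  then obtain a where "q = [:a:]" by (auto elim: degree_eq_zeroE)
  with q(1) have "p = monom a (order 0 p)"
    by (simp add: monom_altdef)
  then show ?thesis by blast
qed

section \<open>Hall's theorem and determinants\<close>

text \<open>If every non-empty proper subset has a surplus of neighbours, any edge (i, x) can be
  used, since deleting x costs each remaining set at most one neighbour. Otherwise some tight W is
  matched with its own neighbours, and sets V disjoint from W keep enough others, as the at most |W|
  neighbours of W are subtracted from those of the union of V and W.\<close>

theorem hall_marriage:
  fixes F :: "('a \<times> 'b) set"
  assumes "finite I" "finite (F `` I)" "\<And>W. W \<subseteq> I \<Longrightarrow> card W \<le> card (F `` W)"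
  shows "\<exists>f. inj_on f I \<and> (\<forall>i\<in>I. (i, f i) \<in> F)"
  using assms
proof (induction I arbitrary: F rule: finite_psubset_induct)
  case (psubset I)
  have fin: "finite (F `` W)" if "W \<subseteq> I" for W
    using psubset.prems(1) that by (meson Image_mono finite_subset order_refl)
  show ?case
  proof (cases "I = {}")
    case False
    then obtain i where i: "i \<in> I" by blast
    show ?thesis
    proof (cases "\<exists>W. W \<noteq> {} \<and> W \<subset> I \<and> card (F `` W) \<le> card W")
      case False
      then have lt: "card V < card (F `` V)" if "V \<noteq> {}" "V \<subset> I" for V
        using that by (metis not_le)
      have "card {i} \<le> card (F `` {i})" using psubset.prems(2) i by blast
      then have "F `` {i} \<noteq> {}" by force
      then obtain x where x: "(i, x) \<in> F" by blast
      define F' where "F' = F - UNIV \<times> {x}"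
      have im: "F' `` W = F `` W - {x}" for W by (auto simp: F'_def)
      have "\<exists>f. inj_on f (I - {i}) \<and> (\<forall>r\<in>I - {i}. (r, f r) \<in> F')"
      proof (rule psubset.IH)
        show "I - {i} \<subset> I" using i by blast
        show "finite (F' `` (I - {i}))" using fin[of "I - {i}"] by (simp add: im)
        fix W assume W: "W \<subseteq> I - {i}"
        show "card W \<le> card (F' `` W)"
        proof (cases "W = {}")
          case False
          then have "card W < card (F `` W)" using W i by (intro lt) auto
          also have "card (F `` W) \<le> Suc (card (F' `` W))"
            unfolding im using fin[of W] W
            by (cases "x \<in> F `` W") (auto simp: card_Diff_singleton)
          finally show ?thesis by simp
        qed simp
      qed
      then obtain f where f: "inj_on f (I - {i})" "\<forall>r\<in>I - {i}. (r, f r) \<in> F'" by blast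
      have "inj_on (f(i := x)) I"
        using f unfolding inj_on_def F'_def by (auto split: if_splits)
      moreover have "\<forall>r\<in>I. (r, (f(i := x)) r) \<in> F" using f(2) x by (auto simp: F'_def)
      ultimately show ?thesis by blast
    next
      case True
      then obtain W where W: "W \<noteq> {}" "W \<subset> I" "card (F `` W) \<le> card W" by blast
      have "\<exists>f. inj_on f W \<and> (\<forall>r\<in>W. (r, f r) \<in> F)"
        by (rule psubset.IH) (use W fin psubset.prems(2) in auto)
      then obtain f where f: "inj_on f W" "\<forall>r\<in>W. (r, f r) \<in> F" by blast
      define F' where "F' = F - UNIV \<times> (F `` W)"
      have im: "F' `` V = F `` V - F `` W" for V by (auto simp: F'_def)
      have "\<exists>f. inj_on f (I - W) \<and> (\<forall>r\<in>I - W. (r, f r) \<in> F')"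
      proof (rule psubset.IH)
        show "I - W \<subset> I" using W by blast
        show "finite (F' `` (I - W))" using fin[of "I - W"] by (simp add: im)
        fix V assume V: "V \<subseteq> I - W"
        have finV: "finite V" "finite W" using V W psubset.hyps by (auto intro: finite_subset)
        have "card V + card W = card (V \<union> W)"
          using V finV by (intro card_Un_disjoint[symmetric]) auto
        also have "\<dots> \<le> card (F `` (V \<union> W))" using V W psubset.prems(2) by blast
        also have "F `` (V \<union> W) = F' `` V \<union> F `` W" by (auto simp: im)
        also have "card \<dots> \<le> card (F' `` V) + card (F `` W)" by (rule card_Un_le)
        finally show "card V \<le> card (F' `` V)" using W(3) by simp
      qed
      then obtain g where g: "inj_on g (I - W)" "\<forall>r\<in>I - W. (r, g r) \<in> F'" by blast
      define h where "h r = (if r \<in> W then f r else g r)" for r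
      have "inj_on h I"
      proof (rule inj_onI)
        fix r s assume rs: "r \<in> I" "s \<in> I" "h r = h s"
        have ne: "f a \<noteq> g b" if "a \<in> W" "b \<in> I - W" for a b
        proof -
          have "f a \<in> F `` W" using f(2) that by blast
          moreover have "g b \<notin> F `` W" using g(2) that by (auto simp: F'_def)
          ultimately show ?thesis by metis
        qed
        show "r = s"
          using rs inj_onD[OF f(1), of r s] inj_onD[OF g(1), of r s] ne[of r s] ne[of s r]
          by (auto simp: h_def split: if_splits)
      qed
      moreover have "\<forall>r\<in>I. (r, h r) \<in> F" using f(2) g(2) by (auto simp: h_def F'_def)
      ultimately show ?thesis by blast
    qed
  qed simp
qed

text \<open>Connectedness together with the paper's condition on the neighbours of sets of rows, in a form that
  turns out to be symmetric in the two sides.\<close>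

definition strong_hall :: "'a set \<Rightarrow> 'b set \<Rightarrow> ('a \<times> 'b) set \<Rightarrow> bool" where
  "strong_hall I J F \<longleftrightarrow> finite I \<and> finite J \<and> I \<noteq> {} \<and> card I = card J \<and> F \<subseteq> I \<times> J \<and> F `` I = J \<and>
     (\<forall>W. W \<noteq> {} \<longrightarrow> W \<subset> I \<longrightarrow> card W < card (F `` W))"

text \<open>Complementation: the rows W not adjacent to S have all their neighbours outside of S.
  The strict inequality for W, subtracted from the equality of the cardinalities of I and J, is the
  one for S. If S reaches every row, it is enough that S is a proper subset of J.\<close>

lemma strong_hall_converse:
  assumes "strong_hall I J F"
  shows "strong_hall J I (F\<inverse>)"
proof -
  have fin: "finite I" "finite J" and I: "I \<noteq> {}" and card: "card I = card J" and F: "F \<subseteq> I \<times> J"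
    and FI: "F `` I = J" and *: "\<And>W. W \<noteq> {} \<Longrightarrow> W \<subset> I \<Longrightarrow> card W < card (F `` W)"
    using assms by (auto simp: strong_hall_def)
  have J: "J \<noteq> {}" using fin I card by auto
  have "F `` {i} \<noteq> {}" if "i \<in> I" for i
  proof (cases "I = {i}")
    case False
    with that have "{i} \<subset> I" by blast
    from *[OF _ this] show ?thesis by fastforce
  qed (use FI J in auto)
  then have conv: "F\<inverse> `` J = I" using F by fastforce
  have "card S < card (F\<inverse> `` S)" if S: "S \<noteq> {}" "S \<subset> J" for S
  proof (cases "F\<inverse> `` S = I")
    case True
    then show ?thesis using S fin card by (metis psubset_card_mono)
  next
    case False
    define W where "W = I - F\<inverse> `` S"
    have sub: "F\<inverse> `` S \<subseteq> I" using F by blast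
    then have "W \<noteq> {}" using False by (auto simp: W_def)
    have "F\<inverse> `` S \<noteq> {}" using S FI by blast
    then have "W \<subset> I" using sub by (auto simp: W_def)
    have "card I = card W + card (F\<inverse> `` S)"
      using sub fin by (simp add: W_def card_Diff_subset finite_subset card_mono)
    moreover have "card J = card (J - S) + card S"
      using S fin by (metis card_Diff_subset card_mono finite_subset le_add_diff_inverse2 psubset_imp_subset)
    moreover have "card (F `` W) \<le> card (J - S)"
      using fin F by (intro card_mono) (auto simp: W_def)
    ultimately show ?thesis using *[OF \<open>W \<noteq> {}\<close> \<open>W \<subset> I\<close>] card by linarith
  qed
  then show ?thesis using fin J card F conv by (auto simp: strong_hall_def)
qed

text \<open>The position (i, j) may be a non-edge. Deleting column j costs every set of the other
  rows at most one neighbour, which the strict inequality can spare. Edges thus yield perfect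
  matchings, and arbitrary positions non-zero cofactors.\<close>

lemma strong_hall_matching:
  assumes sh: "strong_hall I J F" and i: "i \<in> I" and j: "j \<in> J"
  shows "\<exists>\<pi>. bij_betw \<pi> I J \<and> \<pi> i = j \<and> (\<forall>r\<in>I - {i}. (r, \<pi> r) \<in> F)"
proof -
  have fin: "finite I" "finite J" and card: "card I = card J" and F: "F \<subseteq> I \<times> J"
    and *: "\<And>W. W \<noteq> {} \<Longrightarrow> W \<subset> I \<Longrightarrow> card W < card (F `` W)"
    using sh by (auto simp: strong_hall_def)
  define F' where "F' = F - UNIV \<times> {j}"
  have im: "F' `` W = F `` W - {j}" for W by (auto simp: F'_def)
  have finF: "finite (F `` W)" for W using F fin(2) by (auto intro: finite_subset[of _ J])
  have "\<exists>f. inj_on f (I - {i}) \<and> (\<forall>r\<in>I - {i}. (r, f r) \<in> F')"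
  proof (rule hall_marriage)
    fix W assume W: "W \<subseteq> I - {i}"
    show "card W \<le> card (F' `` W)"
    proof (cases "W = {}")
      case False
      have "card W < card (F `` W)" using W i False by (intro *) auto
      then show ?thesis unfolding im using finF[of W]
        by (cases "j \<in> F `` W") (simp_all add: card_Diff_singleton)
    qed simp
  qed (use fin finF in \<open>auto simp: im\<close>)
  then obtain f where f: "inj_on f (I - {i})" "\<forall>r\<in>I - {i}. (r, f r) \<in> F'" by blast
  define \<pi> where "\<pi> = f(i := j)"
  have inj: "inj_on \<pi> I"
    using f i unfolding inj_on_def F'_def \<pi>_def by (auto split: if_splits)
  moreover have "\<pi> ` I \<subseteq> J" using f(2) j F by (auto simp: \<pi>_def F'_def)
  then have "\<pi> ` I = J" using fin card card_image[OF inj] by (intro card_subset_eq) auto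
  ultimately have "bij_betw \<pi> I J" by (simp add: bij_betw_def)
  moreover have "\<pi> i = j" "\<forall>r\<in>I - {i}. (r, \<pi> r) \<in> F"
    using f(2) by (auto simp: \<pi>_def F'_def)
  ultimately show ?thesis by blast
qed

text \<open>Two complementary proper sets of rows without common columns would each have a surplus,
  so there would be at least two more columns than rows. In this form, connectedness serves to
  propagate a property from one row to all others.\<close>

lemma strong_hall_partition:
  assumes sh: "strong_hall I J F" and W: "W \<subseteq> I" "W \<noteq> {}"
    and disj: "F `` W \<inter> F `` (I - W) = {}"
  shows "W = I"
proof (rule ccontr)
  assume "W \<noteq> I"
  have fin: "finite I" "finite J" and card: "card I = card J" and F: "F \<subseteq> I \<times> J"
    and *: "\<And>W. W \<noteq> {} \<Longrightarrow> W \<subset> I \<Longrightarrow> card W < card (F `` W)"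
    using sh by (auto simp: strong_hall_def)
  have finF: "finite (F `` W)" for W using F fin(2) by (auto intro: finite_subset[of _ J])
  have "card W < card (F `` W)" "card (I - W) < card (F `` (I - W))"
    using W \<open>W \<noteq> I\<close> by (auto intro!: *)
  moreover have "card (F `` W) + card (F `` (I - W)) = card (F `` W \<union> F `` (I - W))"
    using finF disj by (simp add: card_Un_disjoint)
  moreover have "card (F `` W \<union> F `` (I - W)) \<le> card J"
    using F fin(2) by (intro card_mono) auto
  moreover have "card I = card W + card (I - W)"
    using W(1) fin(1) by (metis card_Diff_subset card_mono finite_subset le_add_diff_inverse)
  ultimately show False using card by linarith
qed

text \<open>Elimination: an equation with a non-zero coefficient at b0 is solved for the unknown at
  b0 and substituted into the others, which leaves one equation and one unknown fewer.\<close>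

lemma underdetermined_system:
  fixes c :: "'a \<Rightarrow> 'b \<Rightarrow> complex"
  assumes "finite A" "finite B" "card A < card B"
  shows "\<exists>\<gamma>. (\<exists>b\<in>B. \<gamma> b \<noteq> 0) \<and> (\<forall>a\<in>A. (\<Sum>b\<in>B. c a b * \<gamma> b) = 0)"
  using assms
proof (induction A arbitrary: B c rule: finite_induct)
  case empty
  then obtain b where "b \<in> B" by fastforce
  then show ?case by (intro exI[of _ "\<lambda>_. 1"]) auto
next
  case (insert a A)
  show ?case
  proof (cases "\<forall>b\<in>B. c a b = 0")
    case True
    moreover have "card A < card B" using insert by simp
    ultimately show ?thesis using insert.IH[of B c] insert.prems(1) by auto
  next
    case False
    then obtain b0 where b0: "b0 \<in> B" "c a b0 \<noteq> 0" by blast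
    define B' where "B' = B - {b0}"
    have B': "finite B'" "b0 \<notin> B'" "B = insert b0 B'"
      using insert.prems b0 by (auto simp: B'_def)
    have "card A < card B'" using insert B' by simp
    from insert.IH[OF B'(1) this, of "\<lambda>a' b. c a' b - c a' b0 * c a b / c a b0"]
    obtain \<gamma> where \<gamma>: "\<exists>b\<in>B'. \<gamma> b \<noteq> 0"
      "\<And>a'. a' \<in> A \<Longrightarrow> (\<Sum>b\<in>B'. (c a' b - c a' b0 * c a b / c a b0) * \<gamma> b) = 0" by blast
    define x where "x = - (\<Sum>b\<in>B'. c a b * \<gamma> b) / c a b0"
    have sum: "(\<Sum>b\<in>B. c a' b * (\<gamma>(b0 := x)) b) = c a' b0 * x + (\<Sum>b\<in>B'. c a' b * \<gamma> b)" for a'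
      using B' by (auto intro!: sum.cong)
    have "(\<Sum>b\<in>B. c a' b * (\<gamma>(b0 := x)) b) = 0" if "a' \<in> insert a A" for a'
    proof (cases "a' = a")
      case True
      then show ?thesis unfolding sum using b0 by (simp add: x_def)
    next
      case False
      then have "0 = (\<Sum>b\<in>B'. (c a' b - c a' b0 * c a b / c a b0) * \<gamma> b)"
        using \<gamma>(2)[of a'] that by auto
      also have "\<dots> = (\<Sum>b\<in>B'. c a' b * \<gamma> b) - c a' b0 / c a b0 * (\<Sum>b\<in>B'. c a b * \<gamma> b)"
        by (simp add: sum_distrib_left sum_subtractf[symmetric] algebra_simps)
      finally show ?thesis unfolding sum by (simp add: x_def)
    qed
    moreover have "\<exists>b\<in>B. (\<gamma>(b0 := x)) b \<noteq> 0" using \<gamma>(1) B' by auto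
    ultimately show ?thesis by blast
  qed
qed

section \<open>Determinants, cofactors and kernel vectors\<close>

lemma det_permutation_matrix:
  fixes A :: "complex mat"
  assumes A: "A \<in> carrier_mat m m" and \<pi>: "bij_betw \<pi> {..<m} {..<m}"
    and entry: "\<And>i j. i < m \<Longrightarrow> j < m \<Longrightarrow> A $$ (i, j) = (if j = \<pi> i then 1 else 0)"
  shows "Determinant.det A \<noteq> 0"
proof
  \<comment> \<open>Testing the kernel avoids the sign of the permutation: row i reads off the
    coordinate \<open>\<pi> i\<close> of a vector, so a kernel vector is zero.\<close>
  assume "Determinant.det A = 0"
  then obtain v where v: "v \<in> carrier_vec m" "v \<noteq> 0\<^sub>v m" "A *\<^sub>v v = 0\<^sub>v m"
    using det_0_iff_vec_prod_zero_field[OF A] by blast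
  have "vec_index v j = 0" if "j < m" for j
  proof -
    have "j \<in> \<pi> ` {..<m}" using bij_betw_imp_surj_on[OF \<pi>] that by simp
    then obtain i where i: "i < m" "\<pi> i = j" by blast
    have "0 = vec_index (A *\<^sub>v v) i" using v(3) i by simp
    also have "\<dots> = (\<Sum>k = 0..<m. A $$ (i, k) * vec_index v k)"
      using carrier_matD[OF A] carrier_vecD[OF v(1)] i by (simp add: scalar_prod_def)
    also have "\<dots> = (\<Sum>k = 0..<m. if k = j then vec_index v k else 0)"
      by (rule sum.cong) (use i in \<open>auto simp: entry\<close>)
    finally show ?thesis using that by simp
  qed
  with v show False by (metis carrier_vecD eq_vecI index_zero_vec(1,2))
qed

lemma cofactor_cong:
  assumes "A \<in> carrier_mat m m" "B \<in> carrier_mat m m" "i < m" "j < m"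
    and "\<And>r c. r < m \<Longrightarrow> c < m \<Longrightarrow> r \<noteq> i \<Longrightarrow> c \<noteq> j \<Longrightarrow> A $$ (r, c) = B $$ (r, c)"
  shows "cofactor A i j = cofactor B i j"
proof -
  have "mat_delete A i j = mat_delete B i j"
    unfolding mat_delete_def by (rule eq_matI) (use assms in auto)
  then show ?thesis by (simp add: cofactor_def)
qed

text \<open>The products of A with its adjugate, in either order, are zero. So a row of cofactors is
  a right kernel vector, and a column of cofactors is a left one.\<close>

lemma cofactor_kernels:
  fixes A :: "complex mat"
  assumes A: "A \<in> carrier_mat m m" and det: "Determinant.det A = 0" and k: "k < m" "l < m"
  shows "(\<Sum>j<m. A $$ (l, j) * cofactor A k j) = 0"
    and "(\<Sum>i<m. A $$ (i, l) * cofactor A i k) = 0"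
proof -
  have d: "dim_row A = m" "dim_col A = m" using A by auto
  have "(A * adj_mat A) $$ (l, k) = 0" using adj_mat(2)[OF A] det k by simp
  then show "(\<Sum>j<m. A $$ (l, j) * cofactor A k j) = 0"
    using k by (simp add: adj_mat_def scalar_prod_def d lessThan_atLeast0)
  have "(adj_mat A * A) $$ (k, l) = 0" using adj_mat(3)[OF A] det k by simp
  then show "(\<Sum>i<m. A $$ (i, l) * cofactor A i k) = 0"
    using k by (simp add: adj_mat_def scalar_prod_def d lessThan_atLeast0 mult.commute)
qed

section \<open>Singular matrices with prescribed support\<close>

text \<open>\<open>X\<close> names the variable at a position of the support. Keeping it abstract
  lets blocks and re-indexed matrices share their variables with the original matrix, whose
  variables are indexed by edge vectors.\<close>

definition entry :: "('a \<times> 'b) set \<Rightarrow> ('a \<times> 'b \<Rightarrow> 'u) \<Rightarrow> ('u \<Rightarrow> complex) \<Rightarrow> 'a \<Rightarrow> 'b \<Rightarrow> complex" where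
  "entry F X z i j = (if (i, j) \<in> F then z (X (i, j)) else 0)"

definition zmat :: "nat \<Rightarrow> (nat \<times> nat) set \<Rightarrow> (nat \<times> nat \<Rightarrow> 'u) \<Rightarrow> ('u \<Rightarrow> complex) \<Rightarrow> complex mat" where
  "zmat m F X z = mat m m (\<lambda>(i, j). entry F X z i j)"

definition pmat :: "nat \<Rightarrow> (nat \<times> nat) set \<Rightarrow> (nat \<times> nat \<Rightarrow> 'u) \<Rightarrow> 'u cpoly mat" where
  "pmat m F X = mat m m (\<lambda>(i, j). if (i, j) \<in> F then pvar (X (i, j)) else 0)"

definition full_kernels ::
    "'a set \<Rightarrow> 'b set \<Rightarrow> ('a \<times> 'b) set \<Rightarrow> ('a \<times> 'b \<Rightarrow> 'u) \<Rightarrow> ('u \<Rightarrow> complex) \<Rightarrow> bool" where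
  "full_kernels I J F X z \<longleftrightarrow> (\<exists>\<alpha> \<beta>. (\<forall>i\<in>I. \<alpha> i \<noteq> 0) \<and> (\<forall>j\<in>J. \<beta> j \<noteq> 0) \<and>
     (\<forall>i\<in>I. (\<Sum>j\<in>J. entry F X z i j * \<beta> j) = 0) \<and> (\<forall>j\<in>J. (\<Sum>i\<in>I. entry F X z i j * \<alpha> i) = 0))"

lemma zmat_carrier [simp]: "zmat m F X z \<in> carrier_mat m m"
  by (simp add: zmat_def)

lemma zmat_index [simp]: "i < m \<Longrightarrow> j < m \<Longrightarrow> zmat m F X z $$ (i, j) = entry F X z i j"
  by (simp add: zmat_def)

lemma pmat_carrier [simp]: "pmat m F X \<in> carrier_mat m m"
  by (simp add: pmat_def)

lemma line_poly_entry [intro]: "line_poly (\<lambda>z. entry F X z i j)"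
  unfolding entry_def by (intro line_poly_if line_poly_coord line_poly_const)

lemma line_poly_det_zmat [intro]: "line_poly (\<lambda>z. Determinant.det (zmat m F X z))"
  by (rule line_poly_det[OF zmat_carrier]) auto

lemma line_poly_cofactor_zmat:
  "i < m \<Longrightarrow> j < m \<Longrightarrow> line_poly (\<lambda>z. cofactor (zmat m F X z) i j)"
  by (rule line_poly_cofactor[OF zmat_carrier]) auto

lemma entry_line: "entry F X (\<lambda>u. z u + t * y u) i j = entry F X z i j + t * entry F X y i j"
  by (simp add: entry_def)

lemma peval_det_pmat: "peval z (Determinant.det (pmat m F X)) = Determinant.det (zmat m F X z)"
proof -
  interpret comm_ring_hom "peval z" by (rule comm_ring_hom_peval)
  have "map_mat (peval z) (pmat m F X) = zmat m F X z"
    by (rule eq_matI) (auto simp: pmat_def zmat_def entry_def)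
  then show ?thesis by (metis hom_det)
qed

lemma pvars_det_pmat: "pvars (Determinant.det (pmat m F X)) \<subseteq> X ` F"
  by (rule pvars_det[of _ m]) (auto simp: pmat_def pvars_pvar)

lemma det_zmat_eq_0I:
  assumes "k < m" "\<beta> k \<noteq> 0" "\<And>i. i < m \<Longrightarrow> (\<Sum>j<m. entry F X z i j * \<beta> j) = 0"
  shows "Determinant.det (zmat m F X z) = 0"
proof -
  have "vec m \<beta> \<noteq> 0\<^sub>v m"
    using assms(1,2) by (metis index_vec index_zero_vec(1))
  moreover have "zmat m F X z *\<^sub>v vec m \<beta> = 0\<^sub>v m"
    using assms(3) by (intro eq_vecI) (auto simp: zmat_def scalar_prod_def lessThan_atLeast0)
  ultimately show ?thesis
    using det_0_iff_vec_prod_zero_field[OF zmat_carrier] vec_carrier by blast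
qed

lemma det_zmat_eq_0D:
  assumes "Determinant.det (zmat m F X z) = 0"
  shows "\<exists>\<beta>. (\<exists>k<m. \<beta> k \<noteq> 0) \<and> (\<forall>i<m. (\<Sum>j<m. entry F X z i j * \<beta> j) = 0)"
proof -
  obtain v where v: "v \<in> carrier_vec m" "v \<noteq> 0\<^sub>v m" "zmat m F X z *\<^sub>v v = 0\<^sub>v m"
    using det_0_iff_vec_prod_zero_field[OF zmat_carrier] assms by blast
  have "\<exists>k<m. vec_index v k \<noteq> 0"
    using v(1,2) by (metis carrier_vecD eq_vecI index_zero_vec(1,2))
  moreover have "(\<Sum>j<m. entry F X z i j * vec_index v j) = 0" if "i < m" for i
  proof -
    have "vec_index (zmat m F X z *\<^sub>v v) i = (\<Sum>j<m. entry F X z i j * vec_index v j)"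
      using v(1) that by (auto simp: zmat_def scalar_prod_def lessThan_atLeast0)
    then show ?thesis using v(3) that by simp
  qed
  ultimately show ?thesis by blast
qed

text \<open>Scaling the columns is a diagonal change of the variables, well defined because each
  variable belongs to one position only. It serves to move one kernel vector without zeros to
  another.\<close>

lemma entry_scale_columns:
  assumes X: "inj_on X F" and \<rho>: "\<And>j. \<rho> j \<noteq> 0"
  obtains \<sigma> where "\<And>u. \<sigma> u \<noteq> 0" "\<And>z i j. entry F X (\<lambda>u. z u * \<sigma> u) i j = entry F X z i j * \<rho> j"
proof
  define \<sigma> where "\<sigma> u = \<rho> (snd (inv_into F X u))" for u
  show "\<sigma> u \<noteq> 0" for u using \<rho> by (simp add: \<sigma>_def)
  show "entry F X (\<lambda>u. z u * \<sigma> u) i j = entry F X z i j * \<rho> j" for z i j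
    using X by (simp add: entry_def \<sigma>_def)
qed

section \<open>Generic matrices whose support satisfies the strict Hall condition\<close>

locale generic_matrix =
  fixes m :: nat and F :: "(nat \<times> nat) set" and X :: "nat \<times> nat \<Rightarrow> 'u"
  assumes strong_hall: "strong_hall {..<m} {..<m} F" and inj: "inj_on X F"
begin

abbreviation "dt z \<equiv> Determinant.det (zmat m F X z)"

lemma F_less: "(i, j) \<in> F \<Longrightarrow> i < m \<and> j < m"
  using strong_hall by (auto simp: strong_hall_def)

lemma m_pos: "0 < m"
  using strong_hall by (auto simp: strong_hall_def)

lemma X_eq_iff: "(i, j) \<in> F \<Longrightarrow> (k, l) \<in> F \<Longrightarrow> X (i, j) = X (k, l) \<longleftrightarrow> i = k \<and> j = l"
  using inj by (auto dest: inj_onD)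

lemma edge_exists: obtains i j where "(i, j) \<in> F"
proof -
  have "F `` {..<m} \<noteq> {}" using strong_hall m_pos by (auto simp: strong_hall_def)
  then show ?thesis using that by blast
qed

lemma edge_matching:
  assumes "(i, j) \<in> F"
  obtains \<pi> where "bij_betw \<pi> {..<m} {..<m}" "\<pi> i = j" "\<And>r. r < m \<Longrightarrow> (r, \<pi> r) \<in> F"
proof -
  obtain \<pi> where "bij_betw \<pi> {..<m} {..<m}" "\<pi> i = j" "\<forall>r\<in>{..<m} - {i}. (r, \<pi> r) \<in> F"
    using strong_hall_matching[OF strong_hall, of i j] F_less[OF assms] by auto
  with assms show ?thesis by (intro that[of \<pi>]) auto
qed

text \<open>The columns \<open>\<pi> r\<close> may coincide for different rows: the same formula
  describes permutation matrices, partial ones, and the corrections, one entry per row, by which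
  supports of kernel vectors are enlarged.\<close>

lemma entry_matching:
  assumes "\<And>r. r \<in> R \<Longrightarrow> (r, \<pi> r) \<in> F" and c: "\<And>i j. (i, j) \<in> F \<Longrightarrow> c (X (i, j)) = d i j"
  shows "entry F X (\<lambda>u. if u \<in> (\<lambda>r. X (r, \<pi> r)) ` R then c u else 0) i j =
    (if i \<in> R \<and> j = \<pi> i then d i j else 0)"
proof (cases "(i, j) \<in> F")
  case True
  then have "X (i, j) \<in> (\<lambda>r. X (r, \<pi> r)) ` R \<longleftrightarrow> i \<in> R \<and> j = \<pi> i"
    using assms(1) X_eq_iff by auto
  then show ?thesis using True c[OF True] by (auto simp: entry_def)
qed (use assms in \<open>auto simp: entry_def\<close>)

lemma det_nonzero: "\<exists>z. dt z \<noteq> 0"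
proof -
  obtain i j where "(i, j) \<in> F" by (rule edge_exists)
  then obtain \<pi> where \<pi>: "bij_betw \<pi> {..<m} {..<m}" "\<And>r. r < m \<Longrightarrow> (r, \<pi> r) \<in> F"
    using edge_matching by metis
  define z where "z = (\<lambda>u. if u \<in> (\<lambda>r. X (r, \<pi> r)) ` {..<m} then 1 else 0 :: complex)"
  have "entry F X z r c = (if r \<in> {..<m} \<and> c = \<pi> r then 1 else 0)" for r c
    unfolding z_def by (rule entry_matching) (use \<pi>(2) in auto)
  then have "dt z \<noteq> 0"
    by (intro det_permutation_matrix[OF _ \<pi>(1)]) auto
  then show ?thesis by blast
qed

lemma cofactor_nonzero:
  assumes "i < m" "j < m"
  shows "\<exists>z. cofactor (zmat m F X z) i j \<noteq> 0"
proof -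
  obtain \<pi> where \<pi>: "bij_betw \<pi> {..<m} {..<m}" "\<pi> i = j" "\<And>r. r \<in> {..<m} - {i} \<Longrightarrow> (r, \<pi> r) \<in> F"
    using strong_hall_matching[OF strong_hall, of i j] assms by auto
  define z where "z = (\<lambda>u. if u \<in> (\<lambda>r. X (r, \<pi> r)) ` ({..<m} - {i}) then 1 else 0 :: complex)"
  have e: "entry F X z r c = (if r \<in> {..<m} - {i} \<and> c = \<pi> r then 1 else 0)" for r c
    unfolding z_def by (rule entry_matching) (use \<pi>(3) in auto)
  \<comment> \<open>Row i is the unit vector at j even if (i, j) is not an edge. The cofactor at (i,
    j) does not see this row, and it equals the determinant of this permutation matrix.\<close>
  define A :: "complex mat" where "A = mat m m (\<lambda>(r, c). if c = \<pi> r then 1 else 0)"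
  have A: "A \<in> carrier_mat m m" by (simp add: A_def)
  have "Determinant.det A \<noteq> 0"
    by (rule det_permutation_matrix[OF A \<pi>(1)]) (simp add: A_def)
  also have "Determinant.det A = (\<Sum>c<m. A $$ (i, c) * cofactor A i c)"
    by (rule laplace_expansion_row[OF A assms(1)])
  also have "\<dots> = (\<Sum>c<m. if c = j then cofactor A i c else 0)"
    by (rule sum.cong) (use assms \<pi>(2) in \<open>auto simp: A_def\<close>)
  also have "\<dots> = cofactor A i j" using assms by simp
  also have "\<dots> = cofactor (zmat m F X z) i j"
    by (rule cofactor_cong[OF A zmat_carrier assms]) (use assms in \<open>auto simp: e A_def\<close>)
  finally show ?thesis by blast
qed

text \<open>The cofactors in row i0 and in column j0 do not involve the entry at the edge (i0, j0).
  At a point where all of them are non-zero, this entry can be altered so that the determinant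
  vanishes; both kernel vectors given by these cofactors then have no zeros.\<close>

lemma regular_singular_point:
  obtains w i0 j0 where "i0 < m" "j0 < m" "dt w = 0"
    "\<And>j. j < m \<Longrightarrow> cofactor (zmat m F X w) i0 j \<noteq> 0"
    "\<And>i. i < m \<Longrightarrow> cofactor (zmat m F X w) i j0 \<noteq> 0"
proof -
  obtain i0 j0 where edge: "(i0, j0) \<in> F" by (rule edge_exists)
  then have less: "i0 < m" "j0 < m" using F_less by auto
  have "\<exists>w. \<forall>x\<in>{i0} \<times> {..<m} \<union> {..<m} \<times> {j0}. (\<lambda>(i, j) z. cofactor (zmat m F X z) i j) x w \<noteq> 0"
  proof (rule line_poly_common_nonzero_family)
    fix x assume "x \<in> {i0} \<times> {..<m} \<union> {..<m} \<times> {j0}"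
    then show "line_poly ((\<lambda>(i, j) z. cofactor (zmat m F X z) i j) x)"
      and "\<exists>z. (\<lambda>(i, j) z. cofactor (zmat m F X z) i j) x z \<noteq> 0"
      using less by (auto simp: cofactor_nonzero intro!: line_poly_cofactor_zmat)
  qed simp
  then obtain w where w0:
    "\<forall>x\<in>{i0} \<times> {..<m} \<union> {..<m} \<times> {j0}. (\<lambda>(i, j) z. cofactor (zmat m F X z) i j) x w \<noteq> 0" by blast
  have w: "cofactor (zmat m F X w) i0 j \<noteq> 0" "cofactor (zmat m F X w) j j0 \<noteq> 0" if "j < m" for j
    using bspec[OF w0, of "(i0, j)"] bspec[OF w0, of "(j, j0)"] that by simp_all
  define s where "s = (\<Sum>j\<in>{..<m} - {j0}. entry F X w i0 j * cofactor (zmat m F X w) i0 j)"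
  define z where "z = w(X (i0, j0) := - s / cofactor (zmat m F X w) i0 j0)"
  have e: "entry F X z i j = entry F X w i j" if "(i, j) \<noteq> (i0, j0)" for i j
    using that X_eq_iff[OF _ edge] by (auto simp: entry_def z_def)
  have e0: "entry F X z i0 j0 = - s / cofactor (zmat m F X w) i0 j0"
    using edge by (simp add: entry_def z_def)
  have cof: "cofactor (zmat m F X z) i j = cofactor (zmat m F X w) i j"
    if "i = i0 \<or> j = j0" "i < m" "j < m" for i j
    by (rule cofactor_cong[of _ m]) (use that in \<open>auto simp: e\<close>)
  have "dt z = (\<Sum>j<m. entry F X z i0 j * cofactor (zmat m F X z) i0 j)"
    using laplace_expansion_row[OF zmat_carrier less(1), of F X z] less(1) by simp
  also have "\<dots> = (\<Sum>j<m. entry F X z i0 j * cofactor (zmat m F X w) i0 j)"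
    by (rule sum.cong) (use less in \<open>auto simp: cof\<close>)
  also have "\<dots> = entry F X z i0 j0 * cofactor (zmat m F X w) i0 j0 + s"
    unfolding s_def using less by (subst sum.remove[of _ j0]) (auto simp: e)
  also have "\<dots> = 0" using w(1)[OF less(2)] e0 by simp
  finally show ?thesis
    using w less cof by (intro that[of i0 j0 z]) auto
qed

text \<open>The matrices with a fixed full right kernel vector form a linear space, in which those that
  also have a full left kernel vector, given by a column of cofactors, are generic.\<close>

lemma vanish_of_full_right_kernel:
  assumes P: "line_poly P" and van: "\<And>z. full_kernels {..<m} {..<m} F X z \<Longrightarrow> P z = 0"
    and \<beta>: "\<And>j. j < m \<Longrightarrow> \<beta> j \<noteq> 0" "\<And>i. i < m \<Longrightarrow> (\<Sum>j<m. entry F X z i j * \<beta> j) = 0"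
  shows "P z = 0"
proof -
  obtain w i0 j0 where less: "i0 < m" "j0 < m" and w0: "dt w = 0"
    and w1: "\<And>j. j < m \<Longrightarrow> cofactor (zmat m F X w) i0 j \<noteq> 0"
    and w2: "\<And>i. i < m \<Longrightarrow> cofactor (zmat m F X w) i j0 \<noteq> 0"
    by (rule regular_singular_point) blast
  define \<gamma> where "\<gamma> j = cofactor (zmat m F X w) i0 j" for j
  have \<gamma>: "\<gamma> j \<noteq> 0" if "j < m" for j using w1 that by (simp add: \<gamma>_def)
  have w\<gamma>: "(\<Sum>j<m. entry F X w i j * \<gamma> j) = 0" if "i < m" for i
    using cofactor_kernels(1)[OF zmat_carrier w0 less(1) that] that by (simp add: \<gamma>_def)
  \<comment> \<open>This ratio turns the kernel vector \<open>\<gamma>\<close> of \<open>w\<close>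
    into \<open>\<beta>\<close>: scaling the columns by \<open>\<rho>\<close> takes the matrices
    annihilating \<open>\<beta>\<close> to those annihilating \<open>\<gamma>\<close>.\<close>
  define \<rho> where "\<rho> j = (if j < m then \<beta> j / \<gamma> j else 1)" for j
  have \<rho>: "\<rho> j \<noteq> 0" for j using \<beta>(1) \<gamma> by (simp add: \<rho>_def)
  obtain \<sigma> where \<sigma>: "\<And>u. \<sigma> u \<noteq> 0"
    "\<And>z i j. entry F X (\<lambda>u. z u * \<sigma> u) i j = entry F X z i j * \<rho> j"
    using entry_scale_columns[OF inj, of \<rho>] \<rho> by blast
  \<comment> \<open>The line starts at \<open>z\<close> for t = 0 and passes, up to the column
    scaling, through \<open>w\<close> for t = 1. There the cofactors of column \<open>j0\<close> are
    non-zero, so they vanish for finitely many t only.\<close>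
  define y where "y u = w u / \<sigma> u - z u" for u
  define v where "v t u = z u + t * y u" for t u
  define v' where "v' t u = v t u * \<sigma> u" for t u
  have v'_line: "v' t = (\<lambda>u. z u * \<sigma> u + t * (y u * \<sigma> u))" for t
    by (auto simp: v'_def v_def algebra_simps)
  have v'1: "v' 1 = w" using \<sigma>(1) by (auto simp: v'_def v_def y_def field_simps)
  have e': "entry F X (v' t) i j = entry F X (v t) i j * \<rho> j" for t i j
    unfolding v'_def by (rule \<sigma>(2))
  have ev: "(\<Sum>j<m. entry F X (v t) i j * \<beta> j) = 0" if i: "i < m" for t i
  proof -
    have "entry F X w i j = (entry F X z i j + entry F X y i j) * \<rho> j" for j
      using e'[of 1 i j] unfolding v'1 v_def entry_line by simp
    then have "0 = (\<Sum>j<m. (entry F X z i j + entry F X y i j) * \<rho> j * \<gamma> j)"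
      using w\<gamma>[OF i] by simp
    also have "\<dots> = (\<Sum>j<m. entry F X z i j * \<beta> j + entry F X y i j * \<beta> j)"
      by (rule sum.cong) (use \<gamma> in \<open>auto simp: \<rho>_def field_simps\<close>)
    also have "\<dots> = (\<Sum>j<m. entry F X y i j * \<beta> j)"
      using \<beta>(2)[OF i] by (simp add: sum.distrib)
    finally have "(\<Sum>j<m. entry F X y i j * \<beta> j) = 0" by simp
    then show ?thesis unfolding v_def entry_line using \<beta>(2)[OF i]
      by (simp add: ring_distribs sum.distrib mult.assoc sum_distrib_left[symmetric])
  qed
  have det: "dt (v' t) = 0" for t
  proof (rule det_zmat_eq_0I[OF m_pos, of \<gamma>])
    fix i assume i: "i < m"
    have "(\<Sum>j<m. entry F X (v' t) i j * \<gamma> j) = (\<Sum>j<m. entry F X (v t) i j * \<beta> j)"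
      by (rule sum.cong) (use \<gamma> in \<open>auto simp: e' \<rho>_def field_simps\<close>)
    then show "(\<Sum>j<m. entry F X (v' t) i j * \<gamma> j) = 0" using ev[OF i] by simp
  qed (rule \<gamma>[OF m_pos])
  define T where "T = (\<Union>i<m. {t. cofactor (zmat m F X (v' t)) i j0 = 0})"
  have "finite {t. cofactor (zmat m F X (v' t)) i j0 = 0}" if "i < m" for i
    unfolding v'_line
  proof (rule line_poly_finite_roots[where f = "\<lambda>z. cofactor (zmat m F X z) i j0"])
    show "line_poly (\<lambda>z. cofactor (zmat m F X z) i j0)"
      by (rule line_poly_cofactor_zmat) (use that less in auto)
    show "cofactor (zmat m F X (\<lambda>u. z u * \<sigma> u + 1 * (y u * \<sigma> u))) i j0 \<noteq> 0"
      using w2[OF that] unfolding v'_line[symmetric] v'1 .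
  qed
  then have "finite T" by (simp add: T_def)
  show ?thesis
  proof (rule line_poly_limit[OF P \<open>finite T\<close>])
    fix t assume "t \<notin> T"
    then have c: "\<forall>i\<in>{..<m}. cofactor (zmat m F X (v' t)) i j0 \<noteq> 0" by (auto simp: T_def)
    have l: "\<forall>j\<in>{..<m}. (\<Sum>i<m. entry F X (v t) i j * cofactor (zmat m F X (v' t)) i j0) = 0"
    proof
      fix j assume j: "j \<in> {..<m}"
      have "0 = (\<Sum>i<m. entry F X (v' t) i j * cofactor (zmat m F X (v' t)) i j0)"
        using cofactor_kernels(2)[OF zmat_carrier det less(2), of j] j by simp
      also have "\<dots> = \<rho> j * (\<Sum>i<m. entry F X (v t) i j * cofactor (zmat m F X (v' t)) i j0)"
        by (simp add: e' sum_distrib_left mult_ac)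
      finally show "(\<Sum>i<m. entry F X (v t) i j * cofactor (zmat m F X (v' t)) i j0) = 0"
        using \<rho> by simp
    qed
    have "full_kernels {..<m} {..<m} F X (v t)"
      unfolding full_kernels_def using c l \<beta>(1) ev
      by (intro exI[of _ "\<lambda>i. cofactor (zmat m F X (v' t)) i j0"] exI[of _ \<beta>]) auto
    then show "P (\<lambda>u. z u + t * y u) = 0" using van unfolding v_def by blast
  qed
qed

text \<open>Let \<open>S\<close> be the support of a right kernel vector. By Hall's strict inequality, the rows without
  neighbours in \<open>S\<close> are fewer than the columns outside of \<open>S\<close>, and so annihilate a vector supported
  there. Adding a small multiple of it to the kernel vector and correcting the other rows at columns
  in \<open>S\<close>, one obtains nearby matrices whose kernel vector has larger support.\<close>

lemma vanish_of_right_kernel: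
  assumes P: "line_poly P" and van: "\<And>z. full_kernels {..<m} {..<m} F X z \<Longrightarrow> P z = 0"
    and "k < m" "\<beta> k \<noteq> 0" "\<And>i. i < m \<Longrightarrow> (\<Sum>j<m. entry F X z i j * \<beta> j) = 0"
  shows "P z = 0"
  using assms(3-)
proof (induction "card {j. j < m \<and> \<beta> j = 0}" arbitrary: \<beta> z k rule: less_induct)
  case less
  define B where "B = {j. j < m \<and> \<beta> j = 0}"
  define S where "S = {j. j < m \<and> \<beta> j \<noteq> 0}"
  have fin: "finite B" "finite S" by (auto simp: B_def S_def)
  show ?case
  proof (cases "B = {}")
    case True
    then show ?thesis
      using less.prems(3) by (intro vanish_of_full_right_kernel[OF P van, of \<beta>]) (auto simp: B_def)
  next
    case False
    define N where "N = F\<inverse> `` S"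
    define A where "A = {..<m} - N"
    have N: "N \<subseteq> {..<m}" using F_less by (auto simp: N_def)
    have fN: "finite N" using N by (rule finite_subset) simp
    have "S \<noteq> {}" "S \<subset> {..<m}" using less.prems(1,2) False by (auto simp: S_def B_def)
    then have SN: "card S < card N"
      using strong_hall_converse[OF strong_hall] unfolding strong_hall_def N_def by blast
    have "card A = m - card N" unfolding A_def using N fN by (simp add: card_Diff_subset)
    moreover have "card N \<le> m" using card_mono[OF _ N] by simp
    moreover have "{..<m} = S \<union> B" "S \<inter> B = {}" by (auto simp: S_def B_def)
    then have "m = card S + card B" using fin by (metis card_Un_disjoint card_lessThan)
    ultimately have "card A < card B" using SN by linarith
    then obtain \<gamma>0 where \<gamma>0: "\<exists>j\<in>B. \<gamma>0 j \<noteq> 0" "\<And>i. i \<in> A \<Longrightarrow> (\<Sum>j\<in>B. entry F X z i j * \<gamma>0 j) = 0"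
      using underdetermined_system[of A B "entry F X z"] fin by (auto simp: A_def)
    define \<gamma> where "\<gamma> j = (if j \<in> B then \<gamma>0 j else 0)" for j
    have sum\<gamma>: "(\<Sum>j<m. c j * \<gamma> j) = (\<Sum>j\<in>B. c j * \<gamma>0 j)" for c
      by (rule sum.mono_neutral_cong_right) (auto simp: \<gamma>_def B_def)
    define d where "d i = (\<Sum>j<m. entry F X z i j * \<gamma> j)" for i
    have "\<forall>i\<in>N. \<exists>j\<in>S. (i, j) \<in> F" by (auto simp: N_def)
    then obtain s where s: "\<And>i. i \<in> N \<Longrightarrow> s i \<in> S \<and> (i, s i) \<in> F" by metis
    \<comment> \<open>Adding t times \<open>\<gamma>\<close> to the kernel vector spoils row i by t
      times \<open>d i\<close>. Changing one entry of the row, in a column \<open>s i\<close> where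
      \<open>\<beta>\<close> is non-zero, repairs this exactly: \<open>\<gamma>\<close> vanishes in
      that column, so no term quadratic in t survives.\<close>
    define y where "y = (\<lambda>u. if u \<in> (\<lambda>i. X (i, s i)) ` N
      then (\<lambda>(i, j). - d i / \<beta> j) (inv_into F X u) else 0)"
    have ey: "entry F X y i j = (if i \<in> N \<and> j = s i then - d i / \<beta> j else 0)" for i j
      unfolding y_def by (rule entry_matching) (use s inj in auto)
    have sumy: "(\<Sum>j<m. entry F X y i j * c j) = (if i \<in> N then - d i / \<beta> (s i) * c (s i) else 0)" for c i
    proof (cases "i \<in> N")
      case True
      then have "(\<Sum>j<m. entry F X y i j * c j) = (\<Sum>j<m. if j = s i then - d i / \<beta> j * c j else 0)"
        by (intro sum.cong) (auto simp: ey)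
      then show ?thesis using True s[OF True] by (auto simp: S_def)
    qed (simp add: ey)
    have "P (\<lambda>u. z u + t * y u) = 0" if t: "t \<notin> {0}" for t
    proof -
      define \<beta>' where "\<beta>' j = \<beta> j + t * \<gamma> j" for j
      obtain j0 where j0: "j0 \<in> B" "\<gamma>0 j0 \<noteq> 0" using \<gamma>0(1) by blast
      \<comment> \<open>Only t = 0 has to be excluded: the columns in \<open>S\<close> keep their
        non-zero values, because \<open>\<gamma>\<close> vanishes there, and \<open>j0\<close> is
        gained.\<close>
      have "{j. j < m \<and> \<beta>' j = 0} \<subseteq> B - {j0}"
        using j0 t by (auto simp: \<beta>'_def B_def \<gamma>_def)
      then have "card {j. j < m \<and> \<beta>' j = 0} \<le> card (B - {j0})" using fin by (intro card_mono) auto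
      also have "\<dots> < card B" using fin j0 by (intro card_Diff1_less) auto
      finally have "card {j. j < m \<and> \<beta>' j = 0} < card {j. j < m \<and> \<beta> j = 0}" by (simp add: B_def)
      moreover have "j0 < m" "\<beta>' j0 \<noteq> 0" using j0 t by (auto simp: \<beta>'_def B_def \<gamma>_def)
      moreover have "(\<Sum>j<m. entry F X (\<lambda>u. z u + t * y u) i j * \<beta>' j) = 0" if i: "i < m" for i
      proof -
        have "(\<Sum>j<m. entry F X (\<lambda>u. z u + t * y u) i j * \<beta>' j) =
          (\<Sum>j<m. entry F X z i j * \<beta> j) + t * d i +
          t * (\<Sum>j<m. entry F X y i j * \<beta> j) + t * t * (\<Sum>j<m. entry F X y i j * \<gamma> j)"
          unfolding \<beta>'_def entry_line d_def
          by (simp add: sum_distrib_left sum.distrib[symmetric] algebra_simps)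
        also have "(\<Sum>j<m. entry F X y i j * \<gamma> j) = 0"
          unfolding sumy using s by (auto simp: \<gamma>_def S_def B_def)
        also have "(\<Sum>j<m. entry F X y i j * \<beta> j) = - d i"
        proof (cases "i \<in> N")
          case True
          then show ?thesis unfolding sumy using s[OF True] by (simp add: S_def)
        next
          case False
          then have "d i = 0" using \<gamma>0(2)[of i] i unfolding d_def sum\<gamma> by (simp add: A_def)
          then show ?thesis unfolding sumy using False by simp
        qed
        finally show ?thesis using less.prems(3)[OF i] by simp
      qed
      ultimately show ?thesis by (rule less.hyps)
    qed
    then show ?thesis
      using line_poly_limit[OF P, of "{0}" z y] by fast
  qed
qed

theorem vanish_of_det_zero:
  assumes "line_poly P" "\<And>z. full_kernels {..<m} {..<m} F X z \<Longrightarrow> P z = 0" "dt z = 0"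
  shows "P z = 0"
proof -
  obtain \<beta> k where \<beta>: "k < m" "\<beta> k \<noteq> 0" "\<And>i. i < m \<Longrightarrow> (\<Sum>j<m. entry F X z i j * \<beta> j) = 0"
    using det_zmat_eq_0D[OF assms(3)] by auto
  show ?thesis by (rule vanish_of_right_kernel[OF assms(1) _ \<beta>]) (rule assms(2))
qed

end

section \<open>Polynomials without zeros outside of the determinantal hypersurface\<close>

definition scale :: "'u set \<Rightarrow> complex \<Rightarrow> ('u \<Rightarrow> complex) \<Rightarrow> 'u \<Rightarrow> complex" where
  "scale S t z u = (if u \<in> S then t * z u else z u)"

text \<open>Where q is non-zero, scaling by a non-zero t stays off the zeros of q, so p along this
  scaling is a polynomial in t without non-zero roots, hence a monomial. Two components of p of
  different degrees in S would both be non-zero at a generic such point, which the monomial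
  forbids.\<close>

lemma scaling_homogeneous:
  assumes q: "line_poly q" "q z0 \<noteq> 0" "\<And>t z. q (scale S t z) = t * q z"
    and p: "\<And>z. q z \<noteq> 0 \<Longrightarrow> peval z p \<noteq> 0"
  shows "\<exists>D. \<forall>t z. peval (scale S t z) p = t ^ D * peval z p"
proof -
  define deg where "deg m = (\<Sum>u\<in>Poly_Mapping.keys m \<inter> S. Poly_Mapping.lookup m u)" for m :: "'a \<Rightarrow>\<^sub>0 nat"
  have meval_scale: "meval (scale S t z) m = t ^ deg m * meval z m" for t z m
  proof -
    have "meval (scale S t z) m =
      (\<Prod>u\<in>Poly_Mapping.keys m. (if u \<in> S then t ^ Poly_Mapping.lookup m u else 1) * z u ^ Poly_Mapping.lookup m u)"
      unfolding meval_def by (rule prod.cong) (auto simp: scale_def power_mult_distrib)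
    also have "\<dots> = t ^ deg m * meval z m"
      by (simp add: prod.distrib meval_def deg_def power_sum prod.inter_restrict)
    finally show ?thesis .
  qed
  define K where "K = deg ` Poly_Mapping.keys p"
  have K: "finite K" by (simp add: K_def)
  define h where "h k z = (\<Sum>m | m \<in> Poly_Mapping.keys p \<and> deg m = k. Poly_Mapping.lookup p m * meval z m)" for k z
  have h_lp: "line_poly (h k)" for k
    unfolding h_def meval_def
    by (intro line_poly_sum line_poly_mult line_poly_const line_poly_prod line_poly_power line_poly_coord)
  define P where "P z = (\<Sum>k\<in>K. monom (h k z) k)" for z
  have P: "poly (P z) t = peval (scale S t z) p" for z t
  proof -
    have "peval (scale S t z) p = (\<Sum>m\<in>Poly_Mapping.keys p. Poly_Mapping.lookup p m * (t ^ deg m * meval z m))"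
      by (simp add: peval_meval meval_scale)
    also have "\<dots> = (\<Sum>k\<in>K. \<Sum>m | m \<in> Poly_Mapping.keys p \<and> deg m = k.
        Poly_Mapping.lookup p m * (t ^ deg m * meval z m))"
      unfolding K_def by (rule sum.image_gen) simp
    also have "\<dots> = (\<Sum>k\<in>K. h k z * t ^ k)"
      by (rule sum.cong) (simp_all add: h_def sum_distrib_left sum_distrib_right mult_ac)
    finally show ?thesis by (simp add: P_def poly_sum poly_monom)
  qed
  have scale1: "scale S 1 z = z" for z by (auto simp: scale_def)
  have coeffP: "coeff (P z) k = h k z" if "k \<in> K" for z k
    using that K by (simp add: P_def coeff_sum)
  have "P z0 \<noteq> 0" using P[of z0 1] p[OF q(2)] by (auto simp: scale1)
  then obtain k where k: "k \<in> K" "h k z0 \<noteq> 0"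
    unfolding P_def by (metis (no_types, lifting) monom_eq_0 sum.neutral)
  have h0: "h l z = 0" if l: "l \<in> K" "l \<noteq> k" for l z
  proof (rule ccontr)
    assume "h l z \<noteq> 0"
    then obtain w where w: "q w * h k w \<noteq> 0" "h l w \<noteq> 0"
      using line_poly_common_nonzero[of "\<lambda>z. q z * h k z" "h l" z0 z] q(1,2) k(2) h_lp by auto
    have "poly (P w) t \<noteq> 0" if "t \<noteq> 0" for t
      unfolding P by (rule p) (use q(3) w that in auto)
    then obtain c n where "P w = monom c n" using poly_nonvanishing_off_0 by blast
    then have "h k w = (if n = k then c else 0)" "h l w = (if n = l then c else 0)"
      using coeffP k(1) l(1) by (metis coeff_monom)+
    then show False using w l(2) by (auto split: if_splits)
  qed
  have "P z = monom (h k z) k" for z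
  proof -
    have "P z = (\<Sum>l\<in>{k}. monom (h l z) l)"
      unfolding P_def by (rule sum.mono_neutral_right) (use K k h0 in auto)
    then show ?thesis by simp
  qed
  then have *: "peval (scale S t z) p = h k z * t ^ k" for t z
    using P[of z t] by (simp add: poly_monom)
  then have "peval (scale S t z) p = t ^ k * peval z p" for t z
    using *[of 1 z] by (simp add: scale1)
  then show ?thesis by blast
qed

section \<open>Degrees in rows and columns, and powers of the determinant\<close>

context generic_matrix
begin

definition "row_vars i = {X (i, j) |j. (i, j) \<in> F}"
definition "col_vars j = {X (i, j) |i. (i, j) \<in> F}"

lemma X_in_row_vars: "(i, j) \<in> F \<Longrightarrow> X (i, j) \<in> row_vars r \<longleftrightarrow> i = r"
  using X_eq_iff by (auto simp: row_vars_def)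

lemma X_in_col_vars: "(i, j) \<in> F \<Longrightarrow> X (i, j) \<in> col_vars c \<longleftrightarrow> j = c"
  using X_eq_iff by (auto simp: col_vars_def)

lemma dt_row: "i < m \<Longrightarrow> dt z = (\<Sum>j<m. entry F X z i j * cofactor (zmat m F X z) i j)"
  using laplace_expansion_row[OF zmat_carrier, of i m F X z] by simp

lemma dt_col: "j < m \<Longrightarrow> dt z = (\<Sum>i<m. entry F X z i j * cofactor (zmat m F X z) i j)"
  using laplace_expansion_column[OF zmat_carrier, of j m F X z] by simp

lemma dt_scale_row:
  assumes i: "i < m"
  shows "dt (scale (row_vars i) t z) = t * dt z"
proof -
  have e: "entry F X (scale (row_vars i) t z) r c = (if r = i then t else 1) * entry F X z r c" for r c
    by (simp add: entry_def scale_def X_in_row_vars)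
  have "cofactor (zmat m F X (scale (row_vars i) t z)) i j = cofactor (zmat m F X z) i j" if "j < m" for j
    by (rule cofactor_cong[of _ m]) (use i that in \<open>auto simp: e\<close>)
  then show ?thesis
    unfolding dt_row[OF i] by (auto simp: e sum_distrib_left mult_ac intro!: sum.cong)
qed

lemma dt_scale_col:
  assumes j: "j < m"
  shows "dt (scale (col_vars j) t z) = t * dt z"
proof -
  have e: "entry F X (scale (col_vars j) t z) r c = (if c = j then t else 1) * entry F X z r c" for r c
    by (simp add: entry_def scale_def X_in_col_vars)
  have "cofactor (zmat m F X (scale (col_vars j) t z)) i j = cofactor (zmat m F X z) i j" if "i < m" for i
    by (rule cofactor_cong[of _ m]) (use j that in \<open>auto simp: e\<close>)
  then show ?thesis
    unfolding dt_col[OF j] by (auto simp: e sum_distrib_left mult_ac intro!: sum.cong)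
qed

lemma dt_surj: "\<exists>z. dt z = s"
proof -
  obtain z where "dt z \<noteq> 0" using det_nonzero by blast
  then have "dt (scale (row_vars 0) (s / dt z) z) = s"
    using dt_scale_row[OF m_pos] by simp
  then show ?thesis by blast
qed

text \<open>The cofactors along row i do not change when only this row does, so the determinant is
  affine on the line.\<close>

lemma dt_row_line:
  assumes i: "i < m" and eq: "\<And>u. u \<notin> row_vars i \<Longrightarrow> z u = z' u"
  shows "dt (\<lambda>u. z u + t * (z' u - z u)) = dt z + t * (dt z' - dt z)"
proof -
  have e: "entry F X (\<lambda>u. z u + t * (z' u - z u)) r c =
      entry F X z r c + t * (entry F X z' r c - entry F X z r c)" for r c
    by (simp add: entry_def)
  have e': "entry F X z' r c = entry F X z r c" if "r \<noteq> i" for r c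
    using that eq[of "X (r, c)"] X_in_row_vars by (auto simp: entry_def)
  have c: "cofactor (zmat m F X (\<lambda>u. z u + t * (z' u - z u))) i j = cofactor (zmat m F X z) i j"
    "cofactor (zmat m F X z') i j = cofactor (zmat m F X z) i j" if "j < m" for j
    by (rule cofactor_cong[of _ m]; use i that in \<open>auto simp: e e'\<close>)+
  have "dt (\<lambda>u. z u + t * (z' u - z u)) =
      (\<Sum>j<m. (entry F X z i j + t * (entry F X z' i j - entry F X z i j)) * cofactor (zmat m F X z) i j)"
    unfolding dt_row[OF i] by (rule sum.cong) (auto simp: e c)
  moreover have "dt z' = (\<Sum>j<m. entry F X z' i j * cofactor (zmat m F X z) i j)"
    unfolding dt_row[OF i] by (rule sum.cong) (auto simp: c)
  ultimately show ?thesis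
    unfolding dt_row[OF i, of z]
    by (simp add: sum_distrib_left sum.distrib[symmetric] sum_subtractf[symmetric] algebra_simps)
qed

text \<open>In the permutation matrix of a matching through the edge, row i and column j have their
  only non-zero entry in common. Scaling the row and scaling the column have the same effect there,
  which makes the degrees of a polynomial in both comparable.\<close>

lemma edge_matching_point:
  assumes edge: "(i, j) \<in> F"
  shows "\<exists>z. dt z \<noteq> 0 \<and> (\<forall>u \<in> row_vars i \<union> col_vars j. u \<noteq> X (i, j) \<longrightarrow> z u = 0)"
proof -
  obtain \<pi> where \<pi>: "bij_betw \<pi> {..<m} {..<m}" "\<pi> i = j" "\<And>r. r < m \<Longrightarrow> (r, \<pi> r) \<in> F"
    using edge_matching[OF edge] by blast
  define z where "z = (\<lambda>u. if u \<in> (\<lambda>r. X (r, \<pi> r)) ` {..<m} then 1 else 0 :: complex)"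
  have e: "entry F X z r c = (if r \<in> {..<m} \<and> c = \<pi> r then 1 else 0)" for r c
    unfolding z_def by (rule entry_matching) (use \<pi>(3) in auto)
  have "dt z \<noteq> 0"
    by (rule det_permutation_matrix[OF _ \<pi>(1)]) (auto simp: e)
  moreover have "z (X (r, c)) = 0" if "(r, c) \<in> F" "(r, c) \<noteq> (i, j)" "r = i \<or> c = j" for r c
  proof -
    have "c \<noteq> \<pi> r"
      using that \<pi>(2) F_less[OF that(1)] F_less[OF edge] bij_betw_imp_inj_on[OF \<pi>(1)]
      by (auto dest: inj_onD)
    then have "entry F X z r c = 0" by (simp add: e)
    then show ?thesis using that by (simp add: entry_def)
  qed
  ultimately show ?thesis
    by (intro exI[of _ z]) (auto simp: row_vars_def col_vars_def)
qed

text \<open>Such a polynomial is homogeneous in each row and each column, and these degrees agree for the row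
  and the column of an edge. Two matrices with the same non-zero determinant which differ in one row only
  are joined by a line in a level set of the determinant; the polynomial has no zeros there, and hence
  is constant on that line. Changing the rows one after the other, one can compare any two generic
  matrices.\<close>

theorem power_of_det:
  assumes p: "\<And>z. dt z \<noteq> 0 \<Longrightarrow> peval z p \<noteq> 0"
  shows "\<exists>c D. c \<noteq> 0 \<and> (\<forall>z. peval z p = c * dt z ^ D)"
proof -
  obtain z1 where z1: "dt z1 \<noteq> 0" using det_nonzero by blast
  have "\<forall>i\<in>{..<m}. \<exists>D. \<forall>t z. peval (scale (row_vars i) t z) p = t ^ D * peval z p"
    using scaling_homogeneous[OF line_poly_det_zmat z1 _ p] dt_scale_row by blast
  then obtain R where R: "\<And>i t z. i < m \<Longrightarrow> peval (scale (row_vars i) t z) p = t ^ R i * peval z p"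
    by (metis lessThan_iff)
  have "\<forall>j\<in>{..<m}. \<exists>D. \<forall>t z. peval (scale (col_vars j) t z) p = t ^ D * peval z p"
    using scaling_homogeneous[OF line_poly_det_zmat z1 _ p] dt_scale_col by blast
  then obtain C where C: "\<And>j t z. j < m \<Longrightarrow> peval (scale (col_vars j) t z) p = t ^ C j * peval z p"
    by (metis lessThan_iff)
  have RC: "R i = C j" if edge: "(i, j) \<in> F" for i j
  proof -
    obtain z where z: "dt z \<noteq> 0" "\<And>u. u \<in> row_vars i \<union> col_vars j \<Longrightarrow> u \<noteq> X (i, j) \<Longrightarrow> z u = 0"
      using edge_matching_point[OF edge] by blast
    have "X (i, j) \<in> row_vars i" "X (i, j) \<in> col_vars j"
      using edge by (simp_all add: X_in_row_vars X_in_col_vars)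
    then have "scale (row_vars i) 2 z = scale (col_vars j) 2 z"
      using z(2) by (auto simp: scale_def fun_eq_iff)
    then have "(2 :: complex) ^ R i * peval z p = 2 ^ C j * peval z p"
      using R C F_less[OF edge] by metis
    then have "(2 :: complex) ^ R i = 2 ^ C j" using p[OF z(1)] by simp
    \<comment> \<open>Norms are taken because exponents are compared in an ordered field.\<close>
    then have "(2 :: real) ^ R i = 2 ^ C j"
      by (metis norm_numeral norm_power)
    then show ?thesis by simp
  qed
  define D where "D = R 0"
  \<comment> \<open>Rows with a common column have equal degrees by \<open>RC\<close>, so the rows
    of degree \<open>D\<close> share no column with the others; by Hall's condition they are all the
    rows.\<close>
  have "{i. i < m \<and> R i = D} = {..<m}"
    by (rule strong_hall_partition[OF strong_hall])
      (use m_pos RC F_less in \<open>auto simp: D_def, (metis RC)?\<close>)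
  then have RD: "R i = D" if "i < m" for i using that by blast

  have row_move: "peval z' p * dt z ^ D = peval z p * dt z' ^ D"
    if i: "i < m" and eq: "\<And>u. u \<notin> row_vars i \<Longrightarrow> z u = z' u" and nz: "dt z \<noteq> 0" "dt z' \<noteq> 0" for i z z'
  proof -
    \<comment> \<open>Multiplying row i of \<open>z'\<close> by this ratio gives it the determinant
      of \<open>z\<close>, so that the determinant is constant on the line between them.\<close>
    define s where "s = dt z / dt z'"
    define y where "y = scale (row_vars i) s z'"
    have y: "dt y = dt z" using nz by (simp add: y_def s_def dt_scale_row[OF i])
    have "z u = y u" if "u \<notin> row_vars i" for u
      using eq that by (simp add: y_def scale_def)
    then have "dt (\<lambda>u. z u + t * (y u - z u)) \<noteq> 0" for t
      using dt_row_line[OF i] y nz by simp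
    then have "peval (\<lambda>u. z u + 1 * (y u - z u)) p = peval z p"
      by (intro line_poly_nonvanishing line_poly_peval p)
    then have "peval y p = peval z p" by simp
    then have "s ^ D * peval z' p = peval z p" using R[OF i] RD[OF i] by (simp add: y_def)
    then show ?thesis using nz by (simp add: s_def power_divide field_simps)
  qed

  \<comment> \<open>The first r rows are taken from \<open>z\<close>, everything else from
    \<open>z1\<close>; consecutive matrices differ in one row.\<close>
  define mix where "mix r z u = (if \<exists>i<r. u \<in> row_vars i then z u else z1 u)" for r z u
  \<comment> \<open>Where this product is non-zero, \<open>row_move\<close> applies at every stage.
    It is non-zero at \<open>z1\<close>, so an identity proved at such points holds
    everywhere.\<close>
  define f where "f z = (\<Prod>r\<le>m. dt (mix r z))" for z
  have "line_poly (\<lambda>z. mix r z u)" for r u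
    unfolding mix_def by (intro line_poly_if line_poly_coord line_poly_const)
  then have "line_poly (\<lambda>z. dt (mix r z))" for r
    by (intro line_poly_det[OF zmat_carrier]) (auto simp: entry_def)
  then have f_lp: "line_poly f" unfolding f_def by (intro line_poly_prod)
  have "mix r z1 = z1" for r by (auto simp: mix_def)
  then have f1: "f z1 \<noteq> 0" using z1 by (simp add: f_def)
  define h where "h z = peval z p * dt z1 ^ D - peval z1 p * dt z ^ D" for z
  have h_lp: "line_poly h" unfolding h_def
    by (intro line_poly_diff line_poly_mult line_poly_peval line_poly_const line_poly_power line_poly_det_zmat)
  have "h z = 0" if "f z \<noteq> 0" for z
  proof -
    have nz: "dt (mix r z) \<noteq> 0" if "r \<le> m" for r
      using \<open>f z \<noteq> 0\<close> that by (simp add: f_def)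
    have "r \<le> m \<Longrightarrow> peval (mix r z) p * dt z1 ^ D = peval z1 p * dt (mix r z) ^ D" for r
    proof (induction r)
      case 0
      have "mix 0 z = z1" by (auto simp: mix_def)
      then show ?case by simp
    next
      case (Suc r)
      have "mix r z u = mix (Suc r) z u" if "u \<notin> row_vars r" for u
        using that by (auto simp: mix_def less_Suc_eq)
      then have "peval (mix (Suc r) z) p * dt (mix r z) ^ D = peval (mix r z) p * dt (mix (Suc r) z) ^ D"
        using Suc.prems by (intro row_move[of r] nz) auto
      then have "peval (mix (Suc r) z) p * dt z1 ^ D * dt (mix r z) ^ D =
          (peval (mix r z) p * dt z1 ^ D) * dt (mix (Suc r) z) ^ D"
        by (metis mult.assoc mult.commute)
      also have "\<dots> = peval z1 p * dt (mix (Suc r) z) ^ D * dt (mix r z) ^ D"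
        using Suc by simp
      finally show ?case using nz[of r] Suc.prems by simp
    qed
    then have m: "peval (mix m z) p * dt z1 ^ D = peval z1 p * dt (mix m z) ^ D" by simp
    \<comment> \<open>The polynomial may involve variables outside of the support, where
      \<open>mix m z\<close> still has the values of \<open>z1\<close>. The determinant is
      independent of them and stays non-zero on the line to \<open>z\<close>, so the polynomial is
      constant on this line.\<close>
    have eq: "mix m z (X (i, j)) = z (X (i, j))" if "(i, j) \<in> F" for i j
      using F_less[OF that] that by (auto simp: mix_def X_in_row_vars)
    have dt_eq: "dt (\<lambda>u. mix m z u + t * (z u - mix m z u)) = dt (mix m z)" for t
      by (rule arg_cong[where f = Determinant.det], rule eq_matI)
        (auto simp: zmat_def entry_def eq)
    have "peval (\<lambda>u. mix m z u + 1 * (z u - mix m z u)) p = peval (mix m z) p"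
      by (intro line_poly_nonvanishing line_poly_peval p) (simp add: dt_eq nz)
    then have "peval z p = peval (mix m z) p" by simp
    moreover have "dt z = dt (mix m z)" using dt_eq[of 1] by simp
    ultimately show ?thesis using m by (simp add: h_def)
  qed
  then have "h z = 0" for z
    by (intro line_poly_mult_eq_0[OF f_lp h_lp _ f1]) auto
  then have "peval z p = peval z1 p / dt z1 ^ D * dt z ^ D" for z
    using z1 by (simp add: h_def field_simps)
  moreover have "peval z1 p / dt z1 ^ D \<noteq> 0" using z1 p by simp
  ultimately show ?thesis by blast
qed

section \<open>The determinant as reduced equation of the discriminant variety\<close>

abbreviation "dpoly \<equiv> Determinant.det (pmat m F X)"

text \<open>Both y and the complementary factor s are zero-free off the determinantal hypersurface,
  hence constants times powers of the determinant. As the determinant takes every value, the values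
  1 and 2 can be compared; they force 2 D + D' = 1, so D = 0 and y is a unit.\<close>

lemma squarefree_dpoly: "squarefree dpoly"
proof (rule squarefreeI)
  fix y assume "y ^ 2 dvd dpoly"
  then obtain s where s: "dpoly = y ^ 2 * s" by (elim dvdE)
  have dt: "dt z = peval z y ^ 2 * peval z s" for z
    using arg_cong[OF s, of "peval z"] by (simp add: peval_det_pmat peval_mult peval_power)
  obtain c D where c: "c \<noteq> 0" "\<And>z. peval z y = c * dt z ^ D"
    using power_of_det[of y] dt by force
  obtain c' D' where c': "c' \<noteq> 0" "\<And>z. peval z s = c' * dt z ^ D'"
    using power_of_det[of s] dt by force
  have *: "a = (c\<^sup>2 * c') * a ^ (2 * D + D')" for a
  proof -
    obtain z where z: "dt z = a" using dt_surj by blast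
    show ?thesis using dt[of z] unfolding c c' z
      by (simp add: power_mult_distrib power_add power_mult mult_ac)
  qed
  have "(2 :: complex) = 2 ^ (2 * D + D')" using *[of 1] *[of 2] by simp
  then have "(2 :: real) ^ 1 = 2 ^ (2 * D + D')"
    by (metis norm_numeral norm_power power_one_right)
  then have "2 * D + D' = 1" by (metis one_less_numeral_iff power_inject_exp semiring_norm(76))
  then have "D = 0" by simp
  then have "y * pconst (1 / c) = 1"
    using c by (intro peval_inject) (simp add: peval_mult)
  then show "y dvd 1" by (metis dvdI)
qed

text \<open>The determinant has zeros, which excludes the exponent 0 and shows that it is not a
  unit; squarefreeness then excludes the exponents from 2 on.\<close>

lemma squarefree_same_zeros:
  assumes "squarefree p" "\<And>z. peval z p = 0 \<longleftrightarrow> dt z = 0"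
  shows "\<exists>c. c \<noteq> 0 \<and> p = pconst c * dpoly"
proof -
  obtain c D where c: "c \<noteq> 0" "\<And>z. peval z p = c * dt z ^ D"
    using power_of_det[of p] assms(2) by blast
  have p: "p = pconst c * dpoly ^ D"
    by (rule peval_inject) (simp add: c peval_mult peval_power peval_det_pmat)
  obtain z where z: "dt z = 0" using dt_surj by blast
  have "D \<noteq> 0" using c assms(2)[of z] z by (cases D) auto
  moreover have "\<not> D \<ge> 2"
  proof
    assume "D \<ge> 2"
    then have "dpoly ^ 2 dvd p" unfolding p by (intro dvd_mult le_imp_power_dvd)
    then have "dpoly dvd 1" using assms(1) by (rule squarefreeD[rotated])
    then obtain s where "1 = dpoly * s" by (elim dvdE)
    from arg_cong[OF this, of "peval z"] show False
      using z by (simp add: peval_mult peval_det_pmat)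
  qed
  ultimately have "D = 1" by linarith
  then show ?thesis using p c(1) by auto
qed

lemma pvars_dpoly: "pvars dpoly \<noteq> {}"
proof
  assume e: "pvars dpoly = {}"
  obtain z z' where "dt z = 0" "dt z' = 1" using dt_surj by metis
  moreover have "dt z = dt z'"
    using peval_cong[of dpoly z z'] by (simp add: e peval_det_pmat)
  ultimately show False by simp
qed

text \<open>Points of \<open>coeff_space\<close> take the value \<open>undefined\<close> outside of
  the index set. Restriction turns an arbitrary z into such a point without changing any value at a
  variable of the matrix.\<close>

lemma dt_restrict: "dt (restrict z (X ` F)) = dt z"
proof -
  have "peval (restrict z (X ` F)) dpoly = peval z dpoly"
    by (rule peval_cong) (use pvars_det_pmat[of m F X] in auto)
  then show ?thesis by (simp add: peval_det_pmat)
qed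

lemma restrict_coeff_space [simp]: "restrict z B \<in> coeff_space B"
  by (simp add: coeff_space_def)

lemma full_kernels_restrict:
  "full_kernels {..<m} {..<m} F X (restrict z (X ` F)) \<longleftrightarrow> full_kernels {..<m} {..<m} F X z"
proof -
  have "entry F X (restrict z (X ` F)) = entry F X z" by (auto simp: entry_def fun_eq_iff)
  then show ?thesis by (simp add: full_kernels_def)
qed

lemma full_kernels_det: "full_kernels {..<m} {..<m} F X z \<Longrightarrow> dt z = 0"
  unfolding full_kernels_def using det_zmat_eq_0I[OF m_pos, of _ F X z] m_pos by auto

text \<open>The determinant is one of the polynomials defining the closure, and by
  \<open>vanish_of_det_zero\<close> all the others vanish wherever it does.\<close>

lemma zariski_closure_full_kernels:
  "zariski_closure (X ` F) {z \<in> coeff_space (X ` F). full_kernels {..<m} {..<m} F X z} =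
   zero_locus (X ` F) dpoly"
    (is "zariski_closure ?B ?V = _")
proof
  have "?V \<subseteq> zero_locus ?B dpoly"
    by (auto simp: zero_locus_def peval_det_pmat full_kernels_det)
  then show "zariski_closure ?B ?V \<subseteq> zero_locus ?B dpoly"
    unfolding zariski_closure_def using pvars_det_pmat[of m F X] by blast
  show "zero_locus ?B dpoly \<subseteq> zariski_closure ?B ?V"
    unfolding zariski_closure_def
  proof (safe)
    fix z p assume z: "z \<in> zero_locus ?B dpoly" and p: "pvars p \<subseteq> ?B" "?V \<subseteq> zero_locus ?B p"
    have "peval w p = 0" if "full_kernels {..<m} {..<m} F X w" for w
    proof -
      have "restrict w ?B \<in> ?V" using that by (simp add: full_kernels_restrict)
      then have "restrict w ?B \<in> zero_locus ?B p" using p(2) by blast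
      then have "peval (restrict w ?B) p = 0" by (simp add: zero_locus_def)
      moreover have "peval (restrict w ?B) p = peval w p"
        by (rule peval_cong) (use p(1) in auto)
      ultimately show ?thesis by simp
    qed
    then have "peval z p = 0"
      using z vanish_of_det_zero[OF line_poly_peval[of p], of z]
      by (simp add: zero_locus_def peval_det_pmat)
    then show "z \<in> zero_locus ?B p" using z by (simp add: zero_locus_def)
  qed (simp add: zero_locus_def)
qed

lemma hypersurface_dpoly: "hypersurface (X ` F) (zero_locus (X ` F) dpoly)"
  unfolding hypersurface_def using pvars_det_pmat[of m F X] pvars_dpoly by (intro exI[of _ dpoly]) simp

lemma some_reduced_defining_poly:
  "\<exists>c. c \<noteq> 0 \<and> (SOME p. reduced_defining_poly (X ` F) (zero_locus (X ` F) dpoly) p) = pconst c * dpoly"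
proof -
  let ?B = "X ` F"
  define p where "p = (SOME p. reduced_defining_poly ?B (zero_locus ?B dpoly) p)"
  have "reduced_defining_poly ?B (zero_locus ?B dpoly) dpoly"
    by (simp add: reduced_defining_poly_def squarefree_dpoly pvars_det_pmat)
  then have "reduced_defining_poly ?B (zero_locus ?B dpoly) p"
    unfolding p_def by (rule someI)
  then have p: "pvars p \<subseteq> ?B" "squarefree p" "zero_locus ?B dpoly = zero_locus ?B p"
    by (auto simp: reduced_defining_poly_def)
  have "peval z p = 0 \<longleftrightarrow> dt z = 0" for z
  proof -
    have "peval z p = peval (restrict z ?B) p"
      by (rule peval_cong) (use p(1) in auto)
    also have "\<dots> = 0 \<longleftrightarrow> restrict z ?B \<in> zero_locus ?B p" by (simp add: zero_locus_def)
    also have "\<dots> \<longleftrightarrow> restrict z ?B \<in> zero_locus ?B dpoly" by (simp add: p(3))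
    also have "\<dots> \<longleftrightarrow> dt z = 0" by (simp add: zero_locus_def peval_det_pmat dt_restrict)
    finally show ?thesis .
  qed
  then show ?thesis using squarefree_same_zeros[OF p(2)] by (simp add: p_def)
qed

end

section \<open>When the discriminant variety is a hypersurface\<close>

text \<open>Let x occur in the equation p, and let g be non-zero, free of x and zero on V. At a
  generic point g is non-zero and p is not constant in the direction of x. By the fundamental
  theorem of algebra p has a zero on the line in this direction, where g keeps its non-zero value,
  although g vanishes on the closure.\<close>

lemma hypersurface_variable:
  assumes "hypersurface B (zariski_closure B V)"
  shows "\<exists>x\<in>B. \<forall>g. pvars g \<subseteq> B - {x} \<longrightarrow> V \<subseteq> zero_locus B g \<longrightarrow> (\<forall>z. peval z g = 0)"
proof -
  obtain p x where p: "pvars p \<subseteq> B" "x \<in> pvars p" "zariski_closure B V = zero_locus B p"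
    using assms unfolding hypersurface_def by blast
  have "peval z0 g = 0" if g: "pvars g \<subseteq> B - {x}" "V \<subseteq> zero_locus B g" for g z0
  proof (rule ccontr)
    assume "peval z0 g \<noteq> 0"
    have sub: "zero_locus B p \<subseteq> zero_locus B g"
      using g unfolding p(3)[symmetric] zariski_closure_def by blast
    define f where "f z = peval z p - peval (z(x := 0)) p" for z
    have "line_poly (\<lambda>z. (z(x := 0)) u)" for u
      unfolding fun_upd_def by (intro line_poly_if line_poly_coord line_poly_const)
    then have "line_poly (\<lambda>z. peval (z(x := 0)) p)"
      unfolding peval_def
      by (intro line_poly_sum line_poly_mult line_poly_const line_poly_prod line_poly_power)
    then have f: "line_poly f"
      unfolding f_def by (intro line_poly_diff line_poly_peval)
    obtain z where "peval z p \<noteq> peval (z(x := 0)) p" using pvars_depends[OF p(2)] by blast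
    then have "f z \<noteq> 0" by (simp add: f_def)
    then obtain w where w: "f w \<noteq> 0" "peval w g \<noteq> 0"
      using line_poly_common_nonzero[OF f line_poly_peval[of g] _ \<open>peval z0 g \<noteq> 0\<close>] by blast
    have "\<exists>P. \<forall>t. peval (\<lambda>u. (w(x := 0)) u + t * (if u = x then 1 else 0)) p = poly P t"
      by (rule line_poly_peval[of p, unfolded line_poly_def, rule_format])
    then obtain P where P: "\<And>t. peval (\<lambda>u. (w(x := 0)) u + t * (if u = x then 1 else 0)) p = poly P t"
      by auto
    have "(\<lambda>u. (w(x := 0)) u + t * (if u = x then 1 else 0)) = w(x := t)" for t by auto
    then have P': "poly P t = peval (w(x := t)) p" for t using P[of t] by simp
    have "\<not> constant (poly P)"
    proof
      assume "constant (poly P)"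
      then have "poly P (w x) = poly P 0" unfolding constant_def by blast
      then show False using w(1) by (simp add: P' f_def)
    qed
    then obtain t where t: "peval (w(x := t)) p = 0"
      using fundamental_theorem_of_algebra[of P] P' by auto
    have r: "peval (restrict (w(x := t)) B) q = peval (w(x := t)) q" if "pvars q \<subseteq> B" for q
      by (rule peval_cong) (use that in auto)
    have "restrict (w(x := t)) B \<in> zero_locus B p"
      using t r[OF p(1)] by (simp add: zero_locus_def coeff_space_def)
    then have "peval (restrict (w(x := t)) B) g = 0" using sub by (auto simp: zero_locus_def)
    moreover have "peval (restrict (w(x := t)) B) g = peval w g"
      by (rule peval_cong) (use g(1) in auto)
    ultimately show False using w(2) by simp
  qed
  then show ?thesis using p(1,2) by blast
qed

text \<open>Equal cardinalities say that all entries of the rows W lie in a square block; the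
  injection provides a non-zero term of its determinant.\<close>

definition matched :: "('a \<times> 'b) set \<Rightarrow> 'a set \<Rightarrow> bool" where
  "matched F W \<longleftrightarrow> W \<noteq> {} \<and> card (F `` W) = card W \<and> (\<exists>f. inj_on f W \<and> (\<forall>i\<in>W. (i, f i) \<in> F))"

text \<open>The rows of W meet only the columns adjacent to W, so the corresponding part of a full
  right kernel vector is a non-zero kernel vector of the square block. The polynomial g is the
  determinant of this block.\<close>

lemma matched_vanishing:
  assumes F: "finite F" and X: "inj_on X F" and W: "W \<subseteq> fst ` F" "matched F W"
  shows "\<exists>g. pvars g \<subseteq> X ` (F \<inter> W \<times> UNIV) \<and> (\<exists>z. peval z g \<noteq> 0) \<and>
    (\<forall>z. full_kernels (fst ` F) (snd ` F) F X z \<longrightarrow> peval z g = 0)"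
proof -
  obtain f where f: "inj_on f W" "\<And>i. i \<in> W \<Longrightarrow> (i, f i) \<in> F"
    and card: "card (F `` W) = card W" and ne: "W \<noteq> {}"
    using W(2) unfolding matched_def by blast
  have fin: "finite W" "finite (F `` W)" using W(1) F by (auto intro: finite_subset)
  have im: "f ` W = F `` W"
    using f card_image[OF f(1)] card fin by (intro card_subset_eq) auto
  define m where "m = card W"
  have m: "0 < m" using ne fin by (simp add: m_def card_gt_0_iff)
  obtain \<sigma> where \<sigma>: "bij_betw \<sigma> {..<m} W"
    using ex_bij_betw_nat_finite[OF fin(1)] by (auto simp: m_def lessThan_atLeast0)
  \<comment> \<open>The columns are numbered along the matching, which thus becomes the diagonal;
    setting its variables to 1 and the others to 0 gives the identity matrix.\<close>
  define \<tau> where "\<tau> = f \<circ> \<sigma>"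
  have "bij_betw f W (F `` W)" using f(1) im by (simp add: bij_betw_def)
  then have \<tau>: "bij_betw \<tau> {..<m} (F `` W)" unfolding \<tau>_def by (rule bij_betw_trans[OF \<sigma>])
  have \<sigma>W: "\<sigma> r \<in> W" if "r < m" for r using \<sigma> that by (auto simp: bij_betw_def)
  have \<tau>W: "\<tau> r \<in> F `` W" if "r < m" for r using \<tau> that by (auto simp: bij_betw_def)
  define F' where "F' = {(r, c). r < m \<and> c < m \<and> (\<sigma> r, \<tau> c) \<in> F}"
  define X' where "X' = (\<lambda>(r, c). X (\<sigma> r, \<tau> c))"
  have e: "entry F' X' z r c = entry F X z (\<sigma> r) (\<tau> c)" if "r < m" "c < m" for z r c
    using that by (simp add: entry_def F'_def X'_def)
  define g where "g = Determinant.det (pmat m F' X')"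
  have "pvars g \<subseteq> X ` (F \<inter> W \<times> UNIV)"
    using pvars_det_pmat[of m F' X'] \<sigma>W unfolding g_def F'_def X'_def by fastforce
  moreover have "\<exists>z. peval z g \<noteq> 0"
  proof
    define z where "z = (\<lambda>u. if u \<in> (\<lambda>i. X (i, f i)) ` W then 1 else 0 :: complex)"
    have "zmat m F' X' z = 1\<^sub>m m"
    proof (rule eq_matI)
      fix r c assume "r < dim_row (1\<^sub>m m :: complex mat)" "c < dim_col (1\<^sub>m m :: complex mat)"
      then have rc: "r < m" "c < m" by auto
      have "(\<sigma> r, \<tau> c) \<in> F \<and> X (\<sigma> r, \<tau> c) \<in> (\<lambda>i. X (i, f i)) ` W \<longleftrightarrow> \<tau> c = f (\<sigma> r)"
      proof safe
        fix i assume "X (\<sigma> r, \<tau> c) = X (i, f i)" "i \<in> W" "(\<sigma> r, \<tau> c) \<in> F"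
        then show "\<tau> c = f (\<sigma> r)" using inj_onD[OF X] f(2) by blast
      qed (use f(2) \<sigma>W[OF rc(1)] in auto)
      moreover have "\<tau> c = f (\<sigma> r) \<longleftrightarrow> r = c"
        using rc inj_on_eq_iff[OF bij_betw_imp_inj_on[OF \<tau>], of c r] by (auto simp: \<tau>_def)
      ultimately have "entry F X z (\<sigma> r) (\<tau> c) = (if r = c then 1 else 0)"
        by (auto simp: entry_def z_def)
      then show "zmat m F' X' z $$ (r, c) = 1\<^sub>m m $$ (r, c)"
        using rc by (simp add: e)
    qed (auto simp: zmat_def)
    then show "peval z g \<noteq> 0" by (simp add: g_def peval_det_pmat)
  qed
  moreover have "peval z g = 0" if full: "full_kernels (fst ` F) (snd ` F) F X z" for z
  proof -
    obtain \<beta> where \<beta>: "\<And>j. j \<in> snd ` F \<Longrightarrow> \<beta> j \<noteq> 0"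
      "\<And>i. i \<in> fst ` F \<Longrightarrow> (\<Sum>j\<in>snd ` F. entry F X z i j * \<beta> j) = 0"
      using full unfolding full_kernels_def by metis
    have sub: "F `` W \<subseteq> snd ` F" by force
    show ?thesis unfolding g_def peval_det_pmat
    proof (rule det_zmat_eq_0I[OF m, of "\<lambda>c. \<beta> (\<tau> c)"])
      show "\<beta> (\<tau> 0) \<noteq> 0" using \<tau>W[OF m] sub by (intro \<beta>(1)) auto
      fix r assume r: "r < m"
      have "(\<Sum>c<m. entry F' X' z r c * \<beta> (\<tau> c)) = (\<Sum>c<m. entry F X z (\<sigma> r) (\<tau> c) * \<beta> (\<tau> c))"
        using r by (simp add: e)
      also have "\<dots> = (\<Sum>j\<in>F `` W. entry F X z (\<sigma> r) j * \<beta> j)"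
        by (rule sum.reindex_bij_betw[OF \<tau>])
      also have "\<dots> = (\<Sum>j\<in>snd ` F. entry F X z (\<sigma> r) j * \<beta> j)"
        by (rule sum.mono_neutral_left) (use F sub \<sigma>W[OF r] in \<open>auto simp: entry_def\<close>)
      also have "\<dots> = 0" using \<sigma>W[OF r] W(1) by (intro \<beta>(2)) auto
      finally show "(\<Sum>c<m. entry F' X' z r c * \<beta> (\<tau> c)) = 0" .
    qed
  qed
  ultimately show ?thesis by blast
qed

lemma entry_converse: "entry (F\<inverse>) (X \<circ> prod.swap) z j i = entry F X z i j"
  by (simp add: entry_def)

lemma full_kernels_converse:
  "full_kernels J I (F\<inverse>) (X \<circ> prod.swap) z \<longleftrightarrow> full_kernels I J F X z"
  unfolding full_kernels_def entry_converse by blast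

text \<open>Without one of its rows, W has a surplus by induction, so W has at least as many
  neighbours as rows. Equality would, by Hall's theorem for W, make W a matched set avoiding
  i0.\<close>

lemma unmatched_expansion:
  assumes F: "finite F" and no: "\<And>W. W \<subseteq> fst ` F \<Longrightarrow> matched F W \<Longrightarrow> i0 \<in> W"
  shows "W \<subseteq> fst ` F - {i0} \<Longrightarrow> W \<noteq> {} \<Longrightarrow> card W < card (F `` W)"
proof (induction "card W" arbitrary: W rule: less_induct)
  case less
  have fin: "finite W" "finite (F `` V)" for V
    using less.prems(1) F by (auto intro: finite_subset[of _ "fst ` F"] finite_subset[of _ "snd ` F"] rev_image_eqI)
  have IH: "card V < card (F `` V)" if "V \<subset> W" "V \<noteq> {}" for V
    using that less.prems(1) fin(1) by (intro less.hyps psubset_card_mono) auto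
  have ge: "card W \<le> card (F `` W)"
  proof -
    obtain w where w: "w \<in> W" using less.prems(2) by blast
    show ?thesis
    proof (cases "W = {w}")
      case True
      have "F `` W \<noteq> {}" using w less.prems(1) by force
      then have "0 < card (F `` W)" using fin(2) by (simp add: card_gt_0_iff)
      then show ?thesis unfolding True by simp
    next
      case False
      then have "card (W - {w}) < card (F `` (W - {w}))" using w by (intro IH) auto
      also have "\<dots> \<le> card (F `` W)" using fin(2) by (intro card_mono) auto
      finally show ?thesis using w fin(1) by simp
    qed
  qed
  have "card W \<noteq> card (F `` W)"
  proof
    assume eq: "card W = card (F `` W)"
    have "card V \<le> card (F `` V)" if "V \<subseteq> W" for V
    proof (cases "V = W \<or> V = {}")
      case False
      then show ?thesis using IH[of V] that by (simp add: psubset_eq)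
    qed (use ge in auto)
    then have "\<exists>f. inj_on f W \<and> (\<forall>i\<in>W. (i, f i) \<in> F)" by (intro hall_marriage fin)
    then have "matched F W" using eq less.prems(2) by (simp add: matched_def)
    then show False using no[of W] less.prems(1) by blast
  qed
  then show ?case using ge by simp
qed

text \<open>Otherwise there is a matched set of rows or columns whose block does not involve the chosen
  variable; the determinant of this block vanishes on all singular matrices.\<close>

theorem hypersurface_strong_hall:
  assumes F: "finite F" and X: "inj_on X F"
    and hyp: "hypersurface (X ` F)
      (zariski_closure (X ` F) {z \<in> coeff_space (X ` F). full_kernels (fst ` F) (snd ` F) F X z})"
  shows "strong_hall (fst ` F) (snd ` F) F"
proof -
  let ?I = "fst ` F" and ?J = "snd ` F" and ?B = "X ` F"
  let ?V = "{z \<in> coeff_space ?B. full_kernels ?I ?J F X z}"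
  obtain i0 j0 where edge: "(i0, j0) \<in> F"
    and avoid: "\<And>g z. pvars g \<subseteq> ?B - {X (i0, j0)} \<Longrightarrow> ?V \<subseteq> zero_locus ?B g \<Longrightarrow> peval z g = 0"
    using hypersurface_variable[OF hyp] by auto
  have no_row: "i0 \<in> W" if W: "W \<subseteq> ?I" "matched F W" for W
  proof (rule ccontr)
    assume "i0 \<notin> W"
    obtain g where g: "pvars g \<subseteq> X ` (F \<inter> W \<times> UNIV)" "\<exists>z. peval z g \<noteq> 0"
      "\<And>z. full_kernels ?I ?J F X z \<Longrightarrow> peval z g = 0"
      using matched_vanishing[OF F X W] by blast
    have "X (i0, j0) \<notin> X ` (F \<inter> W \<times> UNIV)"
      using edge \<open>i0 \<notin> W\<close> inj_onD[OF X] by fastforce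
    then have "pvars g \<subseteq> ?B - {X (i0, j0)}" using g(1) by blast
    then show False using avoid[of g] g(2,3) by (auto simp: zero_locus_def)
  qed
  have "fst ` (F\<inverse>) = ?J" "snd ` (F\<inverse>) = ?I" by force+
  note conv = this
  have FX: "finite (F\<inverse>)" "inj_on (X \<circ> prod.swap) (F\<inverse>)"
    using F by (auto intro!: inj_onI dest: inj_onD[OF X])
  have no_col: "j0 \<in> Y" if Y: "Y \<subseteq> ?J" "matched (F\<inverse>) Y" for Y
  proof (rule ccontr)
    assume "j0 \<notin> Y"
    obtain g where g: "pvars g \<subseteq> (X \<circ> prod.swap) ` (F\<inverse> \<inter> Y \<times> UNIV)" "\<exists>z. peval z g \<noteq> 0"
      "\<And>z. full_kernels ?I ?J F X z \<Longrightarrow> peval z g = 0"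
      using matched_vanishing[OF FX] Y unfolding conv full_kernels_converse by blast
    have "(X \<circ> prod.swap) ` (F\<inverse> \<inter> Y \<times> UNIV) \<subseteq> ?B - {X (i0, j0)}"
      using edge \<open>j0 \<notin> Y\<close> inj_onD[OF X] by fastforce
    then have "pvars g \<subseteq> ?B - {X (i0, j0)}" using g(1) by blast
    then show False using avoid[of g] g(2,3) by (auto simp: zero_locus_def)
  qed
  have row: "card W < card (F `` W)" if "W \<subseteq> ?I - {i0}" "W \<noteq> {}" for W
    using unmatched_expansion[OF F no_row that] by blast
  have col: "card Y < card (F\<inverse> `` Y)" if "Y \<subseteq> ?J - {j0}" "Y \<noteq> {}" for Y
    using unmatched_expansion[OF FX(1), of j0 Y] no_col that unfolding conv by blast
  have fin: "finite ?I" "finite ?J" using F by auto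
  have i0: "i0 \<in> ?I" and j0: "j0 \<in> ?J" using edge by force+
  have FI: "F `` ?I = ?J" by force
  \<comment> \<open>The rows other than \<open>i0\<close> have at least one neighbour more than
    their number, which makes up for \<open>i0\<close>.\<close>
  have "card ?I \<le> card ?J"
  proof (cases "?I - {i0} = {}")
    case True
    then have "?I = {i0}" using i0 by blast
    moreover have "0 < card ?J" using j0 fin(2) card_gt_0_iff by blast
    ultimately show ?thesis by simp
  next
    case False
    then have "card (?I - {i0}) < card (F `` (?I - {i0}))" by (intro row) auto
    also have "\<dots> \<le> card ?J" using fin(2) by (intro card_mono) force+
    finally show ?thesis using i0 fin(1) by simp
  qed
  moreover have "card ?J \<le> card ?I"
  proof (cases "?J - {j0} = {}")
    case True
    then have "?J = {j0}" using j0 by blast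
    moreover have "0 < card ?I" using i0 fin(1) card_gt_0_iff by blast
    ultimately show ?thesis by simp
  next
    case False
    then have "card (?J - {j0}) < card (F\<inverse> `` (?J - {j0}))" by (intro col) auto
    also have "\<dots> \<le> card ?I" using fin(1) by (intro card_mono) force+
    finally show ?thesis using j0 fin(2) by simp
  qed
  ultimately have card: "card ?I = card ?J" by simp
  have "card W < card (F `` W)" if W: "W \<noteq> {}" "W \<subset> ?I" for W
  proof (cases "i0 \<in> W")
    case True
    \<comment> \<open>The inequality for rows covers only sets avoiding \<open>i0\<close>. As (i0,
      j0) is an edge, the columns not adjacent to W avoid \<open>j0\<close>; the inequality for
      columns, passed to complements, gives the one for W.\<close>
    define Y where "Y = ?J - F `` W"
    have FW: "F `` W \<subseteq> ?J" by force
    show ?thesis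
    proof (cases "Y = {}")
      case True
      then have "F `` W = ?J" using FW by (auto simp: Y_def)
      then show ?thesis using card psubset_card_mono[OF fin(1) W(2)] by simp
    next
      case False
      have "j0 \<notin> Y" using edge \<open>i0 \<in> W\<close> by (auto simp: Y_def)
      then have "card Y < card (F\<inverse> `` Y)" using False by (intro col) (auto simp: Y_def)
      also have "\<dots> \<le> card (?I - W)" using fin(1) by (intro card_mono) (force simp: Y_def)+
      also have "card (?I - W) = card ?I - card W"
        using W(2) fin(1) by (intro card_Diff_subset) (auto intro: finite_subset)
      finally have "card Y < card ?I - card W" .
      moreover have "card Y = card ?J - card (F `` W)"
        using FW fin(2) by (simp add: Y_def card_Diff_subset finite_subset)
      ultimately show ?thesis using card by linarith
    qed
  qed (use W in \<open>auto intro!: row\<close>)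
  moreover have "F \<subseteq> ?I \<times> ?J" by force
  ultimately show ?thesis
    using fin i0 card FI unfolding strong_hall_def by blast
qed

text \<open>Matrices are indexed by initial segments, faces by vertex sets. The enumerations
  transport the condition, the variables and the kernel vectors; they are arbitrary so that they can
  be chosen to agree with the order of rows and columns in \<open>edge_submatrix\<close>.\<close>

lemma strong_hall_reindex:
  assumes sh: "strong_hall I J F" and \<sigma>: "bij_betw \<sigma> {..<m} I" and \<tau>: "bij_betw \<tau> {..<m} J"
    and X: "inj_on X F"
  defines "F' \<equiv> {(r, c). r < m \<and> c < m \<and> (\<sigma> r, \<tau> c) \<in> F}" and "X' \<equiv> (\<lambda>(r, c). X (\<sigma> r, \<tau> c))"
  shows "generic_matrix m F' X'" and "X' ` F' = X ` F"
    and "full_kernels {..<m} {..<m} F' X' z \<longleftrightarrow> full_kernels I J F X z"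
proof -
  have FIJ: "F \<subseteq> I \<times> J" and FI: "F `` I = J" and I: "I \<noteq> {}"
    and *: "\<And>W. W \<noteq> {} \<Longrightarrow> W \<subset> I \<Longrightarrow> card W < card (F `` W)"
    using sh by (auto simp: strong_hall_def)
  have s: "inj_on \<sigma> {..<m}" "\<sigma> ` {..<m} = I" and t: "inj_on \<tau> {..<m}" "\<tau> ` {..<m} = J"
    using \<sigma> \<tau> by (auto simp: bij_betw_def)
  have F: "F = map_prod \<sigma> \<tau> ` F'"
  proof
    show "F \<subseteq> map_prod \<sigma> \<tau> ` F'"
    proof
      fix e assume "e \<in> F"
      moreover obtain i j where e: "e = (i, j)" by (cases e)
      ultimately have "i \<in> \<sigma> ` {..<m}" "j \<in> \<tau> ` {..<m}" using FIJ s t by auto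
      then obtain r c where "r < m" "c < m" "i = \<sigma> r" "j = \<tau> c" by auto
      then show "e \<in> map_prod \<sigma> \<tau> ` F'"
        using \<open>e \<in> F\<close> e by (intro image_eqI[of _ _ "(r, c)"]) (auto simp: F'_def)
    qed
  qed (auto simp: F'_def)
  have X': "X' e = X (map_prod \<sigma> \<tau> e)" for e by (cases e) (simp add: X'_def)
  show "X' ` F' = X ` F" by (subst F) (simp add: image_image X')
  have inj: "inj_on (map_prod \<sigma> \<tau>) F'"
    using s(1) t(1) by (intro inj_onI) (auto simp: F'_def dest: inj_onD)
  have im: "\<tau> ` (F' `` W) = F `` (\<sigma> ` W)" if "W \<subseteq> {..<m}" for W
  proof
    show "F `` (\<sigma> ` W) \<subseteq> \<tau> ` (F' `` W)"
    proof
      fix j assume "j \<in> F `` (\<sigma> ` W)"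
      then obtain r where r: "r \<in> W" "(\<sigma> r, j) \<in> F" by blast
      then have "j \<in> \<tau> ` {..<m}" using FIJ t(2) by blast
      then obtain c where "c < m" "j = \<tau> c" by auto
      then show "j \<in> \<tau> ` (F' `` W)" using r that by (auto simp: F'_def)
    qed
  qed (auto simp: F'_def)
  have sub: "F' `` W \<subseteq> {..<m}" for W by (auto simp: F'_def)
  have "card W < card (F' `` W)" if W: "W \<noteq> {}" "W \<subset> {..<m}" for W
  proof -
    have "\<sigma> ` W \<subset> I" using W(2) s inj_on_image_eq_iff[of \<sigma> "{..<m}" W "{..<m}"] by blast
    then have "card (\<sigma> ` W) < card (F `` (\<sigma> ` W))" using W(1) by (intro *) auto
    moreover have "card (\<sigma> ` W) = card W"
      using W(2) s(1) by (intro card_image) (auto intro: inj_on_subset)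
    moreover have "card (\<tau> ` (F' `` W)) = card (F' `` W)"
      using sub t(1) by (intro card_image) (auto intro: inj_on_subset)
    ultimately show ?thesis using im W(2) by (metis psubset_imp_subset)
  qed
  moreover have "F' `` {..<m} = {..<m}"
  proof
    show "{..<m} \<subseteq> F' `` {..<m}"
    proof
      fix c assume c: "c \<in> {..<m}"
      have "\<tau> ` (F' `` {..<m}) = J" using im[of "{..<m}"] FI s(2) by simp
      then have "\<tau> c \<in> \<tau> ` (F' `` {..<m})" using c t(2) by blast
      then obtain c' where c': "c' \<in> F' `` {..<m}" "\<tau> c = \<tau> c'" by blast
      then have "c = c'" using c sub t(1) by (auto dest: inj_onD)
      then show "c \<in> F' `` {..<m}" using c' by simp
    qed
  qed (rule sub)
  ultimately have "strong_hall {..<m} {..<m} F'"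
    using s I by (auto simp: strong_hall_def F'_def)
  moreover have "inj_on X' F'"
    using comp_inj_on[OF inj, of X] X F by (simp add: X' o_def[abs_def] inj_on_def)
  ultimately show "generic_matrix m F' X'" by unfold_locales
  have e: "entry F' X' z r c = entry F X z (\<sigma> r) (\<tau> c)" if "r < m" "c < m" for r c
    using that by (simp add: entry_def F'_def X'_def)
  have sumJ: "(\<Sum>c<m. entry F' X' z r c * b (\<tau> c)) = (\<Sum>j\<in>J. entry F X z (\<sigma> r) j * b j)"
    if "r < m" for r b
    using sum.reindex_bij_betw[OF \<tau>, of "\<lambda>j. entry F X z (\<sigma> r) j * b j"] that by (simp add: e)
  have sumI: "(\<Sum>r<m. entry F' X' z r c * a (\<sigma> r)) = (\<Sum>i\<in>I. entry F X z i (\<tau> c) * a i)"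
    if "c < m" for c a
    using sum.reindex_bij_betw[OF \<sigma>, of "\<lambda>i. entry F X z i (\<tau> c) * a i"] that by (simp add: e)
  show "full_kernels {..<m} {..<m} F' X' z \<longleftrightarrow> full_kernels I J F X z"
  proof
    assume "full_kernels {..<m} {..<m} F' X' z"
    then obtain \<alpha> \<beta> where ab: "\<forall>r\<in>{..<m}. \<alpha> r \<noteq> 0" "\<forall>c\<in>{..<m}. \<beta> c \<noteq> 0"
      "\<forall>r\<in>{..<m}. (\<Sum>c<m. entry F' X' z r c * \<beta> c) = 0"
      "\<forall>c\<in>{..<m}. (\<Sum>r<m. entry F' X' z r c * \<alpha> r) = 0"
      unfolding full_kernels_def by blast
    define a where "a i = \<alpha> (inv_into {..<m} \<sigma> i)" for i
    define b where "b j = \<beta> (inv_into {..<m} \<tau> j)" for j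
    have a: "a (\<sigma> r) = \<alpha> r" and b: "b (\<tau> r) = \<beta> r" if "r < m" for r
      using that s(1) t(1) by (auto simp: a_def b_def)
    have "\<forall>r\<in>{..<m}. (\<Sum>j\<in>J. entry F X z (\<sigma> r) j * b j) = 0"
      using ab(3) sumJ[of _ b] by (simp add: b)
    moreover have "\<forall>c\<in>{..<m}. (\<Sum>i\<in>I. entry F X z i (\<tau> c) * a i) = 0"
      using ab(4) sumI[of _ a] by (simp add: a)
    ultimately show "full_kernels I J F X z"
      unfolding full_kernels_def s(2)[symmetric] t(2)[symmetric] ball_simps
      using ab(1,2) a b by (intro exI[of _ a] exI[of _ b]) (simp add: s(2) t(2))
  next
    assume "full_kernels I J F X z"
    then obtain a b where ab: "\<forall>i\<in>I. a i \<noteq> 0" "\<forall>j\<in>J. b j \<noteq> 0"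
      "\<forall>i\<in>I. (\<Sum>j\<in>J. entry F X z i j * b j) = 0" "\<forall>j\<in>J. (\<Sum>i\<in>I. entry F X z i j * a i) = 0"
      unfolding full_kernels_def by blast
    have "\<sigma> r \<in> I" "\<tau> r \<in> J" if "r < m" for r using that s(2) t(2) by auto
    then show "full_kernels {..<m} {..<m} F' X' z"
      unfolding full_kernels_def using ab
      by (intro exI[of _ "\<lambda>r. a (\<sigma> r)"] exI[of _ "\<lambda>c. b (\<tau> c)"]) (simp add: sumI sumJ)
  qed
qed

section \<open>Edge polytopes of bipartite graphs\<close>

lemma group_closure_subset:
  assumes "S \<subseteq> G" "0 \<in> G" "\<And>x y. x \<in> G \<Longrightarrow> y \<in> G \<Longrightarrow> x - y \<in> G"
  shows "group_closure S \<subseteq> G"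
proof
  fix x assume "x \<in> group_closure S"
  then show "x \<in> G" by induction (use assms in auto)
qed

lemma group_closure_sum:
  "(\<And>x. x \<in> A \<Longrightarrow> f x \<in> group_closure S) \<Longrightarrow> sum f A \<in> group_closure S"
  by (induction A rule: infinite_finite_induct) (auto intro: group_closure_add)

lemma group_closure_scale_int:
  fixes x :: "int ^ 'n"
  assumes x: "x \<in> group_closure S"
  shows "c *s x \<in> group_closure S"
proof -
  have n: "int n *s x \<in> group_closure S" for n
  proof (induction n)
    case (Suc n)
    have "int (Suc n) *s x = x + int n *s x" by (simp add: Finite_Cartesian_Product.vec_eq_iff algebra_simps)
    then show ?case using group_closure_add[OF x Suc] by simp
  qed (simp add: Finite_Cartesian_Product.vec_eq_iff zero_vec_def[symmetric])
  show ?thesis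
  proof (cases c)
    case (nonneg k)
    then show ?thesis using n by simp
  next
    case (neg k)
    have "c *s x = - (int (Suc k) *s x)"
      unfolding neg by (rule Finite_Cartesian_Product.vec_eq_iff[THEN iffD2]) simp
    then show ?thesis using n[of "Suc k"] by (simp only: group_closure_minus_iff)
  qed
qed

lemma subgroup_index_self:
  assumes "0 \<in> G" "\<And>x y. x \<in> G \<Longrightarrow> y \<in> G \<Longrightarrow> x - y \<in> G"
  shows "subgroup_index G G = 1"
proof -
  have "{(x, y). x \<in> G \<and> y \<in> G \<and> x - y \<in> G} `` {x} = G" if "x \<in> G" for x
    using assms that by auto
  then have "G // {(x, y). x \<in> G \<and> y \<in> G \<and> x - y \<in> G} = {G}"
    using assms(1) unfolding quotient_def by auto
  then show ?thesis by (simp add: subgroup_index_def)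
qed

lemma rvec_diff: "rvec (x - y) = rvec x - rvec y"
  and rvec_0: "rvec 0 = 0"
  by (simp_all add: rvec_def Finite_Cartesian_Product.vec_eq_iff)

lemma pconst_mult: "pconst (a * b) = pconst a * pconst b"
  by (simp add: pconst_def mult_single)

lemma pconst_power: "pconst a ^ n = pconst (a ^ n)"
  by (induction n) (simp_all add: pconst_mult, simp add: pconst_def)

lemma prod_pconst: "(\<Prod>x\<in>A. pconst (f x)) = pconst (\<Prod>x\<in>A. f x)"
  by (induction A rule: infinite_finite_induct) (simp_all add: pconst_mult, simp_all add: pconst_def)

lemma bij_betw_pick: "finite S \<Longrightarrow> bij_betw (pick S) {..<card S} S"
proof -
  assume S: "finite S"
  have inj: "inj_on (pick S) {..<card S}"
    by (rule linorder_inj_onI) (use pick_mono_le[of _ S] in fastforce)+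
  have "pick S ` {..<card S} \<subseteq> S" using pick_in_set_le by blast
  then have "pick S ` {..<card S} = S"
    using card_image[OF inj] S by (intro card_subset_eq) auto
  with inj show ?thesis by (simp add: bij_betw_def)
qed

section \<open>Hall's condition as a condition on bipartite graphs\<close>

lemma strong_hall_images:
  assumes "strong_hall I J F"
  shows "fst ` F = I" "snd ` F = J"
proof -
  have "F \<subseteq> I \<times> J" "F `` I = J" "F\<inverse> `` J = I"
    using assms strong_hall_converse[OF assms] by (auto simp: strong_hall_def)
  then show "fst ` F = I" "snd ` F = J"
    by (auto simp: image_iff) (metis ImageE converse_iff fst_conv, metis ImageE snd_conv)
qed

text \<open>The rows reachable from one row share no column with the other rows, since a common
  column would extend a path; by \<open>strong_hall_partition\<close> they are all the rows.\<close>

lemma strong_hall_connected: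
  assumes sh: "strong_hall I J F"
  shows "graph_connected (I \<union> J) F"
proof -
  let ?R = "(F \<union> F\<inverse>)\<^sup>*"
  obtain i0 where i0: "i0 \<in> I" using sh by (auto simp: strong_hall_def)
  have FI: "F `` I = J" using sh by (simp add: strong_hall_def)
  have "{i \<in> I. (i0, i) \<in> ?R} = I"
  proof (rule strong_hall_partition[OF sh])
    show "F `` {i \<in> I. (i0, i) \<in> ?R} \<inter> F `` (I - {i \<in> I. (i0, i) \<in> ?R}) = {}"
    proof (rule ccontr)
      assume "F `` {i \<in> I. (i0, i) \<in> ?R} \<inter> F `` (I - {i \<in> I. (i0, i) \<in> ?R}) \<noteq> {}"
      then obtain i i' j where *: "(i0, i) \<in> ?R" "(i, j) \<in> F" "i' \<in> I" "(i0, i') \<notin> ?R" "(i', j) \<in> F"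
        by blast
      then have "(i, j) \<in> F \<union> F\<inverse>" "(j, i') \<in> F \<union> F\<inverse>" by auto
      with *(1) have "(i0, i') \<in> ?R" by (meson rtrancl.rtrancl_into_rtrancl)
      with * show False by simp
    qed
  qed (use i0 in auto)
  then have I: "(i0, i) \<in> ?R" if "i \<in> I" for i using that by blast
  have IJ: "(i0, x) \<in> ?R" if "x \<in> I \<union> J" for x
  proof (cases "x \<in> I")
    case False
    then have "x \<in> F `` I" using that FI by blast
    then obtain i where i: "i \<in> I" "(i, x) \<in> F \<union> F\<inverse>" by blast
    then show ?thesis using I rtrancl_into_rtrancl by metis
  qed (rule I)
  have "sym ?R" by (rule sym_rtrancl) (auto simp: sym_def)
  then show ?thesis unfolding graph_connected_def
    using IJ by (meson rtrancl_trans symD)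
qed

lemma neighbours_left: "F \<subseteq> I \<times> J \<Longrightarrow> W \<subseteq> I \<Longrightarrow> I \<inter> J = {} \<Longrightarrow> neighbours F W = F `` W"
  by (auto simp: neighbours_def)

text \<open>The inequality concerns proper subsets only and is vacuous for a single row.
  Connectedness supplies that every column has a neighbour: a path from a vertex in I to j in J is
  non-trivial, so it ends with an edge at j.\<close>

lemma strong_hall_iff:
  assumes fin: "finite I" "finite J" and ne: "I \<noteq> {}" "J \<noteq> {}" and disj: "I \<inter> J = {}" and F: "F \<subseteq> I \<times> J"
  shows "strong_hall I J F \<longleftrightarrow> card I = card J \<and> graph_connected (I \<union> J) F \<and> condition_star I J F"
proof
  assume sh: "strong_hall I J F"
  have "card W < card (neighbours F W)" if "W \<noteq> {}" "W \<subset> I" for W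
    using sh that neighbours_left[OF F _ disj, of W] by (auto simp: strong_hall_def)
  moreover have "card I = 1 \<or> card I > 1"
    using fin(1) ne(1) by (metis One_nat_def Suc_lessI card_gt_0_iff)
  ultimately show "card I = card J \<and> graph_connected (I \<union> J) F \<and> condition_star I J F"
    using sh strong_hall_connected[OF sh] by (auto simp: strong_hall_def condition_star_def)
next
  assume *: "card I = card J \<and> graph_connected (I \<union> J) F \<and> condition_star I J F"
  have "F `` I = J"
  proof
    show "J \<subseteq> F `` I"
    proof
      fix j assume j: "j \<in> J"
      obtain i where i: "i \<in> I" using ne by blast
      have "(i, j) \<in> (F \<union> F\<inverse>)\<^sup>*" "i \<noteq> j"
        using * i j disj by (auto simp: graph_connected_def)
      then obtain l where "(l, j) \<in> F \<union> F\<inverse>" by (meson rtranclE)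
      then show "j \<in> F `` I" using F j disj by auto
    qed
  qed (use F in auto)
  moreover have "card W < card (F `` W)" if W: "W \<noteq> {}" "W \<subset> I" for W
  proof -
    have "card I \<noteq> 1" using W by (metis card_1_singletonE subset_singletonD psubset_eq)
    then show ?thesis
      using * W neighbours_left[OF F _ disj, of W] by (auto simp: condition_star_def)
  qed
  ultimately show "strong_hall I J F" using * fin ne F by (auto simp: strong_hall_def)
qed

section \<open>Edge polynomials and their discriminants\<close>

definition edge_vec :: "nat \<times> nat \<Rightarrow> int ^ 'v::finite" where
  "edge_vec e = std_basis (fst e) + std_basis (snd e)"

lemma edge_vectors_image: "edge_vectors F = edge_vec ` F"
  by (force simp: edge_vectors_def edge_vec_def)

text \<open>The parameter \<open>ix\<close> stands for the enumeration behind
  \<open>std_basis\<close>. It is injective on the numbers up to n, whence the bounds on vertices in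
  the lemmas below.\<close>

locale edge_polytope =
  fixes k n :: nat and E :: "(nat \<times> nat) set" and ix :: "nat \<Rightarrow> 'v::finite"
  assumes card_v: "CARD('v) = n + 1" and kn: "k < n" and E: "E \<subseteq> {0..k} \<times> {k + 1..n}"
    and ix: "ix = from_nat_into UNIV"
begin

lemma ix_bij: "bij_betw ix {..n} UNIV"
  using bij_betw_from_nat_into_finite[of "UNIV :: 'v set"] by (simp add: card_v ix lessThan_Suc_atMost)

lemma ix_eq_iff [simp]: "i \<le> n \<Longrightarrow> j \<le> n \<Longrightarrow> ix i = ix j \<longleftrightarrow> i = j"
  using ix_bij by (auto simp: bij_betw_def dest: inj_onD)

lemma ix_surj: obtains l where "l \<le> n" "v = ix l"
  using ix_bij by (auto simp: bij_betw_def)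

lemma std_basis_ix: "i \<le> n \<Longrightarrow> l \<le> n \<Longrightarrow> (std_basis i :: int ^ 'v) $ ix l = (if l = i then 1 else 0)"
  by (simp add: std_basis_def axis_def ix[symmetric])

abbreviation "ev \<equiv> edge_vec :: nat \<times> nat \<Rightarrow> int ^ 'v"

lemma ev_ix: "i \<le> n \<Longrightarrow> j \<le> n \<Longrightarrow> l \<le> n \<Longrightarrow>
    ev (i, j) $ ix l = (if l = i then 1 else 0) + (if l = j then 1 else 0)"
  by (simp add: edge_vec_def std_basis_ix)

lemma E_bounds: "(i, j) \<in> E \<Longrightarrow> i \<le> k \<and> k < j \<and> j \<le> n \<and> i \<le> n"
  using subsetD[OF E, of "(i, j)"] kn by auto

lemma finite_E: "finite E"
  using E by (rule finite_subset) simp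

lemma inj_ev: "inj_on ev E"
proof (rule inj_onI)
  fix e e' assume e: "e \<in> E" "e' \<in> E" and eq: "ev e = ev e'"
  obtain i j i' j' where ij: "e = (i, j)" "e' = (i', j')" by (cases e; cases e')
  have b: "i \<le> k" "k < j" "j \<le> n" "i \<le> n" "i' \<le> k" "k < j'" "j' \<le> n" "i' \<le> n"
    using e E_bounds[of i j] E_bounds[of i' j'] ij by auto
  have "ev (i, j) $ ix i = ev (i', j') $ ix i" "ev (i, j) $ ix j = ev (i', j') $ ix j"
    using eq ij by simp_all
  then have "i = i'" "j = j'" using b by (auto simp: ev_ix split: if_splits)
  then show "e = e'" by (simp add: ij)
qed

text \<open>The two ends of an edge are distinct coordinates, one from each side, so that the
  polynomial is a bilinear form in the row and the column coordinates.\<close>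

lemma laurent_edges:
  assumes F: "F \<subseteq> E"
  shows "laurent (ev ` F) z \<alpha> = (\<Sum>(i, j)\<in>F. z (ev (i, j)) * (\<alpha> (ix i) * \<alpha> (ix j)))"
proof -
  have "(\<Prod>v\<in>UNIV. \<alpha> v powi (ev (i, j) $ v)) = \<alpha> (ix i) * \<alpha> (ix j)" if ij: "(i, j) \<in> F" for i j
  proof -
    have b: "i \<le> n" "j \<le> n" "i \<noteq> j" using E_bounds[OF subsetD[OF F ij]] by auto
    have "\<alpha> v powi (ev (i, j) $ v) = (if v = ix i then \<alpha> (ix i) else 1) * (if v = ix j then \<alpha> (ix j) else 1)" for v
    proof -
      obtain l where l: "l \<le> n" "v = ix l" by (rule ix_surj)
      then show ?thesis using b by (auto simp: ev_ix)
    qed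
    then have "(\<Prod>v\<in>UNIV. \<alpha> v powi (ev (i, j) $ v)) =
      (\<Prod>v\<in>UNIV. if v = ix i then \<alpha> (ix i) else 1) * (\<Prod>v\<in>UNIV. if v = ix j then \<alpha> (ix j) else 1)"
      by (simp add: prod.distrib)
    then show ?thesis by simp
  qed
  moreover have "inj_on ev F" using inj_ev F by (rule inj_on_subset)
  ultimately show ?thesis
    unfolding laurent_def by (auto simp: sum.reindex intro!: sum.cong)
qed

lemma partial_deriv_edges:
  assumes F: "F \<subseteq> E" and l: "l \<le> n"
  shows "partial_deriv (ix l) (laurent (ev ` F) z) \<alpha> =
    (\<Sum>(i, j)\<in>F. z (ev (i, j)) * (if i = l then \<alpha> (ix j) else if j = l then \<alpha> (ix i) else 0))"
    (is "_ = ?d")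
proof -
  \<comment> \<open>As no edge is a loop, the polynomial is affine in each coordinate;
    \<open>c\<close> collects the terms without the coordinate of l.\<close>
  define c where "c = (\<Sum>(i, j)\<in>F. if i = l \<or> j = l then 0 else z (ev (i, j)) * (\<alpha> (ix i) * \<alpha> (ix j)))"
  have "laurent (ev ` F) z (\<alpha>(ix l := t)) = c + t * ?d" for t
    unfolding laurent_edges[OF F] c_def sum_distrib_left sum.distrib[symmetric]
  proof (rule sum.cong[OF refl], clarify)
    fix i j assume ij: "(i, j) \<in> F"
    have "i \<le> n" "j \<le> n" "i \<noteq> j" using E_bounds[OF subsetD[OF F ij]] by auto
    then show "z (ev (i, j)) * ((\<alpha>(ix l := t)) (ix i) * (\<alpha>(ix l := t)) (ix j)) =
      (if i = l \<or> j = l then 0 else z (ev (i, j)) * (\<alpha> (ix i) * \<alpha> (ix j))) +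
      t * (z (ev (i, j)) * (if i = l then \<alpha> (ix j) else if j = l then \<alpha> (ix i) else 0))"
      using l by auto
  qed
  then have "(\<lambda>t. laurent (ev ` F) z (\<alpha>(ix l := t))) = (\<lambda>t. c + t * ?d)" by simp
  moreover have "((\<lambda>t. c + t * ?d) has_field_derivative ?d) (at (\<alpha> (ix l)))"
    by (auto intro!: derivative_eq_intros)
  ultimately show ?thesis unfolding partial_deriv_def by (simp add: DERIV_imp_deriv)
qed

lemma sum_edges_left:
  assumes "finite F" "i \<in> fst ` F"
  shows "(\<Sum>(r, c)\<in>F. z (X (r, c)) * (if r = i then g c else 0)) = (\<Sum>c\<in>snd ` F. entry F X z i c * g c :: complex)"
proof -
  have "(\<Sum>(r, c)\<in>F. z (X (r, c)) * (if r = i then g c else 0)) =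
    (\<Sum>(r, c)\<in>fst ` F \<times> snd ` F. if r = i then entry F X z i c * g c else 0)"
    by (rule sum.mono_neutral_cong_left) (use assms in \<open>force simp: entry_def\<close>)+
  also have "\<dots> = (\<Sum>r\<in>fst ` F. \<Sum>c\<in>snd ` F. if r = i then entry F X z i c * g c else 0)"
    by (simp add: sum.cartesian_product)
  also have "\<dots> = (\<Sum>r\<in>fst ` F. if r = i then \<Sum>c\<in>snd ` F. entry F X z i c * g c else 0)"
    by (rule sum.cong) auto
  also have "\<dots> = (\<Sum>c\<in>snd ` F. entry F X z i c * g c)" using assms by simp
  finally show ?thesis .
qed

lemma sum_edges_right:
  assumes "finite F" "j \<in> snd ` F"
  shows "(\<Sum>(r, c)\<in>F. z (X (r, c)) * (if c = j then g r else 0)) = (\<Sum>r\<in>fst ` F. entry F X z r j * g r :: complex)"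
proof -
  have "(\<Sum>(r, c)\<in>F. z (X (r, c)) * (if c = j then g r else 0)) =
    (\<Sum>(c, r)\<in>F\<inverse>. z ((X \<circ> prod.swap) (c, r)) * (if c = j then g r else 0))"
    by (rule sum.reindex_bij_witness[of _ prod.swap prod.swap]) auto
  also have "\<dots> = (\<Sum>r\<in>snd ` (F\<inverse>). entry (F\<inverse>) (X \<circ> prod.swap) z j r * g r)"
    by (rule sum_edges_left) (use assms in force)+
  also have "snd ` (F\<inverse>) = fst ` F" by force
  finally show ?thesis unfolding entry_converse .
qed

text \<open>The derivative by a row coordinate is this row applied to the column coordinates, and
  vice versa. A critical point in the torus thus amounts to a right and a left kernel vector without
  zeros.\<close>

lemma singular_coeffs_edges:
  assumes F: "F \<subseteq> E"
  shows "singular_coeffs (ev ` F) = {z \<in> coeff_space (ev ` F). full_kernels (fst ` F) (snd ` F) F ev z}"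
proof -
  have fin: "finite F" using F finite_E by (rule finite_subset)
  have Fb: "r \<le> k" "k < c \<and> c \<le> n" if "(r, c) \<in> F" for r c
    using E_bounds[OF subsetD[OF F that]] by auto
  have fI: "i \<le> k" if "i \<in> fst ` F" for i using that Fb(1) by auto
  have fJ: "k < j \<and> j \<le> n" if "j \<in> snd ` F" for j using that Fb(2) by auto
  have row: "partial_deriv (ix i) (laurent (ev ` F) z) \<alpha> = (\<Sum>j\<in>snd ` F. entry F ev z i j * \<alpha> (ix j))"
    if i: "i \<in> fst ` F" for i z \<alpha>
  proof -
    have "i \<le> n" using fI[OF i] kn by simp
    have ne: "c \<noteq> i" if "(r, c) \<in> F" for r c using Fb(2)[OF that] fI[OF i] by simp
    have "(\<Sum>(r, c)\<in>F. z (ev (r, c)) * (if r = i then \<alpha> (ix c) else if c = i then \<alpha> (ix r) else 0)) =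
      (\<Sum>(r, c)\<in>F. z (ev (r, c)) * (if r = i then \<alpha> (ix c) else 0))"
      by (rule sum.cong) (auto dest: ne)
    then show ?thesis
      using partial_deriv_edges[OF F \<open>i \<le> n\<close>] sum_edges_left[OF fin i, of z ev "\<lambda>c. \<alpha> (ix c)"] by simp
  qed
  have col: "partial_deriv (ix j) (laurent (ev ` F) z) \<alpha> = (\<Sum>i\<in>fst ` F. entry F ev z i j * \<alpha> (ix i))"
    if j: "j \<in> snd ` F" for j z \<alpha>
  proof -
    have ne: "r \<noteq> j" if "(r, c) \<in> F" for r c using Fb(1)[OF that] fJ[OF j] by simp
    have "(\<Sum>(r, c)\<in>F. z (ev (r, c)) * (if r = j then \<alpha> (ix c) else if c = j then \<alpha> (ix r) else 0)) =
      (\<Sum>(r, c)\<in>F. z (ev (r, c)) * (if c = j then \<alpha> (ix r) else 0))"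
      by (rule sum.cong) (auto dest: ne)
    then show ?thesis
      using partial_deriv_edges[OF F, of j] fJ[OF j]
        sum_edges_right[OF fin j, of z ev "\<lambda>c. \<alpha> (ix c)"] by simp
  qed
  have "(\<exists>\<alpha>. (\<forall>v. \<alpha> v \<noteq> 0) \<and> (\<forall>v. partial_deriv v (laurent (ev ` F) z) \<alpha> = 0)) \<longleftrightarrow>
      full_kernels (fst ` F) (snd ` F) F ev z" (is "?L \<longleftrightarrow> ?R") for z
  proof
    assume ?L
    then obtain \<alpha> where \<alpha>: "\<And>v. \<alpha> v \<noteq> 0" "\<And>v. partial_deriv v (laurent (ev ` F) z) \<alpha> = 0" by blast
    have 1: "\<forall>i\<in>fst ` F. (\<Sum>j\<in>snd ` F. entry F ev z i j * \<alpha> (ix j)) = 0"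
      using row[of _ z \<alpha>] \<alpha>(2) by simp
    have 2: "\<forall>j\<in>snd ` F. (\<Sum>i\<in>fst ` F. entry F ev z i j * \<alpha> (ix i)) = 0"
      using col[of _ z \<alpha>] \<alpha>(2) by simp
    have 3: "\<forall>i\<in>S. \<alpha> (ix i) \<noteq> 0" for S using \<alpha>(1) by simp
    show ?R unfolding full_kernels_def
      by (rule exI[of _ "\<lambda>i. \<alpha> (ix i)"], rule exI[of _ "\<lambda>i. \<alpha> (ix i)"]) (intro conjI 1 2 3)
  next
    assume ?R
    then obtain a b where ab: "\<forall>i\<in>fst ` F. a i \<noteq> 0" "\<forall>j\<in>snd ` F. b j \<noteq> 0"
      "\<forall>i\<in>fst ` F. (\<Sum>j\<in>snd ` F. entry F ev z i j * b j) = 0"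
      "\<forall>j\<in>snd ` F. (\<Sum>i\<in>fst ` F. entry F ev z i j * a i) = 0"
      unfolding full_kernels_def by (elim exE conjE)
    \<comment> \<open>Vertices without an edge in F get the value 1: the derivatives there are
      identically zero, but the point must lie in the torus.\<close>
    define h where "h l = (if l \<in> fst ` F then a l else if l \<in> snd ` F then b l else 1)" for l
    define \<alpha> where "\<alpha> v = h (inv_into {..n} ix v)" for v
    have \<alpha>: "\<alpha> (ix l) = h l" if "l \<le> n" for l
      using that ix_bij by (simp add: \<alpha>_def bij_betw_def)
    have ha: "h l = a l" if "l \<in> fst ` F" for l using that by (simp add: h_def)
    have hb: "h l = b l" if "l \<in> snd ` F" for l
    proof -
      have "l \<notin> fst ` F" using fI[of l] fJ[OF that] by auto
      then show ?thesis using that by (simp add: h_def)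
    qed
    have fI': "i \<le> n" if "i \<in> fst ` F" for i using fI[OF that] kn by simp
    have "\<alpha> v \<noteq> 0" for v
      using ab(1,2) by (auto simp: \<alpha>_def h_def)
    moreover have "partial_deriv v (laurent (ev ` F) z) \<alpha> = 0" for v
    proof -
      obtain l where l: "l \<le> n" "v = ix l" by (rule ix_surj)
      consider "l \<in> fst ` F" | "l \<in> snd ` F" | "l \<notin> fst ` F" "l \<notin> snd ` F" by blast
      then show ?thesis
      proof cases
        case 1
        have "(\<Sum>j\<in>snd ` F. entry F ev z l j * \<alpha> (ix j)) = (\<Sum>j\<in>snd ` F. entry F ev z l j * b j)"
          by (rule sum.cong) (simp_all add: \<alpha>[OF conjunct2[OF fJ]] hb)
        then show ?thesis using row[OF 1] bspec[OF ab(3) 1] l(2) by simp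
      next
        case 2
        have "(\<Sum>i\<in>fst ` F. entry F ev z i l * \<alpha> (ix i)) = (\<Sum>i\<in>fst ` F. entry F ev z i l * a i)"
          by (rule sum.cong) (simp_all add: \<alpha>[OF fI'] ha)
        then show ?thesis using col[OF 2] bspec[OF ab(4) 2] l(2) by simp
      next
        case 3
        have "i \<noteq> l" "j \<noteq> l" if "(i, j) \<in> F" for i j
          using 3 imageI[OF that, of fst] imageI[OF that, of snd] by auto
        then show ?thesis unfolding l(2) partial_deriv_edges[OF F l(1)]
          by (intro sum.neutral) auto
      qed
    qed
    ultimately show ?L by blast
  qed
  then show ?thesis by (simp add: singular_coeffs_def)
qed

lemma nondefective_strong_hall:
  assumes F: "F \<subseteq> E" and nd: "nondefective (ev ` F)"
  shows "strong_hall (fst ` F) (snd ` F) F"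
proof (rule hypersurface_strong_hall)
  show "finite F" using F finite_E by (rule finite_subset)
  show "inj_on ev F" using inj_ev F by (rule inj_on_subset)
  show "hypersurface (ev ` F)
      (zariski_closure (ev ` F) {z \<in> coeff_space (ev ` F). full_kernels (fst ` F) (snd ` F) F ev z})"
    using nd unfolding nondefective_def discriminant_variety_def singular_coeffs_edges[OF F] .
qed

lemma discriminant_strong_hall:
  assumes I: "I \<subseteq> {0..k}" and J: "J \<subseteq> {k + 1..n}" and sh: "strong_hall I J (induced_edges E (I \<union> J))"
  defines "F \<equiv> induced_edges E (I \<union> J)"
  shows "nondefective (ev ` F)"
    and "\<exists>c. c \<noteq> 0 \<and> discriminant (ev ` F) = pconst c * Determinant.det (edge_submatrix k n E I J)"
proof -
  have sh: "strong_hall I J F" using sh by (simp add: F_def)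
  have F: "F \<subseteq> E" by (auto simp: F_def induced_edges_def)
  have card: "card I = card J" using sh by (simp add: strong_hall_def)
  define m where "m = card I"
  define C where "C = {c. k + 1 + c \<in> J}"
  have JC: "J = (\<lambda>c. k + 1 + c) ` C"
  proof
    show "J \<subseteq> (\<lambda>c. k + 1 + c) ` C"
    proof
      fix j assume "j \<in> J"
      then show "j \<in> (\<lambda>c. k + 1 + c) ` C" using J by (intro image_eqI[of _ _ "j - (k + 1)"]) (auto simp: C_def)
    qed
  qed (auto simp: C_def)
  have inj: "inj_on (\<lambda>c. k + 1 + c) C" by (simp add: inj_on_def)
  have finJ: "finite J" and finI: "finite I" using sh by (simp_all add: strong_hall_def)
  have finC: "finite C" using finJ inj unfolding JC by (simp add: finite_image_iff)
  have cardC: "card C = m" using card card_image[OF inj] JC by (simp add: m_def)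
  \<comment> \<open>\<open>submatrix\<close> takes its rows and columns in the order of
    \<open>pick\<close>; with this enumeration the re-indexed generic matrix becomes literally
    \<open>edge_submatrix\<close>.\<close>
  have \<sigma>: "bij_betw (pick I) {..<m} I" unfolding m_def by (rule bij_betw_pick[OF finI])
  have "bij_betw (\<lambda>c. k + 1 + c) C J" using inj JC by (simp add: bij_betw_def)
  with bij_betw_pick[OF finC] have \<tau>: "bij_betw (\<lambda>c. k + 1 + pick C c) {..<m} J"
    unfolding cardC by (auto dest: bij_betw_trans simp: o_def)
  define F' where "F' = {(r, c). r < m \<and> c < m \<and> (pick I r, k + 1 + pick C c) \<in> F}"
  define X' where "X' = (\<lambda>(r, c). ev (pick I r, k + 1 + pick C c))"
  have injF: "inj_on ev F" using inj_ev F by (rule inj_on_subset)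
  note re = strong_hall_reindex[OF sh \<sigma> \<tau> injF, folded F'_def X'_def]
  interpret gm: generic_matrix m F' X' by (rule re(1))
  have img: "fst ` F = I" "snd ` F = J" using strong_hall_images[OF sh] .
  have var: "discriminant_variety (ev ` F) = zero_locus (ev ` F) (Determinant.det (pmat m F' X'))"
    unfolding discriminant_variety_def singular_coeffs_edges[OF F] img
    using gm.zariski_closure_full_kernels unfolding re(2,3) .
  show nd: "nondefective (ev ` F)"
    unfolding nondefective_def var using gm.hypersurface_dpoly unfolding re(2) .
  have "edge_submatrix k n E I J = (pmat m F' X' :: (int ^ 'v) cpoly mat)"
  proof (rule eq_matI)
    have "{i. i < k + 1 \<and> i \<in> I} = I" using I by auto
    moreover have "{c. c < n - k \<and> c \<in> C} = C" using J by (auto simp: C_def)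
    ultimately have cards: "card {i. i < dim_row (edge_matrix k n E :: (int ^ 'v) cpoly mat) \<and> i \<in> I} = m"
      "card {c. c < dim_col (edge_matrix k n E :: (int ^ 'v) cpoly mat) \<and> c \<in> C} = m"
      using cardC by (simp_all add: edge_matrix_def m_def)
    then show "dim_row (edge_submatrix k n E I J :: (int ^ 'v) cpoly mat) = dim_row (pmat m F' X')"
      and "dim_col (edge_submatrix k n E I J :: (int ^ 'v) cpoly mat) = dim_col (pmat m F' X')"
      unfolding edge_submatrix_def C_def[symmetric] dim_submatrix by (simp_all add: pmat_def)
    fix r c assume "r < dim_row (pmat m F' X')" "c < dim_col (pmat m F' X')"
    then have rc: "r < m" "c < m" by (simp_all add: pmat_def)
    have rI: "pick I r \<in> I" "k + 1 + pick C c \<in> J"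
      using rc \<sigma> \<tau> by (auto simp: bij_betw_def)
    then have b: "pick I r < k + 1" "pick C c < n - k" using I J by force+
    have "edge_submatrix k n E I J $$ (r, c) = (edge_matrix k n E :: (int ^ 'v) cpoly mat) $$ (pick I r, pick C c)"
      unfolding edge_submatrix_def C_def[symmetric]
      by (rule submatrix_index) (use rc cards in simp_all)
    also have "\<dots> = (if (pick I r, k + 1 + pick C c) \<in> E then pvar (ev (pick I r, k + 1 + pick C c)) else 0)"
      using b by (simp add: edge_matrix_def edge_vec_def)
    also have "\<dots> = pmat m F' X' $$ (r, c)"
      using rc rI by (simp add: pmat_def F'_def X'_def F_def induced_edges_def)
    finally show "edge_submatrix k n E I J $$ (r, c) = pmat m F' X' $$ (r, c)" .
  qed
  then show "\<exists>c. c \<noteq> 0 \<and> discriminant (ev ` F) = pconst c * Determinant.det (edge_submatrix k n E I J)"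
    using gm.some_reduced_defining_poly nd unfolding re(2) discriminant_def var by simp
qed

end

section \<open>Faces of the edge polytope, the lattice index and the product formula\<close>

context edge_polytope
begin

lemma rvec_ev_inner:
  assumes "(i, j) \<in> E"
  shows "a \<bullet> rvec (ev (i, j)) = a $ ix i + a $ ix j"
proof -
  have "rvec (ev (i, j)) = axis (ix i) 1 + axis (ix j) 1"
    by (simp add: rvec_def edge_vec_def std_basis_def axis_def ix[symmetric] Finite_Cartesian_Product.vec_eq_iff)
  then show ?thesis by (simp add: inner_add_right inner_axis)
qed

lemma face_points_edges: "face_points (ev ` E) Q = ev ` {e \<in> E. rvec (ev e) \<in> Q}"
  by (auto simp: face_points_def)

lemma face_eq_hull:
  assumes "Q face_of newton_polytope (ev ` E)"
  shows "Q = convex hull (rvec ` face_points (ev ` E) Q)"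
proof
  have "compact (rvec ` ev ` E)" using finite_E by (intro finite_imp_compact) simp
  then obtain S where S: "S \<subseteq> rvec ` ev ` E" "Q = convex hull S"
    using assms unfolding newton_polytope_def by (elim face_of_convex_hull_subset)
  have "S \<subseteq> rvec ` face_points (ev ` E) Q"
  proof
    fix x assume "x \<in> S"
    moreover from this have "x \<in> Q" unfolding S(2) by (rule hull_inc)
    ultimately show "x \<in> rvec ` face_points (ev ` E) Q" using S(1) by (auto simp: face_points_def)
  qed
  then show "Q \<subseteq> convex hull (rvec ` face_points (ev ` E) Q)"
    unfolding S(2) by (rule hull_mono)
  show "convex hull (rvec ` face_points (ev ` E) Q) \<subseteq> Q"
    by (rule hull_minimal) (use face_of_imp_convex[OF assms] in \<open>auto simp: face_points_def\<close>)
qed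

text \<open>A linear functional that is constant on the edges of a connected graph takes the same value on
  every further edge between its vertices.\<close>

lemma face_edges_induced:
  assumes Q: "Q face_of newton_polytope (ev ` E)"
  defines "F \<equiv> {e \<in> E. rvec (ev e) \<in> Q}"
  assumes con: "graph_connected (fst ` F \<union> snd ` F) F"
  shows "F = induced_edges E (fst ` F \<union> snd ` F)"
proof
  show "F \<subseteq> induced_edges E (fst ` F \<union> snd ` F)"
    by (auto simp: F_def induced_edges_def image_iff)
  have "polyhedron (newton_polytope (ev ` E))"
    unfolding newton_polytope_def using finite_E
    by (intro polytope_imp_polyhedron polytope_convex_hull) simp
  then have "Q exposed_face_of newton_polytope (ev ` E)"
    using Q exposed_face_of_polyhedron by blast
  then obtain a b where ab: "Q = newton_polytope (ev ` E) \<inter> {x. a \<bullet> x = b}"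
    unfolding exposed_face_of_def by blast
  have F: "a $ ix i + a $ ix j = b" if "(i, j) \<in> F" for i j
    using that rvec_ev_inner[of i j a] unfolding F_def ab by simp
  \<comment> \<open>The reflection on the right side turns \<open>a $ ix i + a $ ix j = b\<close>
    into \<open>h i = h j\<close>, an equation that spreads along paths.\<close>
  define h where "h l = (if l \<le> k then a $ ix l else b - a $ ix l)" for l
  have h_edge: "h i = h j" if "(i, j) \<in> F" for i j
    using F[OF that] that E_bounds[of i j] by (simp add: h_def F_def)
  have h_path: "h x = h y" if "(x, y) \<in> (F \<union> F\<inverse>)\<^sup>*" for x y
    using that by induction (use h_edge in force)+
  show "induced_edges E (fst ` F \<union> snd ` F) \<subseteq> F"
  proof
    fix e assume e: "e \<in> induced_edges E (fst ` F \<union> snd ` F)"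
    obtain i j where ij: "e = (i, j)" by (cases e)
    have E': "(i, j) \<in> E" and v: "i \<in> fst ` F \<union> snd ` F" "j \<in> fst ` F \<union> snd ` F"
      using e ij by (simp_all add: induced_edges_def)
    then have "h i = h j" using con h_path unfolding graph_connected_def by blast
    then have "a $ ix i + a $ ix j = b" using E_bounds[OF E'] by (simp add: h_def)
    moreover have "rvec (ev (i, j)) \<in> newton_polytope (ev ` E)"
      unfolding newton_polytope_def using E' by (intro hull_inc) blast
    ultimately show "e \<in> F" using E' by (simp add: F_def ij ab rvec_ev_inner)
  qed
qed

text \<open>The functional counts the ends of an edge that lie in I or J. It is at most 2, with
  equality exactly for the induced edges, so its hyperplane cuts out the face spanned by
  them.\<close>

lemma edge_face_supporting:
  assumes T: "I \<union> J \<subseteq> {..n}"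
  defines "a \<equiv> (\<chi> v. if v \<in> ix ` (I \<union> J) then 1 else 0)"
  shows "newton_polytope (ev ` E) \<inter> {x. a \<bullet> x = 2} face_of newton_polytope (ev ` E)"
    and "{e \<in> E. a \<bullet> rvec (ev e) = 2} = induced_edges E (I \<union> J)"
    and "edge_face E I J = newton_polytope (ev ` E) \<inter> {x. a \<bullet> x = 2}"
proof -
  have a: "a $ ix l = (if l \<in> I \<union> J then 1 else 0)" if "l \<le> n" for l
    using that T by (auto simp: a_def image_iff)
  have val: "a \<bullet> rvec (ev (i, j)) = (if i \<in> I \<union> J then 1 else 0) + (if j \<in> I \<union> J then 1 else 0)"
    if "(i, j) \<in> E" for i j
    using E_bounds[OF that] by (simp add: rvec_ev_inner[OF that] a)
  have "a \<bullet> x \<le> 2" if "x \<in> newton_polytope (ev ` E)" for x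
  proof -
    have "newton_polytope (ev ` E) \<subseteq> {x. a \<bullet> x \<le> 2}"
      unfolding newton_polytope_def by (rule hull_minimal) (auto simp: val convex_halfspace_le)
    then show ?thesis using that by blast
  qed
  then show face: "newton_polytope (ev ` E) \<inter> {x. a \<bullet> x = 2} face_of newton_polytope (ev ` E)"
    by (intro face_of_Int_supporting_hyperplane_le) (simp_all add: newton_polytope_def)
  show F: "{e \<in> E. a \<bullet> rvec (ev e) = 2} = induced_edges E (I \<union> J)"
    by (auto simp: induced_edges_def val split: if_splits)
  have "{e \<in> E. rvec (ev e) \<in> newton_polytope (ev ` E) \<inter> {x. a \<bullet> x = 2}} = induced_edges E (I \<union> J)"
    unfolding F[symmetric] by (auto simp: newton_polytope_def intro!: hull_inc)
  then show "edge_face E I J = newton_polytope (ev ` E) \<inter> {x. a \<bullet> x = 2}"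
    using face_eq_hull[OF face] by (simp add: face_points_edges edge_face_def edge_vectors_image)
qed

lemma edge_face_face_of:
  "I \<union> J \<subseteq> {..n} \<Longrightarrow> edge_face E I J face_of newton_polytope (ev ` E)"
  using edge_face_supporting(1,3) by metis

lemma edge_face_edges:
  assumes "I \<union> J \<subseteq> {..n}"
  shows "{e \<in> E. rvec (ev e) \<in> edge_face E I J} = induced_edges E (I \<union> J)"
  unfolding edge_face_supporting(3)[OF assms] edge_face_supporting(2)[OF assms, symmetric]
  by (auto simp: newton_polytope_def intro!: hull_inc)

text \<open>Up to sign, all vertices of a connected bipartite graph are congruent modulo its edges.\<close>

lemma balanced_in_group_closure:
  assumes I: "I \<subseteq> {0..k}" and J: "J \<subseteq> {k + 1..n}" and F: "F \<subseteq> I \<times> J" and "r \<in> I"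
    and con: "graph_connected (I \<union> J) F"
    and supp: "\<And>l. l \<le> n \<Longrightarrow> l \<notin> I \<union> J \<Longrightarrow> v $ ix l = 0"
    and bal: "(\<Sum>l\<in>I. v $ ix l) = (\<Sum>l\<in>J. v $ ix l)"
  shows "v \<in> group_closure (ev ` F)"
proof -
  let ?H = "group_closure (ev ` F)"
  define s where "s l = (if l \<le> k then 1 else -1 :: int)" for l
  define w where "w l = s l *s (std_basis l :: int ^ 'v)" for l
  have IJ: "l \<le> n" if "l \<in> I \<union> J" for l using that I J kn by auto
  have edge: "w i - w j \<in> ?H" if "(i, j) \<in> F" for i j
  proof -
    have "w i - w j = ev (i, j)"
      using that F I J by (auto simp: w_def s_def edge_vec_def Finite_Cartesian_Product.vec_eq_iff)
    then show ?thesis using that by (auto intro: group_closure.base)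
  qed
  have path: "w x - w y \<in> ?H" if "(x, y) \<in> (F \<union> F\<inverse>)\<^sup>*" for x y
    using that
  proof induction
    case (step y z)
    have "w y - w z \<in> ?H"
      using step.hyps(2) edge[of y z] edge[of z y] group_closure_minus_iff[of "w z - w y"] by auto
    then have "(w x - w y) + (w y - w z) \<in> ?H" using step.IH by (rule group_closure_add[rotated])
    then show ?case by simp
  qed simp
  have fin: "finite I" "finite J" using I J by (auto intro: finite_subset)
  have disj: "I \<inter> J = {}" using I J by force
  define c where "c l = v $ ix l * s l" for l
  have "(\<Sum>l\<in>I \<union> J. c l) = (\<Sum>l\<in>I. c l) + (\<Sum>l\<in>J. c l)"
    using fin disj by (rule sum.union_disjoint)
  also have "(\<Sum>l\<in>I. c l) = (\<Sum>l\<in>I. v $ ix l)"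
    by (rule sum.cong) (use I in \<open>auto simp: c_def s_def\<close>)
  also have "(\<Sum>l\<in>J. c l) = (\<Sum>l\<in>J. - (v $ ix l))"
    by (rule sum.cong) (use J in \<open>auto simp: c_def s_def\<close>)
  finally have c0: "(\<Sum>l\<in>I \<union> J. c l) = 0" using bal by (simp add: sum_negf)
  have ss: "s l * s l = 1" for l by (simp add: s_def)
  \<comment> \<open>Since the coefficients add up to zero, each signed basis vector may be replaced
    by its difference to that of \<open>r\<close>, which lies in the group.\<close>
  have "v = (\<Sum>l\<in>I \<union> J. c l *s (w l - w r))"
  proof (rule Finite_Cartesian_Product.vec_eq_iff[THEN iffD2], rule allI)
    fix u
    obtain t where t: "t \<le> n" "u = ix t" by (rule ix_surj)
    have "(\<Sum>l\<in>I \<union> J. c l *s (w l - w r)) $ u = (\<Sum>l\<in>I \<union> J. c l * (w l $ u) - c l * (w r $ u))"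
      by (simp add: sum_component right_diff_distrib)
    also have "\<dots> = (\<Sum>l\<in>I \<union> J. c l * (w l $ u))"
      by (simp add: sum_subtractf c0 sum_distrib_right[symmetric])
    also have "\<dots> = (\<Sum>l\<in>I \<union> J. if l = t then v $ ix t else 0)"
      by (rule sum.cong) (use t IJ ss in \<open>auto simp: w_def c_def std_basis_ix\<close>)
    also have "\<dots> = v $ u" using fin t supp by auto
    finally show "v $ u = (\<Sum>l\<in>I \<union> J. c l *s (w l - w r)) $ u" by simp
  qed
  also have "\<dots> \<in> ?H"
  proof (intro group_closure_sum group_closure_scale_int path)
    fix l assume "l \<in> I \<union> J"
    then show "(l, r) \<in> (F \<union> F\<inverse>)\<^sup>*" using con \<open>r \<in> I\<close> by (auto simp: graph_connected_def)
  qed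
  finally show ?thesis .
qed

text \<open>The edge vectors of the face have zero coordinates off I and J, and equal coordinate
  sums over I and J. These equations pass to the integer points of the span, and by
  \<open>balanced_in_group_closure\<close> their integer solutions are generated by the edges; so
  the two lattices coincide.\<close>

lemma face_index_strong_hall:
  assumes I: "I \<subseteq> {0..k}" and J: "J \<subseteq> {k + 1..n}" and sh: "strong_hall I J (induced_edges E (I \<union> J))"
  shows "face_index (edge_face E I J) (ev ` E) = 1"
proof -
  define F where "F = induced_edges E (I \<union> J)"
  have sh: "strong_hall I J F" using sh by (simp add: F_def)
  have T: "I \<union> J \<subseteq> {..n}" using I J kn by auto
  have FE: "F \<subseteq> E" by (auto simp: F_def induced_edges_def)
  have FIJ: "F \<subseteq> I \<times> J" and fin: "finite I" "finite J" and "I \<noteq> {}" using sh by (auto simp: strong_hall_def)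
  then obtain r where r: "r \<in> I" by blast
  define G where "G = {v. rvec v \<in> span (edge_face E I J :: (real ^ 'v) set)}"
  have fp: "face_points (ev ` E) (edge_face E I J) = ev ` F"
    using edge_face_edges[OF T] by (simp add: face_points_edges F_def)
  have hull: "edge_face E I J = convex hull (rvec ` ev ` F)"
    by (simp add: edge_face_def edge_vectors_image F_def)
  have G0: "0 \<in> G" by (simp add: G_def rvec_0 span_zero)
  have Gd: "x - y \<in> G" if "x \<in> G" "y \<in> G" for x y
    using that by (simp add: G_def rvec_diff span_diff)
  define L where "L = {x :: real ^ 'v. (\<forall>l\<le>n. l \<notin> I \<union> J \<longrightarrow> x $ ix l = 0) \<and>
    (\<Sum>l\<in>I. x $ ix l) = (\<Sum>l\<in>J. x $ ix l)}"
  have subL: "subspace L"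
    by (auto simp: subspace_def L_def sum.distrib sum_distrib_left[symmetric])
  have "rvec (ev (i, j)) \<in> L" if ij: "(i, j) \<in> F" for i j
  proof -
    have b: "i \<le> k" "k < j" "j \<le> n" "i \<le> n" using E_bounds FE ij by blast+
    have ij': "i \<in> I" "j \<in> J" "i \<notin> J" "j \<notin> I" using FIJ ij I J b by auto
    have x: "rvec (ev (i, j)) $ ix l = (if l = i then 1 else 0) + (if l = j then 1 else 0)" if "l \<le> n" for l
      using that b by (simp add: rvec_def ev_ix)
    have "(\<Sum>l\<in>I. rvec (ev (i, j)) $ ix l) = (\<Sum>l\<in>I. if l = i then 1 else 0)"
      by (rule sum.cong) (use x T ij' in auto)
    moreover have "(\<Sum>l\<in>J. rvec (ev (i, j)) $ ix l) = (\<Sum>l\<in>J. if l = j then 1 else 0)"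
      by (rule sum.cong) (use x T ij' in auto)
    ultimately show ?thesis using fin ij' x by (auto simp: L_def)
  qed
  then have genL: "rvec ` ev ` F \<subseteq> L" by auto
  then have "edge_face E I J \<subseteq> L"
    unfolding hull by (rule hull_minimal) (rule subspace_imp_convex[OF subL])
  then have spanL: "span (edge_face E I J) \<subseteq> L" by (rule span_minimal) (rule subL)
  have "G = group_closure (ev ` F)"
  proof
    show "G \<subseteq> group_closure (ev ` F)"
    proof
      fix v assume "v \<in> G"
      then have "rvec v \<in> L" using spanL by (auto simp: G_def)
      then have "v $ ix l = 0" if "l \<le> n" "l \<notin> I \<union> J" for l
        using that by (auto simp: L_def rvec_def)
      moreover have "(\<Sum>l\<in>I. v $ ix l) = (\<Sum>l\<in>J. v $ ix l)"
      proof -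
        have "real_of_int (\<Sum>l\<in>I. v $ ix l) = real_of_int (\<Sum>l\<in>J. v $ ix l)"
          using \<open>rvec v \<in> L\<close> by (simp add: L_def rvec_def)
        then show ?thesis by (simp only: of_int_eq_iff)
      qed
      ultimately show "v \<in> group_closure (ev ` F)"
        using balanced_in_group_closure[OF I J FIJ r strong_hall_connected[OF sh]] by blast
    qed
    show "group_closure (ev ` F) \<subseteq> G"
    proof (rule group_closure_subset[OF _ G0 Gd])
      show "ev ` F \<subseteq> G" unfolding G_def hull by (auto intro!: span_base hull_inc)
    qed
  qed
  then show ?thesis
    using subgroup_index_self[OF G0 Gd] by (simp add: face_index_def fp G_def[symmetric])
qed

definition good_pairs :: "(nat set \<times> nat set) set" where
  "good_pairs = {(I, J). I \<noteq> {} \<and> I \<subseteq> {0..k} \<and> J \<noteq> {} \<and> J \<subseteq> {k + 1..n} \<and> card I = card J \<and>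
     graph_connected (I \<union> J) (induced_edges E (I \<union> J)) \<and> condition_star I J (induced_edges E (I \<union> J))}"

lemma good_pairs_iff:
  "(I, J) \<in> good_pairs \<longleftrightarrow> I \<subseteq> {0..k} \<and> J \<subseteq> {k + 1..n} \<and> strong_hall I J (induced_edges E (I \<union> J))"
proof (cases "I \<subseteq> {0..k} \<and> J \<subseteq> {k + 1..n} \<and> I \<noteq> {} \<and> J \<noteq> {}")
  case True
  then have IJ: "I \<subseteq> {0..k}" "J \<subseteq> {k + 1..n}" by simp_all
  have "induced_edges E (I \<union> J) \<subseteq> I \<times> J"
  proof
    fix e assume "e \<in> induced_edges E (I \<union> J)"
    moreover obtain i j where ij: "e = (i, j)" by (cases e)
    ultimately have e: "(i, j) \<in> E" "i \<in> I \<union> J" "j \<in> I \<union> J" by (simp_all add: induced_edges_def)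
    have "i \<notin> J" "j \<notin> I" using E_bounds[OF e(1)] IJ by auto
    then show "e \<in> I \<times> J" using e ij by simp
  qed
  moreover have "finite I" "finite J" using IJ by (auto intro: finite_subset)
  moreover have "I \<inter> J = {}" using IJ by force
  ultimately show ?thesis using True by (simp add: good_pairs_def strong_hall_iff)
next
  case False
  then show ?thesis by (auto simp: good_pairs_def strong_hall_def)
qed

lemma finite_good_pairs: "finite good_pairs"
proof (rule finite_subset)
  show "good_pairs \<subseteq> Pow {0..k} \<times> Pow {k + 1..n}" by (auto simp: good_pairs_def)
qed simp

text \<open>The inverse sends a face to the left and right ends of its edges. Under Hall's condition
  no vertex of I or J is isolated, which gives injectivity; a nondefective face contains all edges
  between its vertices, which gives surjectivity.\<close>

lemma nondefective_faces:
  "bij_betw (\<lambda>(I, J). edge_face E I J) good_pairs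
    {Q. Q face_of newton_polytope (ev ` E) \<and> Q \<noteq> {} \<and> nondefective (face_points (ev ` E) Q)}"
    (is "bij_betw ?g _ ?faces")
proof -
  have T: "I \<union> J \<subseteq> {..n}" if "(I, J) \<in> good_pairs" for I J
  proof -
    have "I \<subseteq> {0..k}" "J \<subseteq> {k + 1..n}" using that by (simp_all add: good_pairs_iff)
    then show ?thesis using kn by auto
  qed
  have img: "fst ` induced_edges E (I \<union> J) = I" "snd ` induced_edges E (I \<union> J) = J"
    if "(I, J) \<in> good_pairs" for I J
    using that strong_hall_images[of I J "induced_edges E (I \<union> J)"] by (simp_all add: good_pairs_iff)
  have "inj_on ?g good_pairs"
  proof (rule inj_onI, clarify)
    fix I J I' J' assume g: "(I, J) \<in> good_pairs" "(I', J') \<in> good_pairs"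
      and eq: "(edge_face E I J :: (real ^ 'v) set) = edge_face E I' J'"
    then have "induced_edges E (I \<union> J) = induced_edges E (I' \<union> J')"
      using edge_face_edges[OF T[OF g(1)]] edge_face_edges[OF T[OF g(2)]] by simp
    then show "I = I' \<and> J = J'" using img[OF g(1)] img[OF g(2)] by simp
  qed
  moreover have "?g ` good_pairs = ?faces"
  proof
    show "?g ` good_pairs \<subseteq> ?faces"
    proof clarify
      fix I J assume g: "(I, J) \<in> good_pairs"
      have nd: "nondefective (ev ` induced_edges E (I \<union> J))"
        using g discriminant_strong_hall(1) by (simp add: good_pairs_iff)
      have "induced_edges E (I \<union> J) \<noteq> {}" using img(1)[OF g] g by (auto simp: good_pairs_def)
      then have "(edge_face E I J :: (real ^ 'v) set) \<noteq> {}"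
        by (simp add: edge_face_def edge_vectors_image)
      then show "edge_face E I J face_of newton_polytope (ev ` E) \<and>
          (edge_face E I J :: (real ^ 'v) set) \<noteq> {} \<and> nondefective (face_points (ev ` E) (edge_face E I J))"
        using nd edge_face_face_of[OF T[OF g]] edge_face_edges[OF T[OF g]]
        by (simp add: face_points_edges)
    qed
    show "?faces \<subseteq> ?g ` good_pairs"
    proof clarify
      fix Q assume Q: "Q face_of newton_polytope (ev ` E)" and nd: "nondefective (face_points (ev ` E) Q)"
      define F where "F = {e \<in> E. rvec (ev e) \<in> Q}"
      have FE: "F \<subseteq> E" by (simp add: F_def)
      have fp: "face_points (ev ` E) Q = ev ` F" by (simp add: face_points_edges F_def)
      have sh: "strong_hall (fst ` F) (snd ` F) F"
        by (rule nondefective_strong_hall[OF FE]) (use nd fp in simp)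
      have F: "F = induced_edges E (fst ` F \<union> snd ` F)"
        unfolding F_def by (rule face_edges_induced[OF Q]) (use strong_hall_connected[OF sh] F_def in simp)
      have "fst ` F \<subseteq> {0..k}" "snd ` F \<subseteq> {k + 1..n}" using FE E by auto
      then have "(fst ` F, snd ` F) \<in> good_pairs" using sh F by (simp add: good_pairs_iff)
      moreover have "Q = edge_face E (fst ` F) (snd ` F)"
        using face_eq_hull[OF Q] F by (simp add: fp edge_face_def edge_vectors_image)
      ultimately show "Q \<in> ?g ` good_pairs" by (intro image_eqI[of _ _ "(fst ` F, snd ` F)"]) auto
    qed
  qed
  ultimately show ?thesis by (simp add: bij_betw_def)
qed

text \<open>Each chosen discriminant carries its own scalar; raised to the exponents of their
  factors, these scalars are collected in c.\<close>

lemma principal_determinant_edges: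
  "\<exists>c. c \<noteq> 0 \<and> principal_determinant (ev ` E) = pconst c *
    (\<Prod>(I, J)\<in>good_pairs. Determinant.det (edge_submatrix k n E I J) ^ face_volume (ev ` E) (edge_face E I J))"
proof -
  let ?A = "ev ` E"
  let ?d = "\<lambda>(I, J). Determinant.det (edge_submatrix k n E I J) :: (int ^ 'v) cpoly"
  let ?v = "\<lambda>(I, J). face_volume ?A (edge_face E I J)"
  have "\<forall>x\<in>good_pairs. \<exists>c. c \<noteq> 0 \<and>
      discriminant (face_points ?A (case x of (I, J) \<Rightarrow> edge_face E I J)) = pconst c * ?d x \<and>
      face_index (case x of (I, J) \<Rightarrow> edge_face E I J) ?A = 1"
  proof
    fix x assume "x \<in> good_pairs"
    moreover obtain I J where x: "x = (I, J)" by (cases x)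
    ultimately have IJ: "I \<subseteq> {0..k}" "J \<subseteq> {k + 1..n}" "strong_hall I J (induced_edges E (I \<union> J))"
      by (simp_all add: good_pairs_iff)
    have "I \<union> J \<subseteq> {..n}" using IJ(1,2) kn by auto
    then have "face_points ?A (edge_face E I J) = ev ` induced_edges E (I \<union> J)"
      using edge_face_edges by (simp add: face_points_edges)
    then show "\<exists>c. c \<noteq> 0 \<and>
        discriminant (face_points ?A (case x of (I, J) \<Rightarrow> edge_face E I J)) = pconst c * ?d x \<and>
        face_index (case x of (I, J) \<Rightarrow> edge_face E I J) ?A = 1"
      using discriminant_strong_hall(2)[OF IJ] face_index_strong_hall[OF IJ] by (simp add: x)
  qed
  then obtain c where c: "\<And>x. x \<in> good_pairs \<Longrightarrow> c x \<noteq> 0 \<and>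
      discriminant (face_points ?A (case x of (I, J) \<Rightarrow> edge_face E I J)) = pconst (c x) * ?d x \<and>
      face_index (case x of (I, J) \<Rightarrow> edge_face E I J) ?A = 1" by metis
  have "principal_determinant ?A = (\<Prod>x\<in>good_pairs. pconst (c x ^ ?v x) * ?d x ^ ?v x)"
    unfolding principal_determinant_def prod.reindex_bij_betw[OF nondefective_faces, symmetric]
    by (rule prod.cong) (auto dest!: c simp: power_mult_distrib pconst_power)
  also have "\<dots> = pconst (\<Prod>x\<in>good_pairs. c x ^ ?v x) * (\<Prod>x\<in>good_pairs. ?d x ^ ?v x)"
    by (simp add: prod.distrib prod_pconst)
  also have "(\<Prod>x\<in>good_pairs. ?d x ^ ?v x) = (\<Prod>(I, J)\<in>good_pairs.
      Determinant.det (edge_submatrix k n E I J) ^ face_volume ?A (edge_face E I J))"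
    by (rule prod.cong) auto
  finally show ?thesis using c finite_good_pairs
    by (intro exI[of _ "\<Prod>x\<in>good_pairs. c x ^ ?v x"]) simp
qed

end

theorem theorem3p9:
  fixes k n :: nat and E :: "(nat \<times> nat) set" and A\<^sub>G :: "(int ^ 'v::finite) set"
  assumes "CARD('v) = n + 1"
    and "k < n"
    and "E \<subseteq> {0..k} \<times> {k + 1..n}"
    and "graph_connected {0..n} E"
    and "A\<^sub>G = edge_vectors E"
  shows "\<exists>c. c \<noteq> 0 \<and> principal_determinant A\<^sub>G = pconst c *
    (\<Prod>(I, J) \<in> {(I, J). I \<noteq> {} \<and> I \<subseteq> {0..k} \<and> J \<noteq> {} \<and> J \<subseteq> {k + 1..n} \<and> card I = card J \<and>
         graph_connected (I \<union> J) (induced_edges E (I \<union> J)) \<and>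
         condition_star I J (induced_edges E (I \<union> J))}.
       Determinant.det (edge_submatrix k n E I J) ^ face_volume A\<^sub>G (edge_face E I J))"
proof -
  interpret edge_polytope k n E "from_nat_into UNIV :: nat \<Rightarrow> 'v"
    by unfold_locales (use assms in auto)
  show ?thesis
    using principal_determinant_edges unfolding good_pairs_def assms(5) edge_vectors_image .
qed

end
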